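(* Let $P$ be a topological operad, $Q$ a reduced operad and $M$ a $(P\text{-}Q)$-bimodule. If the operad $Q$ is well-pointed, then the $(P\text{-}Q)$-bimodule $M^f$ is Reedy fibrant.
   Context: $Top$ is the category of $k$-spaces with the Quillen model structure. Operads are symmetric topological operads with unit $\ast_1\in O(1)$; $Q$ reduced means $Q(0)=\{\ast_0\}$; $Q$ well-pointed means that $\{\ast_1\}\to Q(1)$ is a cofibration in $Top$. A $(P\text{-}Q)$-bimodule is a sequence of right $\Sigma_n$-spaces $M(n)$, $n\ge0$, with right operations $M(n)\times\prod_{i=1}^n Q(m_i)\to M(\sum m_i)$ (equivalently $\circ^i:M(n)\times Q(m)\to M(n+m-1)$) and left operations $\gamma_\ell:P(n)\times\prod_{i=1}^n M(m_i)\to M(\sum m_i)$ satisfying the usual associativity, unit, equivariance and commutation axioms; for $n=0$ this includes $\gamma_0:P(0)\to M(0)$. Reedy fibrancy. Let $\Lambda_+$ be the category of the sets $[n]=\{1,\dots,n\}$, $n\ge0$, and order preserving injections. A bimodule $N$ is a contravariant functor on $\Lambda_+$, with the injection $s_i:[n-1]\to[n]$ missing $i$ acting by $x\mapsto x\circ^i\ast_0$. Its matching object is $\mathcal{M}(N)(n)=\lim_{h\in\Lambda_+([\ell],[n]),\,\ell<n}N(\ell)$. $N$ is Reedy fibrant if the canonical map $N(n)\to\mathcal{M}(N)(n)$ is a Serre fibration for every $n\ge0$. Construction of $M^f$. Let $\mathbb{P}[n]$ be the set of planar rooted trees $T$ whose root $r$ has exactly $n$ incoming edges (other vertices $v$ have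 any arity $|v|\ge0$). Let $|T|$ be the number of leaves of $T$, labelled in planar order, and $V(T)$ the set of vertices, partially ordered by $v<v'$ if the path from $v'$ to the root passes through $v$. Put $D(T)=\prod_{v\in V(T)\setminus\{r\}}Q(|v|)$ and $H(T)=\{\{t_v\}\in[0,1]^{V(T)\setminus\{r\}}: t_v\le t_{v'}\text{ whenever } v<v'\}$. For $m\in M(n)$, $T\in\mathbb{P}[n]$ and $\{q_v\}\in D(T)$ let $m\circ\{q_v\}\in M(|T|)$ be the composite obtained by putting $m$ at the root and $q_v$ at the vertices $v$. $M^f(n)\subset\prod_{T\in\mathbb{P}[n]}Map(H(T)\times D(T),M(|T|))$ is the subspace of families $\{f_T\}$ such that: 1. if a non-root vertex $v$ of arity one is labelled by $\ast_1$, then $f_T$ takes the same value as $f_{T\setminus\{v\}}$ on the remaining decorations, where $T\setminus\{v\}$ is obtained by removing $v$ and merging its two edges (the number $t_v$ is forgotten); 2. for a non-root vertex $v$ and a permutation $\sigma$ of its incoming edges, let $T\cdot\sigma$ be the tree with these edges permuted, with label of $v$ replaced by $q_v\cdot\sigma$ and other decorations unchanged; then $f_{T\cdot\sigma}$ on the new decorations equals $f_T$ acted on by the induced permutation $\sigma_L[T]\in\Sigma_{|T|}$ of the leaves (conventions as for composites: $m\circ(T\cdot\sigma\text{-decorations})=(m\circ\{q_v\})\cdot\sigma_L[T]$); 3. if an inner edge $e$ not connected to the root joins two vertices with the same number $t$, then $f_T$ takes the same value as $f_{T/e}$, where $e$ is contracted, the new vertex is labelled by the operadic composite in $Q$ of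 the two labels and by $t$; 4. for an inner edge $e$, write $T=T_e\circ_{i(e)}T'_e$, with $T_e$ containing the root and $T'_e$ the tree above $e$; if all vertices of $T'_e$ carry the number $1$, then $f_T$ equals $f_{T_e}(\text{decorations of }T_e)\circ^{i(e)}q'$, where $q'\in Q(|T'_e|)$ is the operadic composite of the labels of $T'_e$. Structure on $M^f$. Symmetric groups: for $\sigma\in\Sigma_n$, $(f\cdot\sigma)_T(\{t_v\},\{q_v\})=f_{T_\sigma}(\text{corresponding decorations})\cdot\sigma_L[T]$, where $T_\sigma$ is $T$ with the root edges permuted by $\sigma$ and $\sigma_L[T]$ is the induced leaf permutation (so that $(m\cdot\sigma)\circ\{q_v\}=(m\circ\{q_v\}_{T_\sigma})\cdot\sigma_L[T]$). Right operations: for $f\in M^f(n)$, $q\in Q(m)$, $T\in\mathbb{P}[n+m-1]$, $(f\circ^i q)_T$ is $f_{\delta_{i,m}(T)}$ evaluated on the decorations of $T$ together with the number $0$ and the label $q$ on the new vertex; here $\delta_{i,m}(T)\in\mathbb{P}[n]$ is obtained by making the root edges $i,\dots,i+m-1$ of $T$ the incoming edges of a new vertex attached to the root in position $i$ (for $m=0$: a new univalent vertex is attached to the root in position $i$). Left operations: for $p\in P(k)$, $f^i\in M^f(n_i)$, $T\in\mathbb{P}[n_1+\dots+n_k]$, $p(f^1,\dots,f^k)_T=\gamma_\ell(p;f^1_{T^1},\dots,f^k_{T^k})$, where $T^i\in\mathbb{P}[n_i]$ is obtained from $T$ by keeping only the root edges numbered $n_1+\dots+n_{i-1}+1,\dots,n_1+\dots+n_i$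 and what is above them, with the restricted decorations. One has $M^f(0)=M(0)$, and $\gamma_0:P(0)\to M^f(0)$ is that of $M$. *)

theory Defs
  imports "HOL-Analysis.Analysis" "HOL-Library.Sublist"
begin

section \<open>The category of k-spaces\<close>

text \<open>
  A k-space is a space in which a set is open as soon as its preimage under every continuous map
  from a compact Hausdorff space is open.  (The library predicate \<open>k_space\<close> tests on compact
  subspaces instead; this agrees for Hausdorff spaces, but otherwise does not give a cartesian
  closed category.)

  Quantification over \<^emph>\<open>all\<close> compact Hausdorff spaces (and, in \<open>cofibration\<close> below, over all
  trivial fibrations) has to be rendered by quantification over the topologies on one type.  The
  type \<open>'a huge\<close> is large enough for nothing to be lost.

  \<^item> Let \<open>f : K \<rightarrow> X\<close> be continuous, \<open>K\<close> compact Hausdorff of any cardinality, \<open>f(x) \<in> U\<close>, and let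
    the preimage of \<open>U\<close> not be a neighbourhood of \<open>x\<close>.  Choose for every open \<open>V\<close> containing \<open>f(x)\<close>
    a closed neighbourhood \<open>C V\<close> of \<open>x\<close> inside the preimage of \<open>V\<close>, and let \<open>S\<close> contain for every
    finite set of such \<open>V\<close> a point of the intersection of the \<open>C V\<close> that \<open>f\<close> maps outside \<open>U\<close>.
    These points have a cluster point \<open>w\<close> lying in all \<open>C V\<close>, so every neighbourhood of \<open>f(x)\<close>
    contains \<open>f(w)\<close>.  If \<open>f(w) \<in> U\<close>, then \<open>U\<close> fails the test on the closure of \<open>S\<close>; otherwise it
    fails the test on a convergent sequence, mapped constantly to \<open>f(w)\<close> with limit \<open>f(x)\<close>.
    Both compact spaces embed in \<open>'a huge\<close>.
  \<^item> The small object argument factors a map of spaces on \<open>'a\<close> as a relative cell complex followed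
    by a trivial fibration, with a middle space that embeds in \<open>'a huge\<close>.
\<close>

type_synonym 'a huge = "('a + real) set set set"

definition k_open :: "'a topology \<Rightarrow> 'a set \<Rightarrow> bool" where
  "k_open X U \<longleftrightarrow> U \<subseteq> topspace X \<and>
     (\<forall>(K :: 'a huge topology) f. compact_space K \<and> Hausdorff_space K \<and> continuous_map K X f
        \<longrightarrow> openin K {x \<in> topspace K. f x \<in> U})"

lemma istopology_k_open: "istopology (k_open X)"
  unfolding istopology_def
proof (intro conjI allI impI)
  fix S T assume "k_open X S" "k_open X T"
  moreover have "{x \<in> topspace K. f x \<in> S \<inter> T}
      = {x \<in> topspace K. f x \<in> S} \<inter> {x \<in> topspace K. f x \<in> T}" for K :: "'a huge topology" and f
    by auto
  ultimately show "k_open X (S \<inter> T)"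
    unfolding k_open_def by (auto intro: openin_Int)
next
  fix \<K> assume "\<forall>S\<in>\<K>. k_open X S"
  moreover have "{x \<in> topspace K. f x \<in> \<Union>\<K>}
      = (\<Union>S\<in>\<K>. {x \<in> topspace K. f x \<in> S})" for K :: "'a huge topology" and f
    by auto
  ultimately show "k_open X (\<Union>\<K>)"
    unfolding k_open_def by (auto intro!: openin_Union)
qed

definition kify :: "'a topology \<Rightarrow> 'a topology" where
  "kify X = topology (k_open X)"

lemma openin_kify: "openin (kify X) U \<longleftrightarrow> k_open X U"
  by (simp add: kify_def istopology_k_open topology_inverse')

lemma topspace_kify [simp]: "topspace (kify X) = topspace X"
proof -
  have "k_open X (topspace X)"
    unfolding k_open_def by (auto simp: continuous_map_def intro: openin_subopen[THEN iffD2])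
  then show ?thesis
    unfolding topspace_def openin_kify k_open_def by blast
qed

definition kspace :: "'a topology \<Rightarrow> bool" where
  "kspace X \<longleftrightarrow> (\<forall>U. k_open X U \<longrightarrow> openin X U)"

definition kprod :: "'a topology \<Rightarrow> 'b topology \<Rightarrow> ('a \<times> 'b) topology" where
  "kprod X Y = kify (prod_topology X Y)"

definition kproduct :: "'i set \<Rightarrow> ('i \<Rightarrow> 'a topology) \<Rightarrow> ('i \<Rightarrow> 'a) topology" where
  "kproduct I X = kify (product_topology X I)"

definition ksub :: "'a topology \<Rightarrow> 'a set \<Rightarrow> 'a topology" where
  "ksub X S = kify (subtopology X S)"

text \<open>
  The mapping space: the compact-open topology (tested on maps from compact Hausdorff spaces into
  \<open>X\<close>, as \<open>X\<close> need not be Hausdorff), made into a k-space.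
\<close>

definition maps :: "'a topology \<Rightarrow> 'b topology \<Rightarrow> ('a \<Rightarrow> 'b) set" where
  "maps X Y = {g \<in> extensional (topspace X). continuous_map X Y g}"

definition Map :: "'a topology \<Rightarrow> 'b topology \<Rightarrow> ('a \<Rightarrow> 'b) topology" where
  "Map X Y = kify (topology_generated_by
     {{g \<in> maps X Y. g ` f ` topspace K \<subseteq> U} | (K :: 'a huge topology) f U.
        compact_space K \<and> Hausdorff_space K \<and> continuous_map K X f \<and> openin Y U})"


section \<open>The Quillen model structure\<close>

definition lifting :: "'a topology \<Rightarrow> 'b topology \<Rightarrow> ('a \<Rightarrow> 'b)
    \<Rightarrow> 'e topology \<Rightarrow> 'c topology \<Rightarrow> ('e \<Rightarrow> 'c) \<Rightarrow> bool" where
  "lifting A X j E B p \<longleftrightarrow>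
     (\<forall>u v. continuous_map A E u \<and> continuous_map X B v \<and> (\<forall>a\<in>topspace A. p (u a) = v (j a))
        \<longrightarrow> (\<exists>w. continuous_map X E w \<and> (\<forall>a\<in>topspace A. w (j a) = u a)
                 \<and> (\<forall>x\<in>topspace X. p (w x) = v x)))"

definition disk :: "nat \<Rightarrow> (nat \<Rightarrow> real) topology" where
  "disk n = subtopology (Euclidean_space n) {x. (\<Sum>i<n. (x i)\<^sup>2) \<le> 1}"

text \<open>The boundary of \<open>disk n\<close>, which is empty for \<open>n = 0\<close>.\<close>

definition bdry :: "nat \<Rightarrow> (nat \<Rightarrow> real) topology" where
  "bdry n = subtopology (Euclidean_space n) {x. (\<Sum>i<n. (x i)\<^sup>2) = 1}"

definition serre_fibration :: "'e topology \<Rightarrow> 'b topology \<Rightarrow> ('e \<Rightarrow> 'b) \<Rightarrow> bool" where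
  "serre_fibration E B p \<longleftrightarrow> continuous_map E B p \<and>
     (\<forall>n. lifting (disk n) (prod_topology (disk n) (top_of_set {0..1::real})) (\<lambda>x. (x, 0)) E B p)"

definition trivial_fibration :: "'e topology \<Rightarrow> 'b topology \<Rightarrow> ('e \<Rightarrow> 'b) \<Rightarrow> bool" where
  "trivial_fibration E B p \<longleftrightarrow> continuous_map E B p \<and>
     (\<forall>n. lifting (bdry n) (disk n) (\<lambda>x. x) E B p)"

definition cofibration :: "'a topology \<Rightarrow> 'a topology \<Rightarrow> ('a \<Rightarrow> 'a) \<Rightarrow> bool" where
  "cofibration A X j \<longleftrightarrow> continuous_map A X j \<and>
     (\<forall>(E :: 'a huge topology) (B :: 'a huge topology) p.
        kspace E \<and> kspace B \<and> trivial_fibration E B p \<longrightarrow> lifting A X j E B p)"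


section \<open>Operads and bimodules\<close>

text \<open>
  Inputs are numbered from \<open>0\<close>, so \<open>\<Sigma>\<^sub>n\<close> consists of the \<open>\<sigma>\<close> with \<open>\<sigma> permutes {..<n}\<close>.  For right
  actions the convention is that input \<open>j\<close> of \<open>x \<cdot> \<sigma>\<close> is input \<open>\<sigma> j\<close> of \<open>x\<close>.

  \<open>block_perm k ns \<sigma> \<tau>\<close> moves the \<open>j\<close>-th of \<open>k\<close> consecutive blocks (of lengths \<open>ns 0, ns 1, \<dots>\<close>)
  to block position \<open>\<sigma> j\<close>, permuting its elements by \<open>\<tau> j\<close>.
\<close>

definition block_perm ::
  "nat \<Rightarrow> (nat \<Rightarrow> nat) \<Rightarrow> (nat \<Rightarrow> nat) \<Rightarrow> (nat \<Rightarrow> nat \<Rightarrow> nat) \<Rightarrow> nat \<Rightarrow> nat" where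
  "block_perm k ns \<sigma> \<tau> p =
     (if p < (\<Sum>l<k. ns l)
      then let j = (LEAST j. p < (\<Sum>l\<le>j. ns l))
           in (\<Sum>l<\<sigma> j. ns (inv \<sigma> l)) + \<tau> j (p - (\<Sum>l<j. ns l))
      else p)"

definition circ_perm ::
  "nat \<Rightarrow> nat \<Rightarrow> nat \<Rightarrow> (nat \<Rightarrow> nat) \<Rightarrow> (nat \<Rightarrow> nat) \<Rightarrow> nat \<Rightarrow> nat" where
  "circ_perm n m i \<sigma> \<tau> =
     block_perm n (\<lambda>j. if j = i then m else 1) \<sigma> (\<lambda>j. if j = i then \<tau> else id)"

definition symmetric_sequence ::
  "(nat \<Rightarrow> 'a topology) \<Rightarrow> (nat \<Rightarrow> (nat \<Rightarrow> nat) \<Rightarrow> 'a \<Rightarrow> 'a) \<Rightarrow> bool" where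
  "symmetric_sequence X act \<longleftrightarrow>
     (\<forall>n. kspace (X n)
        \<and> (\<forall>\<sigma>. \<sigma> permutes {..<n} \<longrightarrow> continuous_map (X n) (X n) (act n \<sigma>))
        \<and> (\<forall>x\<in>topspace (X n). act n id x = x)
        \<and> (\<forall>x\<in>topspace (X n). \<forall>\<sigma> \<tau>. \<sigma> permutes {..<n} \<and> \<tau> permutes {..<n}
              \<longrightarrow> act n (\<sigma> \<circ> \<tau>) x = act n \<tau> (act n \<sigma> x)))"

text \<open>
  \<open>op_circ Q n m i x y\<close> is \<open>x \<circ>\<^sub>i y\<close> for \<open>x \<in> Q(n)\<close>, \<open>y \<in> Q(m)\<close>, \<open>i < n\<close>.  The arities are arguments
  because the spaces of different arities, which live on the same type, need not be disjoint.
\<close>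

record 'a operad_data =
  op_space :: "nat \<Rightarrow> 'a topology"
  op_act :: "nat \<Rightarrow> (nat \<Rightarrow> nat) \<Rightarrow> 'a \<Rightarrow> 'a"
  op_circ :: "nat \<Rightarrow> nat \<Rightarrow> nat \<Rightarrow> 'a \<Rightarrow> 'a \<Rightarrow> 'a"
  op_unit :: 'a

locale right_module =
  fixes Q :: "'q operad_data"
    and X :: "nat \<Rightarrow> 'm topology"
    and act :: "nat \<Rightarrow> (nat \<Rightarrow> nat) \<Rightarrow> 'm \<Rightarrow> 'm"
    and circ :: "nat \<Rightarrow> nat \<Rightarrow> nat \<Rightarrow> 'm \<Rightarrow> 'q \<Rightarrow> 'm"
  assumes symmetric: "symmetric_sequence X act"
    and continuous: "i < n \<Longrightarrow>
          continuous_map (kprod (X n) (op_space Q m)) (X (n + m - 1)) (\<lambda>(x, q). circ n m i x q)"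
    and assoc_sequential:
        "\<lbrakk>i < n; j < m; x \<in> topspace (X n); q \<in> topspace (op_space Q m); r \<in> topspace (op_space Q l)\<rbrakk>
          \<Longrightarrow> circ (n + m - 1) l (i + j) (circ n m i x q) r
              = circ n (m + l - 1) i x (op_circ Q m l j q r)"
    and assoc_parallel:
        "\<lbrakk>i < k; k < n; x \<in> topspace (X n); q \<in> topspace (op_space Q m); r \<in> topspace (op_space Q l)\<rbrakk>
          \<Longrightarrow> circ (n + m - 1) l (k + m - 1) (circ n m i x q) r
              = circ (n + l - 1) m i (circ n l k x r) q"
    and right_unit: "\<lbrakk>i < n; x \<in> topspace (X n)\<rbrakk> \<Longrightarrow> circ n 1 i x (op_unit Q) = x"
    and equivariant:
        "\<lbrakk>i < n; \<sigma> permutes {..<n}; \<tau> permutes {..<m}; x \<in> topspace (X n); q \<in> topspace (op_space Q m)\<rbrakk>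
          \<Longrightarrow> circ n m i (act n \<sigma> x) (op_act Q m \<tau> q)
              = act (n + m - 1) (circ_perm n m i \<sigma> \<tau>) (circ n m (\<sigma> i) x q)"

text \<open>The remaining operad axioms say precisely that \<open>Q\<close> is a right module over itself.\<close>

locale operad = right_module Q "op_space Q" "op_act Q" "op_circ Q" for Q :: "'q operad_data" +
  assumes unit_in: "op_unit Q \<in> topspace (op_space Q 1)"
    and left_unit: "x \<in> topspace (op_space Q n) \<Longrightarrow> op_circ Q 1 n 0 (op_unit Q) x = x"

definition reduced_operad :: "'q operad_data \<Rightarrow> bool" where
  "reduced_operad Q \<longleftrightarrow> (\<exists>z. topspace (op_space Q 0) = {z})"

definition star0 :: "'q operad_data \<Rightarrow> 'q" where
  "star0 Q = (THE z. z \<in> topspace (op_space Q 0))"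

definition well_pointed :: "'q operad_data \<Rightarrow> bool" where
  "well_pointed Q \<longleftrightarrow>
     cofibration (subtopology (op_space Q 1) {op_unit Q}) (op_space Q 1) (\<lambda>x. x)"

text \<open>
  In \<open>bm_left M p [(n\<^sub>1, x\<^sub>1), \<dots>, (n\<^sub>k, x\<^sub>k)]\<close>, the value of the left operation \<open>\<gamma>\<^sub>\<ell>\<close> at
  \<open>p \<in> P(k)\<close> and the \<open>x\<^sub>i \<in> M(n\<^sub>i)\<close>, every argument is listed together with its arity.
\<close>

record ('p, 'q, 'm) bimodule_data =
  bm_space :: "nat \<Rightarrow> 'm topology"
  bm_act :: "nat \<Rightarrow> (nat \<Rightarrow> nat) \<Rightarrow> 'm \<Rightarrow> 'm"
  bm_right :: "nat \<Rightarrow> nat \<Rightarrow> nat \<Rightarrow> 'm \<Rightarrow> 'q \<Rightarrow> 'm"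
  bm_left :: "'p \<Rightarrow> (nat \<times> 'm) list \<Rightarrow> 'm"

definition arity_sum :: "(nat \<times> 'm) list \<Rightarrow> nat" where
  "arity_sum xs = sum_list (map fst xs)"

definition bm_args :: "('p, 'q, 'm) bimodule_data \<Rightarrow> (nat \<times> 'm) list set" where
  "bm_args M = {xs. \<forall>(n, x) \<in> set xs. x \<in> topspace (bm_space M n)}"

locale bimodule =
  P: operad P + Q: operad Q + right_module Q "bm_space M" "bm_act M" "bm_right M"
  for P :: "'p operad_data" and Q :: "'q operad_data" and M :: "('p, 'q, 'm) bimodule_data" +
  assumes left_continuous:
      "continuous_map
         (kprod (op_space P (length ns)) (kproduct {..<length ns} (\<lambda>i. bm_space M (ns ! i))))
         (bm_space M (sum_list ns))
         (\<lambda>(p, x). bm_left M p (map (\<lambda>i. (ns ! i, x i)) [0..<length ns]))"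
    and left_assoc:
      "\<lbrakk>p \<in> topspace (op_space P (length xs + 1 + length zs)); p' \<in> topspace (op_space P (length ys));
        xs \<in> bm_args M; ys \<in> bm_args M; zs \<in> bm_args M\<rbrakk>
       \<Longrightarrow> bm_left M (op_circ P (length xs + 1 + length zs) (length ys) (length xs) p p') (xs @ ys @ zs)
           = bm_left M p (xs @ (arity_sum ys, bm_left M p' ys) # zs)"
    and left_unit_action: "x \<in> topspace (bm_space M n) \<Longrightarrow> bm_left M (op_unit P) [(n, x)] = x"
    and left_equivariant:
      "\<lbrakk>p \<in> topspace (op_space P (length xs)); xs \<in> bm_args M; \<sigma> permutes {..<length xs}\<rbrakk>
       \<Longrightarrow> bm_left M (op_act P (length xs) \<sigma> p) xs
           = bm_act M (arity_sum xs) (block_perm (length xs) (\<lambda>j. fst (xs ! j)) \<sigma> (\<lambda>_. id))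
               (bm_left M p (map (\<lambda>j. xs ! inv \<sigma> j) [0..<length xs]))"
    and left_equivariant_args:
      "\<lbrakk>p \<in> topspace (op_space P (length xs)); xs \<in> bm_args M;
        \<And>j. j < length xs \<Longrightarrow> \<tau> j permutes {..<fst (xs ! j)}\<rbrakk>
       \<Longrightarrow> bm_left M p (map (\<lambda>j. (fst (xs ! j), bm_act M (fst (xs ! j)) (\<tau> j) (snd (xs ! j)))) [0..<length xs])
           = bm_act M (arity_sum xs) (block_perm (length xs) (\<lambda>j. fst (xs ! j)) id \<tau>) (bm_left M p xs)"
    and left_right_commute:
      "\<lbrakk>p \<in> topspace (op_space P (length xs + 1 + length zs)); xs \<in> bm_args M; zs \<in> bm_args M;
        x \<in> topspace (bm_space M n); i < n; q \<in> topspace (op_space Q m)\<rbrakk>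
       \<Longrightarrow> bm_right M (arity_sum xs + n + arity_sum zs) m (arity_sum xs + i)
             (bm_left M p (xs @ (n, x) # zs)) q
           = bm_left M p (xs @ (n + m - 1, bm_right M n m i x q) # zs)"


section \<open>Reedy fibrancy\<close>

definition inj_mor :: "nat \<Rightarrow> nat \<Rightarrow> (nat \<Rightarrow> nat) set" where
  "inj_mor l n = {h \<in> {..<l} \<rightarrow>\<^sub>E {..<n}. strict_mono_on {..<l} h}"

text \<open>
  An injection \<open>h\<close> into \<open>[n]\<close> is the composite of the injections \<open>s\<^sub>j\<close> with \<open>j\<close> missed by \<open>h\<close>;
  so it acts by inserting \<open>\<ast>\<^sub>0\<close> into the missed inputs, the largest one first.
\<close>

definition pull_back ::
  "'q operad_data \<Rightarrow> ('p, 'q, 'm) bimodule_data \<Rightarrow> nat \<Rightarrow> nat \<Rightarrow> (nat \<Rightarrow> nat) \<Rightarrow> 'm \<Rightarrow> 'm" where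
  "pull_back Q N n l h x =
     snd (foldr (\<lambda>j (k, y). (k - 1, bm_right N k 0 j y (star0 Q)))
            (filter (\<lambda>j. j \<notin> h ` {..<l}) [0..<n]) (n, x))"

definition matching_index :: "nat \<Rightarrow> (nat \<times> (nat \<Rightarrow> nat)) set" where
  "matching_index n = (SIGMA l:{..<n}. inj_mor l n)"

definition matching_object ::
  "'q operad_data \<Rightarrow> ('p, 'q, 'm) bimodule_data \<Rightarrow> nat \<Rightarrow> (nat \<times> (nat \<Rightarrow> nat) \<Rightarrow> 'm) topology" where
  "matching_object Q N n =
     ksub (kproduct (matching_index n) (\<lambda>(l, h). bm_space N l))
       {x. \<forall>(l, h) \<in> matching_index n. \<forall>k. \<forall>g \<in> inj_mor k l.
              pull_back Q N l k g (x (l, h)) = x (k, compose {..<k} h g)}"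

definition matching_map ::
  "'q operad_data \<Rightarrow> ('p, 'q, 'm) bimodule_data \<Rightarrow> nat \<Rightarrow> 'm \<Rightarrow> (nat \<times> (nat \<Rightarrow> nat) \<Rightarrow> 'm)" where
  "matching_map Q N n x = (\<lambda>(l, h) \<in> matching_index n. pull_back Q N n l h x)"

definition reedy_fibrant :: "'q operad_data \<Rightarrow> ('p, 'q, 'm) bimodule_data \<Rightarrow> bool" where
  "reedy_fibrant Q N \<longleftrightarrow>
     (\<forall>n. serre_fibration (bm_space N n) (matching_object Q N n) (matching_map Q N n))"


section \<open>Planar trees\<close>

text \<open>
  Planar rooted trees with vertices labelled in \<open>'d\<close>; unlabelled ones have type \<open>unit tree\<close>.
  A subtree is addressed by the list of edges leading to it from the root, whose address is \<open>[]\<close>.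
\<close>

datatype 'd tree = Leaf | Vert 'd "'d tree list"

fun leaves :: "'d tree \<Rightarrow> nat" where
  "leaves Leaf = 1"
| "leaves (Vert d ts) = sum_list (map leaves ts)"

fun kids :: "'d tree \<Rightarrow> 'd tree list" where
  "kids Leaf = []"
| "kids (Vert d ts) = ts"

fun subtree :: "'d tree \<Rightarrow> nat list \<Rightarrow> 'd tree option" where
  "subtree t [] = Some t"
| "subtree Leaf (i # a) = None"
| "subtree (Vert d ts) (i # a) = (if i < length ts then subtree (ts ! i) a else None)"

fun replace :: "'d tree \<Rightarrow> nat list \<Rightarrow> 'd tree \<Rightarrow> 'd tree" where
  "replace t [] s = s"
| "replace Leaf (i # a) s = Leaf"
| "replace (Vert d ts) (i # a) s = Vert d (ts[i := replace (ts ! i) a s])"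

text \<open>The number of leaves of a tree to the left of the subtree at the given address.\<close>

fun offset :: "'d tree \<Rightarrow> nat list \<Rightarrow> nat" where
  "offset t [] = 0"
| "offset Leaf (i # a) = 0"
| "offset (Vert d ts) (i # a) = sum_list (map leaves (take i ts)) + offset (ts ! i) a"

definition inner_vertices :: "'d tree \<Rightarrow> nat list set" where
  "inner_vertices t = {a. a \<noteq> [] \<and> (\<exists>d ts. subtree t a = Some (Vert d ts))}"

definition arity :: "'d tree \<Rightarrow> nat list \<Rightarrow> nat" where
  "arity t a = length (kids (the (subtree t a)))"

definition label :: "'d tree \<Rightarrow> nat list \<Rightarrow> 'd" where
  "label t a = (case subtree t a of Some (Vert d ts) \<Rightarrow> d)"

abbreviation shape :: "'d tree \<Rightarrow> unit tree" where
  "shape \<equiv> map_tree (\<lambda>_. ())"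

text \<open>The tree of shape \<open>t\<close> in which the vertex with address \<open>a\<close> is labelled by \<open>g a\<close>.\<close>

function decorate :: "unit tree \<Rightarrow> (nat list \<Rightarrow> 'd) \<Rightarrow> 'd tree" where
  "decorate Leaf g = Leaf"
| "decorate (Vert d ts) g =
     Vert (g []) (map (\<lambda>i. decorate (ts ! i) (\<lambda>a. g (i # a))) [0..<length ts])"
  by pat_completeness auto
termination
  by (relation "Wellfounded.measure (\<lambda>(t, g). size t)")
     (auto simp: less_Suc_eq_le intro!: size_list_estimation' nth_mem)

definition trees :: "nat \<Rightarrow> unit tree set" where
  "trees n = {Vert () ts | ts. length ts = n}"


section \<open>The bimodule \<open>M\<^sup>f\<close>\<close>

definition H_space :: "unit tree \<Rightarrow> (nat list \<Rightarrow> real) topology" where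
  "H_space T = subtopology (product_topology (\<lambda>_. top_of_set {0..1}) (inner_vertices T))
     {t. \<forall>v \<in> inner_vertices T. \<forall>w \<in> inner_vertices T. strict_prefix v w \<longrightarrow> t v \<le> t w}"

definition D_space :: "'q operad_data \<Rightarrow> unit tree \<Rightarrow> (nat list \<Rightarrow> 'q) topology" where
  "D_space Q T = kproduct (inner_vertices T) (\<lambda>v. op_space Q (arity T v))"

definition HD_space ::
  "'q operad_data \<Rightarrow> unit tree \<Rightarrow> ((nat list \<Rightarrow> real) \<times> (nat list \<Rightarrow> 'q)) topology" where
  "HD_space Q T = kprod (H_space T) (D_space Q T)"

text \<open>
  Pairs \<open>({t\<^sub>v}, {q\<^sub>v})\<close> and trees labelled by pairs \<open>(t\<^sub>v, q\<^sub>v)\<close> are two forms of the same data.  The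
  latter are used to describe operations on trees; such a tree also carries a label at its root,
  but this label is never used.
\<close>

definition decorations ::
  "(real \<times> 'q) tree \<Rightarrow> (nat list \<Rightarrow> real) \<times> (nat list \<Rightarrow> 'q)" where
  "decorations X = (\<lambda>v \<in> inner_vertices X. fst (label X v), \<lambda>v \<in> inner_vertices X. snd (label X v))"

definition decorated_trees :: "'q operad_data \<Rightarrow> nat \<Rightarrow> (real \<times> 'q) tree set" where
  "decorated_trees Q n =
     {X. shape X \<in> trees n \<and> decorations X \<in> topspace (HD_space Q (shape X))}"

type_synonym ('q, 'm) family =
  "unit tree \<Rightarrow> (nat list \<Rightarrow> real) \<times> (nat list \<Rightarrow> 'q) \<Rightarrow> 'm"

definition value_at :: "('q, 'm) family \<Rightarrow> (real \<times> 'q) tree \<Rightarrow> 'm" where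
  "value_at f X = f (shape X) (decorations X)"

definition family_of ::
  "'q operad_data \<Rightarrow> nat \<Rightarrow> ((real \<times> 'q) tree \<Rightarrow> 'm) \<Rightarrow> ('q, 'm) family" where
  "family_of Q n \<phi> =
     (\<lambda>T \<in> trees n. \<lambda>(t, q) \<in> topspace (HD_space Q T). \<phi> (decorate T (\<lambda>a. (t a, q a))))"

text \<open>
  \<open>insert_from circ n i x [(m\<^sub>0, y\<^sub>0), (m\<^sub>1, y\<^sub>1), \<dots>]\<close> inserts the \<open>y\<^sub>j\<close> (of arity \<open>m\<^sub>j\<close>) into the inputs
  \<open>i + j\<close> of \<open>x\<close> (of arity \<open>n\<close>), from left to right.
\<close>

fun insert_from :: "(nat \<Rightarrow> nat \<Rightarrow> nat \<Rightarrow> 'm \<Rightarrow> 'q \<Rightarrow> 'm) \<Rightarrow> nat \<Rightarrow> nat \<Rightarrow> 'm \<Rightarrow> (nat \<times> 'q) list \<Rightarrow> 'm" where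
  "insert_from circ n i x [] = x"
| "insert_from circ n i x ((m, y) # ys) = insert_from circ (n + m - 1) (i + m) (circ n m i x y) ys"

fun composite :: "'q operad_data \<Rightarrow> (real \<times> 'q) tree \<Rightarrow> 'q" where
  "composite Q Leaf = op_unit Q"
| "composite Q (Vert d ts) =
     insert_from (op_circ Q) (length ts) 0 (snd d) (map (\<lambda>s. (leaves s, composite Q s)) ts)"

text \<open>The permutation \<open>\<pi>\<close> of an interval of leaves starting at \<open>s\<close>.\<close>

definition shift_perm :: "nat \<Rightarrow> (nat \<Rightarrow> nat) \<Rightarrow> nat \<Rightarrow> nat" where
  "shift_perm s \<pi> p = (if p < s then p else s + \<pi> (p - s))"

definition Mf_unit :: "'q operad_data \<Rightarrow> nat \<Rightarrow> ('q, 'm) family \<Rightarrow> bool" where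
  "Mf_unit Q n f \<longleftrightarrow>
     (\<forall>X \<in> decorated_trees Q n. \<forall>a t S. a \<noteq> [] \<and> subtree X a = Some (Vert (t, op_unit Q) [S])
        \<longrightarrow> value_at f X = value_at f (replace X a S))"

definition Mf_perm ::
  "'q operad_data \<Rightarrow> ('p, 'q, 'm) bimodule_data \<Rightarrow> nat \<Rightarrow> ('q, 'm) family \<Rightarrow> bool" where
  "Mf_perm Q M n f \<longleftrightarrow>
     (\<forall>X \<in> decorated_trees Q n. \<forall>a t q ts \<sigma> ts'.
        a \<noteq> [] \<and> subtree X a = Some (Vert (t, q) ts) \<and> \<sigma> permutes {..<length ts} \<and>
        ts' = map (\<lambda>j. ts ! \<sigma> j) [0..<length ts]
        \<longrightarrow> value_at f (replace X a (Vert (t, op_act Q (length ts) \<sigma> q) ts'))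
            = bm_act M (leaves X)
                (shift_perm (offset X a) (block_perm (length ts) (\<lambda>j. leaves (ts' ! j)) \<sigma> (\<lambda>_. id)))
                (value_at f X))"

definition Mf_contract :: "'q operad_data \<Rightarrow> nat \<Rightarrow> ('q, 'm) family \<Rightarrow> bool" where
  "Mf_contract Q n f \<longleftrightarrow>
     (\<forall>X \<in> decorated_trees Q n. \<forall>a t q ts i q' ts'.
        a \<noteq> [] \<and> subtree X a = Some (Vert (t, q) ts) \<and> i < length ts \<and> ts ! i = Vert (t, q') ts'
        \<longrightarrow> value_at f X
            = value_at f (replace X a
                (Vert (t, op_circ Q (length ts) (length ts') i q q') (take i ts @ ts' @ drop (i + 1) ts))))"

definition Mf_top ::
  "'q operad_data \<Rightarrow> ('p, 'q, 'm) bimodule_data \<Rightarrow> nat \<Rightarrow> ('q, 'm) family \<Rightarrow> bool" where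
  "Mf_top Q M n f \<longleftrightarrow>
     (\<forall>X \<in> decorated_trees Q n. \<forall>a \<in> inner_vertices X. \<forall>S.
        subtree X a = Some S \<and> (\<forall>d \<in> set_tree S. fst d = 1)
        \<longrightarrow> value_at f X
            = bm_right M (leaves (replace X a Leaf)) (leaves S) (offset X a)
                (value_at f (replace X a Leaf)) (composite Q S))"

definition Mf_space ::
  "'q operad_data \<Rightarrow> ('p, 'q, 'm) bimodule_data \<Rightarrow> nat \<Rightarrow> ('q, 'm) family topology" where
  "Mf_space Q M n =
     ksub (kproduct (trees n) (\<lambda>T. Map (HD_space Q T) (bm_space M (leaves T))))
       {f. Mf_unit Q n f \<and> Mf_perm Q M n f \<and> Mf_contract Q n f \<and> Mf_top Q M n f}"

definition Mf_act ::
  "'q operad_data \<Rightarrow> ('p, 'q, 'm) bimodule_data \<Rightarrow> nat \<Rightarrow> (nat \<Rightarrow> nat)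
    \<Rightarrow> ('q, 'm) family \<Rightarrow> ('q, 'm) family" where
  "Mf_act Q M n \<sigma> f = family_of Q n (\<lambda>X.
     bm_act M (leaves X) (block_perm n (\<lambda>j. leaves (kids X ! j)) \<sigma> (\<lambda>_. id))
       (value_at f (Vert (label X []) (map (\<lambda>j. kids X ! inv \<sigma> j) [0..<n]))))"

definition Mf_right ::
  "'q operad_data \<Rightarrow> nat \<Rightarrow> nat \<Rightarrow> nat \<Rightarrow> ('q, 'm) family \<Rightarrow> 'q \<Rightarrow> ('q, 'm) family" where
  "Mf_right Q n m i f q = family_of Q (n + m - 1) (\<lambda>X.
     value_at f (Vert (label X [])
       (take i (kids X) @ Vert (0, q) (take m (drop i (kids X))) # drop (i + m) (kids X))))"

fun chunks :: "nat list \<Rightarrow> 'a list \<Rightarrow> 'a list list" where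
  "chunks [] xs = []"
| "chunks (n # ns) xs = take n xs # chunks ns (drop n xs)"

definition Mf_left ::
  "'q operad_data \<Rightarrow> ('p, 'q, 'm) bimodule_data \<Rightarrow> 'p \<Rightarrow> (nat \<times> ('q, 'm) family) list
    \<Rightarrow> ('q, 'm) family" where
  "Mf_left Q M p fs = family_of Q (arity_sum fs) (\<lambda>X.
     bm_left M p
       (map2 (\<lambda>(n, f) ts. let X' = Vert (label X []) ts in (leaves X', value_at f X'))
          fs (chunks (map fst fs) (kids X))))"

definition Mf :: "'q operad_data \<Rightarrow> ('p, 'q, 'm) bimodule_data
    \<Rightarrow> ('p, 'q, ('q, 'm) family) bimodule_data" where
  "Mf Q M = \<lparr>bm_space = Mf_space Q M, bm_act = Mf_act Q M,
     bm_right = Mf_right Q, bm_left = Mf_left Q M\<rparr>"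

end

theory Submission
  imports Defs
begin

text \<open>
  Call the maximum of the numbers on the nullary vertices of a branch its height, counting a leaf as
  \<open>1\<close>.  The height is invariant under the identifications that define \<open>M\<^sup>f\<close>; a branch of height
  less than \<open>1\<close> has no leaves and none of its numbers exceeds the height.  A point of the matching
  object prescribes the values on the trees with a root branch of height \<open>0\<close>, since such a branch
  contracts to a univalent vertex labelled by \<open>0\<close> and \<open>\<ast>\<^sub>0\<close>.

  Let \<open>m\<close> be the smallest height of a root branch.  Subtracting
  \<open>min {m, \<tau>(1 - m), 1 - height}\<close> from the numbers of every root branch and replacing the time
  \<open>\<tau>\<close> by \<open>max {0, \<tau>(1 - m) - m}\<close> retracts (trees) \<open>\<times> [0, 1]\<close> onto the union of
  (trees) \<open>\<times> 0\<close> and (trees with \<open>m = 0\<close>) \<open>\<times> [0, 1]\<close>.  As branches of height \<open>1\<close>, the only ones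
  in which the number \<open>1\<close> occurs, are not changed, the retraction is compatible with the right
  action of \<open>Q\<close>, and composition with it solves the lifting problem.
\<close>

section \<open>Compact test spaces\<close>

text \<open>On pairs (m, \<tau>) the retraction maps the unit square onto the edges \<tau> = 0 and m
  = 0: a point goes to (m - \<tau>(1 - m), 0) or to (0, \<tau>(1 - m) - m), whichever has no
  negative entry. The factor 1 - m collapses the edge m = 1 to a point, and it ensures that a branch
  which has to reach height 0 satisfies m \<le> 1 - m, so that the bound 1 - height never stops it
  short. That bound comes from the condition on subtrees with all numbers 1: these must stay fixed,
  and the amounts must tend to 0 as a height tends to 1. Root branches may be lowered by different
  amounts because edges at the root are never contracted.

  The other obstacle is the k-topology on mapping spaces. Disk times interval is compact, so the
  lift is continuous once its adjoint is continuous on products with compact test spaces. There, the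
  choice of a branch of minimal height gives a finite closed cover; agreement on the overlaps is
  what the matching condition provides.\<close>

lemma infinite_huge: "infinite (UNIV :: 'a huge set)"
proof -
  have "inj (\<lambda>x::real. {{{Inr x :: 'a + real}}})"
    by (auto intro: injI)
  then show ?thesis
    using infinite_UNIV_char_0 finite_imageD[of "\<lambda>x::real. {{{Inr x :: 'a + real}}}" UNIV]
    by (metis finite_subset subset_UNIV)
qed

lemma ex_inj_huge_Times: "\<exists>e :: 'a huge \<times> 'a huge \<Rightarrow> 'a huge. inj e"
  using card_of_Times_same_infinite[OF infinite_huge, THEN ordIso_imp_ordLeq]
  unfolding card_of_ordLeq[symmetric] UNIV_Times_UNIV by (simp only: subset_UNIV simp_thms)

text \<open>A sequence is encoded by its graph, with Kuratowski pairs of real numbers: a pair is a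
  set of sets and the graph lies one level higher, which uses the three set levels of
  \<open>huge\<close>. Disks live on the type \<open>nat \<Rightarrow> real\<close>.\<close>

lemma ex_inj_huge_fun: "\<exists>e :: (nat \<Rightarrow> real) \<Rightarrow> 'a huge. inj e"
proof -
  define p :: "nat \<Rightarrow> real \<Rightarrow> ('a + real) set set" where
    "p n x = {{Inr (real n)}, {Inr (real n), Inr x}}" for n x
  have p: "p n x = p m y \<longleftrightarrow> n = m \<and> x = y" for n m x y
    by (auto simp: p_def doubleton_eq_iff insert_commute)
  have "f = g" if "range (\<lambda>n. p n (f n)) = range (\<lambda>n. p n (g n))" for f g
  proof
    fix n
    have "p n (f n) \<in> range (\<lambda>n. p n (g n))" unfolding that[symmetric] by (rule rangeI)
    then obtain m where "p n (f n) = p m (g m)" by (rule rangeE)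
    then show "f n = g n" unfolding p by metis
  qed
  then have "inj (\<lambda>f. range (\<lambda>n. p n (f n)))" by (rule injI)
  then show ?thesis by blast
qed

lemma ex_inj_huge_Pair:
  fixes e1 :: "'k \<Rightarrow> 'a huge" and e2 :: "'l \<Rightarrow> 'a huge"
  assumes "inj e1" and "inj e2"
  shows "\<exists>e :: 'k \<times> 'l \<Rightarrow> 'a huge. inj e"
proof -
  obtain e :: "'a huge \<times> 'a huge \<Rightarrow> 'a huge" where "inj e"
    using ex_inj_huge_Times by blast
  then have "inj (e \<circ> map_prod e1 e2)"
    using assms by (intro inj_compose prod.inj_map)
  then show ?thesis by blast
qed

lemma ex_inj_huge_real: "\<exists>e :: real \<Rightarrow> 'a huge. inj e"
proof -
  obtain e :: "(nat \<Rightarrow> real) \<Rightarrow> 'a huge" where "inj e" using ex_inj_huge_fun by blast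
  moreover have "inj (\<lambda>x::real. (\<lambda>_::nat. x))" by (auto intro: injI dest: fun_cong)
  ultimately show ?thesis using inj_compose by blast
qed

text \<open>Needed when a test space belonging to one type has to probe a space on a larger type,
  such as a product.\<close>

lemma ex_inj_huge_map:
  fixes i :: "'a \<Rightarrow> 'b"
  assumes "inj i"
  shows "\<exists>e :: 'a huge \<Rightarrow> 'b huge. inj e"
proof -
  have "inj (map_sum i (id :: real \<Rightarrow> real))" using assms by (intro sum.inj_map) auto
  then have "inj (image (image (image (map_sum i (id :: real \<Rightarrow> real)))))"
    by (simp add: inj_on_image_Pow inj_image_eq_iff inj_def)
  then show ?thesis by blast
qed

abbreviation compact_Hausdorff :: "'a topology \<Rightarrow> bool" where
  "compact_Hausdorff K \<equiv> compact_space K \<and> Hausdorff_space K"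

lemma compact_Hausdorff_prod:
  "compact_Hausdorff K \<Longrightarrow> compact_Hausdorff L \<Longrightarrow> compact_Hausdorff (prod_topology K L)"
  by (simp add: compact_space_prod_topology Hausdorff_space_prod_topology)

lemma compact_Hausdorff_subtopology:
  "compact_Hausdorff K \<Longrightarrow> closedin K C \<Longrightarrow> compact_Hausdorff (subtopology K C)"
  by (simp add: Hausdorff_space_subtopology closedin_compact_space compact_space_subtopology)

text \<open>The topology is transported along the injection. In this way compact Hausdorff spaces on
  other types, such as cylinders over disks, become tests in the sense of
  \<open>k_open\<close>.\<close>

lemma huge_copy:
  fixes K :: "'k topology" and e :: "'k \<Rightarrow> 'a huge"
  assumes "compact_Hausdorff K" and "inj e"
  obtains L :: "'a huge topology" and h h' where "compact_Hausdorff L"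
    "continuous_map L K h" "continuous_map K L h'" "\<And>x. x \<in> topspace K \<Longrightarrow> h (h' x) = x"
proof
  let ?L = "pullback_topology (e ` topspace K) (inv e) K"
  have 1: "continuous_map ?L K (inv e)"
    using continuous_map_pullback[OF continuous_map_id, of "e ` topspace K" "inv e" K] by simp
  have 2: "continuous_map K ?L e"
    using assms(2) by (intro continuous_map_pullback') (auto simp: o_def)
  have "homeomorphic_maps K ?L e (inv e)"
    using 1 2 assms(2) by (auto simp: homeomorphic_maps_def topspace_pullback_topology)
  then have "K homeomorphic_space ?L"
    by (rule homeomorphic_maps_imp_homeomorphic_space)
  then show "compact_Hausdorff ?L"
    using assms(1) homeomorphic_compact_space homeomorphic_Hausdorff_space by blast
  show "inv e (e x) = x" if "x \<in> topspace K" for x using assms(2) by simp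
  show "continuous_map ?L K (inv e)" "continuous_map K ?L e" by (rule 1, rule 2)
qed

section \<open>The k-space topology\<close>

lemma openin_kifyI: "openin X U \<Longrightarrow> openin (kify X) U"
  using openin_subset[of X U] unfolding openin_kify k_open_def continuous_map_def by blast

lemma continuous_map_kify_id: "continuous_map (kify X) X (\<lambda>x. x)"
proof -
  have "{x \<in> topspace (kify X). x \<in> U} = U" if "openin X U" for U
    using openin_subset[OF that] by auto
  then show ?thesis by (simp add: continuous_map_def openin_kifyI)
qed

lemma continuous_map_from_kify_coarse: "continuous_map X Y f \<Longrightarrow> continuous_map (kify X) Y f"
  using continuous_map_compose[OF continuous_map_kify_id] by (auto simp: o_def)

lemma continuous_map_into_kifyD: "continuous_map X (kify Y) f \<Longrightarrow> continuous_map X Y f"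
  using continuous_map_compose[OF _ continuous_map_kify_id] by (auto simp: o_def)

text \<open>Universal property of \<open>kify\<close>: compact Hausdorff spaces cannot distinguish
  \<open>kify X\<close> from \<open>X\<close>. A k-open set has an open preimage in the copy of
  \<open>K\<close> on the test type, and this preimage is pulled back to \<open>K\<close>.\<close>

lemma continuous_map_into_kify:
  fixes K :: "'k topology" and X :: "'a topology" and e :: "'k \<Rightarrow> 'a huge"
  assumes K: "compact_Hausdorff K" and e: "inj e" and f: "continuous_map K X f"
  shows "continuous_map K (kify X) f"
proof -
  obtain L :: "'a huge topology" and h h' where L: "compact_Hausdorff L"
    and h: "continuous_map L K h" and h': "continuous_map K L h'"
    and hh: "\<And>x. x \<in> topspace K \<Longrightarrow> h (h' x) = x"
    using huge_copy[OF K e] by metis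
  have "openin K {x \<in> topspace K. f x \<in> U}" if U: "openin (kify X) U" for U
  proof -
    have "openin L {x \<in> topspace L. (f \<circ> h) x \<in> U}"
      using U L continuous_map_compose[OF h f] unfolding openin_kify k_open_def by blast
    then have "openin K {x \<in> topspace K. h' x \<in> {x \<in> topspace L. (f \<circ> h) x \<in> U}}"
      using h' unfolding continuous_map_def by blast
    moreover have "{x \<in> topspace K. h' x \<in> {x \<in> topspace L. (f \<circ> h) x \<in> U}}
        = {x \<in> topspace K. f x \<in> U}"
      using hh continuous_map_image_subset_topspace[OF h'] by auto
    ultimately show ?thesis by (simp only:)
  qed
  then show ?thesis using f by (auto simp: continuous_map_def)
qed

text \<open>Together with \<open>continuous_map_into_kify\<close> this reduces continuity between
  k-spaces to composites with compact test maps.\<close>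

lemma continuous_map_from_kify:
  fixes X :: "'a topology"
  assumes "f \<in> topspace X \<rightarrow> topspace Y"
    and "\<And>(K :: 'a huge topology) k. compact_Hausdorff K \<Longrightarrow> continuous_map K X k \<Longrightarrow>
           continuous_map K Y (f \<circ> k)"
  shows "continuous_map (kify X) Y f"
  unfolding continuous_map_def
proof (intro conjI allI impI)
  show "f \<in> topspace (kify X) \<rightarrow> topspace Y" using assms(1) by simp
  fix U assume U: "openin Y U"
  have "openin K {x \<in> topspace K. k x \<in> {x \<in> topspace X. f x \<in> U}}"
    if K: "compact_Hausdorff K" "continuous_map K X k" for K :: "'a huge topology" and k
  proof -
    have "openin K {x \<in> topspace K. (f \<circ> k) x \<in> U}"
      using assms(2)[OF K] U by (simp add: continuous_map_def)
    moreover have "{x \<in> topspace K. (f \<circ> k) x \<in> U}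
        = {x \<in> topspace K. k x \<in> {x \<in> topspace X. f x \<in> U}}"
      using K(2) by (auto simp: continuous_map_def)
    ultimately show ?thesis by simp
  qed
  then show "openin (kify X) {x \<in> topspace (kify X). f x \<in> U}"
    by (auto simp: openin_kify k_open_def)
qed

text \<open>Source and target share a type and hence a test type, so composition with
  \<open>f\<close> turns tests of \<open>X\<close> into tests of \<open>Y\<close>.\<close>

lemma continuous_map_kify:
  fixes X Y :: "'a topology"
  assumes "continuous_map X Y f"
  shows "continuous_map (kify X) (kify Y) f"
proof (rule continuous_map_from_kify)
  show "f \<in> topspace X \<rightarrow> topspace (kify Y)"
    using assms by (auto simp: continuous_map_def)
  fix K :: "'a huge topology" and k
  assume "compact_Hausdorff K" and "continuous_map K X k"
  then show "continuous_map K (kify Y) (f \<circ> k)"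
    using continuous_map_into_kify[of K id] continuous_map_compose[OF _ assms] by auto
qed

lemma topspace_kproduct [simp]: "topspace (kproduct I X) = (\<Pi>\<^sub>E i\<in>I. topspace (X i))"
  by (simp add: kproduct_def)

lemma topspace_kprod [simp]: "topspace (kprod X Y) = topspace X \<times> topspace Y"
  by (simp add: kprod_def)

lemma topspace_ksub [simp]: "topspace (ksub X S) = topspace X \<inter> S"
  by (simp add: ksub_def)

lemma continuous_map_ksub_id: "continuous_map (ksub X S) X (\<lambda>x. x)"
  unfolding ksub_def
  by (intro continuous_map_from_kify_coarse continuous_map_from_subtopology) (simp add: id_def[symmetric])

lemma continuous_map_kproduct_proj: "i \<in> I \<Longrightarrow> continuous_map (kproduct I X) (X i) (\<lambda>x. x i)"
  unfolding kproduct_def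
  by (intro continuous_map_from_kify_coarse continuous_map_product_projection)

section \<open>Mapping spaces\<close>

text \<open>The empty test space makes \<open>maps X Y\<close> itself a subbasic set, so that no map
  is lost in the generated topology.\<close>

lemma topspace_Map [simp]: "topspace (Map X Y) = maps X Y"
proof -
  have "maps X Y = {g \<in> maps X Y. g ` (\<lambda>_. undefined) ` topspace (discrete_topology {} :: 'a huge topology) \<subseteq> {}}"
    by auto
  moreover have "compact_Hausdorff (discrete_topology {} :: 'a huge topology)"
    by simp
  moreover have "continuous_map (discrete_topology {} :: 'a huge topology) X (\<lambda>_. undefined)" by simp
  moreover have "openin Y {}" by simp
  ultimately have "maps X Y \<in> {{g \<in> maps X Y. g ` f ` topspace K \<subseteq> U} | (K :: 'a huge topology) f U.
        compact_space K \<and> Hausdorff_space K \<and> continuous_map K X f \<and> openin Y U}"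
    by blast
  then show ?thesis
    unfolding Map_def by (auto simp: topology_generated_by_topspace)
qed

lemma openin_Map:
  fixes K :: "'k topology" and X :: "'x topology" and e :: "'k \<Rightarrow> 'x huge"
  assumes "compact_Hausdorff K" and "inj e" and f: "continuous_map K X f" and "openin Y U"
  shows "openin (Map X Y) {g \<in> maps X Y. g ` f ` topspace K \<subseteq> U}"
proof -
  obtain L :: "'x huge topology" and h h' where L: "compact_Hausdorff L"
    and h: "continuous_map L K h" and h': "continuous_map K L h'"
    and hh: "\<And>x. x \<in> topspace K \<Longrightarrow> h (h' x) = x"
    using huge_copy[OF assms(1,2)] by metis
  have "h ` topspace L = topspace K"
  proof
    show "h ` topspace L \<subseteq> topspace K" using h by (rule continuous_map_image_subset_topspace)
    show "topspace K \<subseteq> h ` topspace L"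
      using continuous_map_image_subset_topspace[OF h'] hh by (metis image_eqI image_subset_iff subsetI)
  qed
  then have "f ` topspace K = (f \<circ> h) ` topspace L" unfolding image_comp[symmetric] by (rule arg_cong[OF sym])
  then have "{g \<in> maps X Y. g ` f ` topspace K \<subseteq> U}
      = {g \<in> maps X Y. g ` (f \<circ> h) ` topspace L \<subseteq> U}"
    by simp
  then have "openin (topology_generated_by
     {{g \<in> maps X Y. g ` f ` topspace K \<subseteq> U} | (K :: 'x huge topology) f U.
        compact_space K \<and> Hausdorff_space K \<and> continuous_map K X f \<and> openin Y U})
      {g \<in> maps X Y. g ` f ` topspace K \<subseteq> U}"
    using L continuous_map_compose[OF h f] assms(4)
    by (intro topology_generated_by_Basis CollectI exI[of _ L] exI[of _ "f \<circ> h"] exI[of _ U] conjI) auto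
  then show ?thesis unfolding Map_def by (rule openin_kifyI)
qed

lemma continuous_map_Map_eval:
  fixes K :: "'k topology" and X :: "'x topology" and e :: "'k \<Rightarrow> 'x huge"
  assumes K: "compact_Hausdorff K" and e: "inj e"
    and a: "continuous_map Z (Map X Y) a" and \<kappa>: "continuous_map K X \<kappa>"
  shows "continuous_map (prod_topology Z K) Y (\<lambda>(z, x). a z (\<kappa> x))"
  unfolding continuous_map_def
proof (intro conjI allI impI)
  have maps: "a z \<in> maps X Y" if "z \<in> topspace Z" for z
    using a that by (auto simp: continuous_map_def)
  have cont: "continuous_map K Y (a z \<circ> \<kappa>)" if "z \<in> topspace Z" for z
    using maps[OF that] \<kappa> by (auto simp: maps_def intro: continuous_map_compose)
  show "(\<lambda>(z, x). a z (\<kappa> x)) \<in> topspace (prod_topology Z K) \<rightarrow> topspace Y"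
    using cont by (auto simp: continuous_map_def Pi_iff)
  fix U assume U: "openin Y U"
  let ?W = "{p \<in> topspace (prod_topology Z K). (case p of (z, x) \<Rightarrow> a z (\<kappa> x)) \<in> U}"
  have "\<exists>T. openin (prod_topology Z K) T \<and> p \<in> T \<and> T \<subseteq> ?W" if "p \<in> ?W" for p
  proof -
    obtain z x where p: "p = (z, x)" "z \<in> topspace Z" "x \<in> topspace K" "a z (\<kappa> x) \<in> U"
      using \<open>p \<in> ?W\<close> by auto
    have "openin K {x \<in> topspace K. (a z \<circ> \<kappa>) x \<in> U}"
      using cont[OF p(2)] U by (simp add: continuous_map_def)
    moreover have "neighbourhood_base_of (closedin K) K"
      using K by (simp add: neighbourhood_base_of_closedin compact_Hausdorff_imp_regular_space)
    ultimately obtain V C where V: "openin K V" "closedin K C" "x \<in> V" "V \<subseteq> C"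
        "C \<subseteq> {x \<in> topspace K. (a z \<circ> \<kappa>) x \<in> U}"
      using p(3,4) unfolding neighbourhood_base_of
      by (metis (mono_tags, lifting) comp_apply mem_Collect_eq)
    let ?G = "{g \<in> maps X Y. g ` \<kappa> ` topspace (subtopology K C) \<subseteq> U}"
    have G: "openin (Map X Y) ?G"
      using K V(2) e U \<kappa>
      by (intro openin_Map[OF _ e] compact_Hausdorff_subtopology continuous_map_from_subtopology)
    have C: "topspace (subtopology K C) = C" using closedin_subset[OF V(2)] by auto
    have "openin Z {z \<in> topspace Z. a z \<in> ?G}"
      using a G by (auto simp: continuous_map_def)
    then have "openin (prod_topology Z K) ({z \<in> topspace Z. a z \<in> ?G} \<times> V)"
      using V(1) by (simp add: openin_prod_Times_iff)
    moreover have "p \<in> {z \<in> topspace Z. a z \<in> ?G} \<times> V"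
      using p maps V by (auto simp: C)
    moreover have "{z \<in> topspace Z. a z \<in> ?G} \<times> V \<subseteq> ?W"
      using V openin_subset[OF V(1)] unfolding C by (auto simp: image_subset_iff subset_iff)
    ultimately show ?thesis by blast
  qed
  then show "openin (prod_topology Z K) ?W"
    by (subst openin_subopen) blast
qed

text \<open>Joint evaluation with \<open>C\<close> in both roles, pulled back along the
  diagonal.\<close>

lemma continuous_map_Map_apply:
  fixes C :: "'k topology" and X :: "'x topology" and e :: "'k \<Rightarrow> 'x huge"
  assumes "compact_Hausdorff C" and "inj e"
    and "continuous_map C (Map X Y) a" and "continuous_map C X b"
  shows "continuous_map C Y (\<lambda>c. a c (b c))"
proof -
  have "continuous_map C (prod_topology C C) (\<lambda>c. (c, c))"
    by (intro continuous_map_pairedI) auto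
  then show ?thesis
    using continuous_map_compose[OF _ continuous_map_Map_eval[OF assms]] by (fastforce simp: o_def)
qed

text \<open>One direction of the exponential law, by the tube lemma: projection along a compact
  factor is closed, so the \<open>z\<close> for which \<open>a z\<close> fails to map the whole test
  space into \<open>U\<close> form a closed set.\<close>

lemma continuous_map_into_Map:
  fixes Z :: "'z topology" and X :: "'x topology" and Y :: "'y topology"
    and e :: "'z \<Rightarrow> ('x \<Rightarrow> 'y) huge"
  assumes Z: "compact_Hausdorff Z" and e: "inj e"
    and maps: "\<And>z. z \<in> topspace Z \<Longrightarrow> a z \<in> maps X Y"
    and cont: "\<And>(K :: 'x huge topology) \<kappa>. compact_Hausdorff K \<Longrightarrow> continuous_map K X \<kappa> \<Longrightarrow>
                 continuous_map (prod_topology Z K) Y (\<lambda>(z, x). a z (\<kappa> x))"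
  shows "continuous_map Z (Map X Y) a"
  unfolding Map_def
proof (rule continuous_map_into_kify[OF Z e], rule continuous_on_generated_topo)
  let ?B = "{{g \<in> maps X Y. g ` f ` topspace K \<subseteq> U} | (K :: 'x huge topology) f U.
        compact_space K \<and> Hausdorff_space K \<and> continuous_map K X f \<and> openin Y U}"
  have "\<Union>?B = maps X Y"
    using topspace_Map[of X Y] unfolding Map_def by (simp add: topology_generated_by_topspace)
  then show "a ` topspace Z \<subseteq> \<Union>?B" using maps by auto
  fix G assume "G \<in> ?B"
  then obtain K :: "'x huge topology" and \<kappa> U where G: "G = {g \<in> maps X Y. g ` \<kappa> ` topspace K \<subseteq> U}"
    and K: "compact_Hausdorff K" "continuous_map K X \<kappa>" and U: "openin Y U"
    by blast
  let ?W = "{p \<in> topspace (prod_topology Z K). (case p of (z, x) \<Rightarrow> a z (\<kappa> x)) \<in> U}"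
  let ?F = "topspace (prod_topology Z K) - ?W"
  have "openin (prod_topology Z K) ?W"
    using cont[OF K] U by (simp add: continuous_map_def)
  then have "closedin (prod_topology Z K) ?F" by blast
  then have "closedin Z (fst ` ?F)"
    using closed_map_fst[of K Z] K by (auto simp: closed_map_def)
  moreover have "a -` G \<inter> topspace Z = topspace Z - fst ` ?F"
  proof -
    have "z \<in> fst ` ?F \<longleftrightarrow> z \<in> topspace Z \<and> (\<exists>x\<in>topspace K. a z (\<kappa> x) \<notin> U)" for z
      by force
    then show ?thesis using maps by (auto simp: G)
  qed
  ultimately show "openin Z (a -` G \<inter> topspace Z)" by auto
qed

text \<open>The preimage of the subbasic set given by a test map \<open>\<kappa>\<close> is the one
  given by \<open>\<phi> \<circ> \<kappa>\<close>; both sources live on one type, so this is again a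
  test map of the right kind.\<close>

lemma continuous_map_Map_precompose:
  fixes X X' :: "'x topology"
  assumes \<phi>: "continuous_map X X' \<phi>"
  shows "continuous_map (Map X' Y) (Map X Y) (\<lambda>g. restrict (g \<circ> \<phi>) (topspace X))"
  unfolding Map_def
proof (rule continuous_map_kify, rule continuous_on_generated_topo)
  let ?B = "\<lambda>X :: 'x topology. {{g \<in> maps X Y. g ` f ` topspace K \<subseteq> U} | (K :: 'x huge topology) f U.
        compact_space K \<and> Hausdorff_space K \<and> continuous_map K X f \<and> openin Y U}"
  let ?r = "\<lambda>g. restrict (g \<circ> \<phi>) (topspace X)"
  have B: "\<Union>(?B X) = maps X Y" for X :: "'x topology"
    using topspace_Map[of X Y] unfolding Map_def by (simp add: topology_generated_by_topspace)
  have r: "?r g \<in> maps X Y" if "g \<in> maps X' Y" for g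
  proof -
    have "continuous_map X Y (g \<circ> \<phi>)"
      using that \<phi> continuous_map_compose by (auto simp: maps_def)
    then have "continuous_map X Y (?r g)"
      by (rule continuous_map_eq) simp
    then show ?thesis by (simp add: maps_def)
  qed
  then show "?r ` topspace (topology_generated_by (?B X')) \<subseteq> \<Union>(?B X)"
    unfolding B topology_generated_by_topspace by blast
  fix G assume "G \<in> ?B X"
  then obtain K :: "'x huge topology" and \<kappa> U where G: "G = {g \<in> maps X Y. g ` \<kappa> ` topspace K \<subseteq> U}"
    and K: "compact_Hausdorff K" "continuous_map K X \<kappa>" and U: "openin Y U"
    by blast
  have "?r -` G \<inter> maps X' Y = {g \<in> maps X' Y. g ` (\<phi> \<circ> \<kappa>) ` topspace K \<subseteq> U}"
    using r continuous_map_image_subset_topspace[OF K(2)]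
    by (fastforce simp: G)
  moreover have "continuous_map K X' (\<phi> \<circ> \<kappa>)" using K(2) \<phi> by (rule continuous_map_compose)
  ultimately show "openin (topology_generated_by (?B X'))
      (?r -` G \<inter> topspace (topology_generated_by (?B X')))"
    unfolding B topology_generated_by_topspace using K(1) U
    by (intro topology_generated_by_Basis CollectI exI[of _ K] exI[of _ "\<phi> \<circ> \<kappa>"] exI[of _ U] conjI) auto
qed

text \<open>Every coordinate is bounded by the sum of squares or vanishes, so the disk is a closed
  subset of a power of [-1, 1], which is compact by Tychonoff.\<close>

lemma compact_Hausdorff_disk: "compact_Hausdorff (disk n)"
proof
  let ?P = "product_topology (\<lambda>i::nat. top_of_set {-1..1::real}) UNIV"
  let ?D = "{x. (\<forall>i\<ge>n. x i = 0) \<and> (\<Sum>i<n. (x i)\<^sup>2) \<le> (1::real)}"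
  have D: "disk n = subtopology (powertop_real UNIV) ?D"
    by (auto simp: disk_def Euclidean_space_def subtopology_subtopology intro!: arg_cong[where f="subtopology _"])
  show "Hausdorff_space (disk n)"
    unfolding D by (intro Hausdorff_space_subtopology) (simp add: Hausdorff_space_product_topology)
  have *: "x i \<in> {-1..1}" if "x \<in> ?D" for x i
  proof (cases "i < n")
    case True
    then have "(x i)\<^sup>2 \<le> (\<Sum>i<n. (x i)\<^sup>2)" by (intro member_le_sum) auto
    also have "\<dots> \<le> 1" using that by simp
    finally show ?thesis by (simp add: abs_le_square_iff[of _ 1, simplified, symmetric] abs_le_iff)
  qed (use that in auto)
  have "closedin (powertop_real UNIV) ?D"
  proof -
    have c: "continuous_map (powertop_real UNIV) euclideanreal (\<lambda>x::nat\<Rightarrow>real. x i)" for i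
      by (rule continuous_map_product_projection) simp
    have "closedin (powertop_real UNIV) {x \<in> topspace (powertop_real UNIV). x i \<in> {0}}" for i :: nat
      by (rule closedin_continuous_map_preimage[OF c]) simp
    then have 1: "closedin (powertop_real UNIV) (\<Inter>i\<in>{n..}. {x::nat\<Rightarrow>real. x i = 0})"
      by (intro closedin_Inter) auto
    have "continuous_map (powertop_real UNIV) euclideanreal (\<lambda>x::nat\<Rightarrow>real. \<Sum>i<n. (x i)\<^sup>2)"
      by (intro continuous_map_sum continuous_map_real_pow c) auto
    from closedin_continuous_map_preimage[OF this, of "{..1}"]
    have "closedin (powertop_real UNIV) {x::nat\<Rightarrow>real. (\<Sum>i<n. (x i)\<^sup>2) \<le> 1}" by simp
    with 1 have "closedin (powertop_real UNIV)
        ((\<Inter>i\<in>{n..}. {x::nat\<Rightarrow>real. x i = 0}) \<inter> {x. (\<Sum>i<n. (x i)\<^sup>2) \<le> 1})" by (rule closedin_Int)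
    moreover have "(\<Inter>i\<in>{n..}. {x::nat\<Rightarrow>real. x i = 0}) \<inter> {x. (\<Sum>i<n. (x i)\<^sup>2) \<le> 1} = ?D" by auto
    ultimately show ?thesis by simp
  qed
  moreover have P: "?P = subtopology (powertop_real UNIV) (UNIV \<rightarrow>\<^sub>E {-1..1})"
    by (rule subtopology_product_topology[symmetric])
  ultimately have "closedin ?P ?D"
    unfolding P using * by (intro closedin_subset_topspace) (auto simp: PiE_iff)
  moreover have "compact_space ?P"
    by (simp add: compact_space_product_topology compact_space_subtopology)
  ultimately have "compact_space (subtopology ?P ?D)"
    using closedin_compact_space compact_space_subtopology by blast
  moreover have "subtopology ?P ?D = disk n"
    unfolding P D subtopology_subtopology
    using * by (intro arg_cong[where f="subtopology _"]) (auto simp: PiE_iff)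
  ultimately show "compact_space (disk n)" by simp
qed

section \<open>Decorated trees\<close>

definition verts :: "'d tree \<Rightarrow> nat list set" where
  "verts S = {a. \<exists>d ts. subtree S a = Some (Vert d ts)}"

lemma inner_vertices_verts: "inner_vertices X = verts X - {[]}"
  by (auto simp: inner_vertices_def verts_def)

lemma verts_Leaf [simp]: "verts (Leaf :: 'd tree) = {}"
proof -
  have "subtree (Leaf :: 'd tree) a \<noteq> Some (Vert d ts)" for a d ts by (cases a) auto
  then show ?thesis unfolding verts_def by blast
qed

lemma Nil_in_verts [simp]: "[] \<in> verts (Vert d ts)"
  by (simp add: verts_def)

lemma Cons_in_verts [simp]: "i # a \<in> verts (Vert d ts) \<longleftrightarrow> i < length ts \<and> a \<in> verts (ts ! i)"
  by (simp add: verts_def)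

lemma verts_Vert: "verts (Vert d ts) = insert [] (\<Union>i<length ts. (#) i ` verts (ts ! i))"
proof (rule set_eqI)
  show "a \<in> verts (Vert d ts) \<longleftrightarrow> a \<in> insert [] (\<Union>i<length ts. (#) i ` verts (ts ! i))" for a
    by (cases a) auto
qed

lemma label_Nil [simp]: "label (Vert d ts) [] = d"
  by (simp add: label_def)

lemma label_Cons [simp]: "i < length ts \<Longrightarrow> label (Vert d ts) (i # a) = label (ts ! i) a"
  by (simp add: label_def)

lemma arity_Nil [simp]: "arity (Vert d ts) [] = length ts"
  by (simp add: arity_def)

lemma arity_Cons [simp]: "i < length ts \<Longrightarrow> arity (Vert d ts) (i # a) = arity (ts ! i) a"
  by (simp add: arity_def)

lemma subtree_map_tree: "subtree (map_tree f S) a = map_option (map_tree f) (subtree S a)"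
  by (induction S a rule: subtree.induct) auto

lemma verts_map_tree [simp]: "verts (map_tree f S) = verts S"
proof -
  have "(\<exists>d ts. map_option (map_tree f) x = Some (Vert d ts)) \<longleftrightarrow> (\<exists>d ts. x = Some (Vert d ts))" for x
    by (cases x rule: option.exhaust; simp) (metis tree.exhaust tree.distinct(1) tree.simps(9) tree.simps(8))
  then show ?thesis by (simp add: verts_def subtree_map_tree)
qed

lemma arity_map_tree [simp]: "a \<in> verts S \<Longrightarrow> arity (map_tree f S) a = arity S a"
  by (auto simp: verts_def arity_def subtree_map_tree)

lemma label_map_tree: "a \<in> verts S \<Longrightarrow> label (map_tree f S) a = f (label S a)"
  by (auto simp: verts_def label_def subtree_map_tree)

lemma leaves_map_tree [simp]: "leaves (map_tree f S) = leaves S"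
  by (induction S) (auto intro!: arg_cong[where f=sum_list])

lemma inner_vertices_map_tree [simp]: "inner_vertices (map_tree f S) = inner_vertices S"
  by (simp add: inner_vertices_verts)

lemma replace_map_tree: "map_tree f (replace S a R) = replace (map_tree f S) a (map_tree f R)"
proof (induction S a R rule: replace.induct)
  case (3 d ts i a s)
  then show ?case by (cases "i < length ts") (auto simp: map_update list_update_beyond)
qed auto

lemma offset_map_tree: "subtree S a \<noteq> None \<Longrightarrow> offset (map_tree f S) a = offset S a"
  by (induction S a rule: offset.induct) (auto simp: take_map split: if_splits intro!: arg_cong[where f=sum_list])

lemma verts_decorate [simp]: "verts (decorate T g) = verts T"
  by (induction T g rule: decorate.induct) (auto simp: verts_Vert)

lemma shape_decorate [simp]: "shape (decorate T g) = T"
  by (induction T g rule: decorate.induct) (auto intro!: nth_equalityI)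

lemma label_decorate: "a \<in> verts T \<Longrightarrow> label (decorate T g) a = g a"
  by (induction T g arbitrary: a rule: decorate.induct) (auto simp: verts_Vert)

lemma decorate_shape: "(\<And>a. a \<in> verts S \<Longrightarrow> g a = label S a) \<Longrightarrow> decorate (shape S) g = S"
proof (induction S arbitrary: g)
  case (Vert d ts)
  have "decorate (shape (ts ! i)) (\<lambda>a. g (i # a)) = ts ! i" if "i < length ts" for i
    using that Vert.prems by (intro Vert.IH) auto
  then show ?case using Vert.prems[of "[]"] by (auto intro!: nth_equalityI)
qed simp

text \<open>The bound \<open>b\<close> stands for the number on the vertex below, so that the order
  condition can be checked edge by edge. Root branches get the bound 0, as the root carries no
  number.\<close>

fun good :: "'q operad_data \<Rightarrow> real \<Rightarrow> (real \<times> 'q) tree \<Rightarrow> bool" where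
  "good Q b Leaf \<longleftrightarrow> True"
| "good Q b (Vert d ts) \<longleftrightarrow> b \<le> fst d \<and> fst d \<le> 1 \<and> snd d \<in> topspace (op_space Q (length ts)) \<and>
     (\<forall>s\<in>set ts. good Q (fst d) s)"

text \<open>By transitivity, comparing numbers along edges amounts to comparing them along all
  prefixes. This connects the recursive form with \<open>H_space\<close> and
  \<open>D_space\<close>.\<close>

lemma good_iff:
  "good Q b S \<longleftrightarrow>
     (\<forall>v\<in>verts S. b \<le> fst (label S v) \<and> fst (label S v) \<le> 1
        \<and> snd (label S v) \<in> topspace (op_space Q (arity S v))
        \<and> (\<forall>w\<in>verts S. strict_prefix v w \<longrightarrow> fst (label S v) \<le> fst (label S w)))"
    (is "_ \<longleftrightarrow> (\<forall>v\<in>verts S. ?P b S v)")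
proof (induction S arbitrary: b)
  case (Vert d ts)
  let ?X = "Vert d ts"
  have ball: "(\<forall>v\<in>verts ?X. R v) \<longleftrightarrow> R [] \<and> (\<forall>i<length ts. \<forall>v\<in>verts (ts ! i). R (i # v))" for R
    by (auto simp: verts_Vert)
  have "good Q b ?X \<longleftrightarrow> b \<le> fst d \<and> fst d \<le> 1 \<and> snd d \<in> topspace (op_space Q (length ts)) \<and>
      (\<forall>i<length ts. good Q (fst d) (ts ! i))"
    by (simp add: all_set_conv_all_nth)
  also have "\<dots> \<longleftrightarrow> b \<le> fst d \<and> fst d \<le> 1 \<and> snd d \<in> topspace (op_space Q (length ts)) \<and>
      (\<forall>i<length ts. \<forall>v\<in>verts (ts ! i). ?P (fst d) (ts ! i) v)"
    by (simp add: Vert.IH)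
  also have "\<dots> \<longleftrightarrow> ?P b ?X [] \<and> (\<forall>i<length ts. \<forall>v\<in>verts (ts ! i). ?P b ?X (i # v))"
  proof -
    have "?P b ?X [] \<longleftrightarrow> b \<le> fst d \<and> fst d \<le> 1 \<and> snd d \<in> topspace (op_space Q (length ts)) \<and>
        (\<forall>i<length ts. \<forall>v\<in>verts (ts ! i). fst d \<le> fst (label (ts ! i) v))"
      by (simp add: ball)
    moreover have "?P b ?X (i # v) \<longleftrightarrow> ?P b (ts ! i) v" if "i < length ts" for i v
      using that by (auto simp: ball)
    ultimately show ?thesis by (auto intro: order.trans)
  qed
  also have "\<dots> \<longleftrightarrow> (\<forall>v\<in>verts ?X. ?P b ?X v)"
    by (rule ball[symmetric])
  finally show ?case .
qed simp

lemma good_mono: "good Q b S \<Longrightarrow> c \<le> b \<Longrightarrow> good Q c S"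
  by (cases S) auto

lemma topspace_H_space:
  "t \<in> topspace (H_space T) \<longleftrightarrow> t \<in> inner_vertices T \<rightarrow>\<^sub>E {0..1} \<and>
     (\<forall>v \<in> inner_vertices T. \<forall>w \<in> inner_vertices T. strict_prefix v w \<longrightarrow> t v \<le> t w)"
  by (simp add: H_space_def)

lemma topspace_D_space:
  "topspace (D_space Q T) = (\<Pi>\<^sub>E v\<in>inner_vertices T. topspace (op_space Q (arity T v)))"
  by (simp add: D_space_def kproduct_def)

lemma topspace_HD_space: "topspace (HD_space Q T) = topspace (H_space T) \<times> topspace (D_space Q T)"
  by (simp add: HD_space_def kprod_def)

lemma inner_vertices_Vert: "inner_vertices (Vert d ts) = (\<Union>i<length ts. (#) i ` verts (ts ! i))"
  by (auto simp: inner_vertices_verts verts_Vert)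

lemma decorated_trees_iff:
  "Vert d ts \<in> decorated_trees Q n \<longleftrightarrow> length ts = n \<and> (\<forall>s\<in>set ts. good Q 0 s)"
proof -
  let ?X = "Vert d ts"
  have "decorations ?X \<in> topspace (HD_space Q (shape ?X)) \<longleftrightarrow>
      (\<forall>v\<in>inner_vertices ?X. 0 \<le> fst (label ?X v) \<and> fst (label ?X v) \<le> 1
        \<and> snd (label ?X v) \<in> topspace (op_space Q (arity ?X v))
        \<and> (\<forall>w\<in>inner_vertices ?X. strict_prefix v w \<longrightarrow> fst (label ?X v) \<le> fst (label ?X w)))"
    unfolding topspace_HD_space topspace_D_space decorations_def inner_vertices_map_tree mem_Times_iff topspace_H_space
    by (auto simp: PiE_iff inner_vertices_verts simp del: tree.map)
  also have "\<dots> \<longleftrightarrow> (\<forall>i<length ts. good Q 0 (ts ! i))"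
    unfolding inner_vertices_Vert good_iff
    by (auto simp: ball_Un)
  also have "\<dots> \<longleftrightarrow> (\<forall>s\<in>set ts. good Q 0 s)"
    by (metis in_set_conv_nth)
  finally show ?thesis by (auto simp: decorated_trees_def trees_def)
qed

lemma decorated_treesE:
  assumes "X \<in> decorated_trees Q n"
  obtains d ts where "X = Vert d ts" and "length ts = n" and "\<forall>s\<in>set ts. good Q 0 s"
proof (cases X)
  case Leaf
  then show ?thesis using assms by (simp add: decorated_trees_def trees_def)
next
  case (Vert d ts)
  then show ?thesis using assms that decorated_trees_iff by blast
qed

lemma good_subtree: "good Q b S \<Longrightarrow> subtree S a = Some R \<Longrightarrow> good Q b R"
proof (induction S a arbitrary: b rule: subtree.induct)
  case (3 d ts i a)
  then show ?case by (auto split: if_splits) (meson good_mono nth_mem)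
qed auto

text \<open>The last hypothesis ranges over all bounds because the bound met at the address
  \<open>a\<close> is the number on the vertex below it, which varies in the induction.\<close>

lemma good_replace:
  assumes "good Q b S" and "subtree S a = Some R" and "\<And>c. good Q c R \<Longrightarrow> good Q c R'"
  shows "good Q b (replace S a R')"
  using assms
proof (induction S a R' arbitrary: b rule: replace.induct)
  case (3 d ts i a s)
  then have i: "i < length ts" by (auto split: if_splits)
  then have "good Q (fst d) (replace (ts ! i) a s)" using 3 by auto
  then show ?case using 3 i by (auto dest!: subsetD[OF set_update_subset_insert])
qed auto

lemma leaves_subtree: "subtree S a = Some R \<Longrightarrow> leaves R \<le> leaves S"
proof (induction S a rule: subtree.induct)
  case (3 d ts i a)
  then have "leaves R \<le> leaves (ts ! i)" "i < length ts" by (auto split: if_splits)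
  moreover have "leaves (ts ! i) \<le> sum_list (map leaves ts)" if "i < length ts"
    using that by (intro member_le_sum_list) auto
  ultimately show ?case by simp
qed auto

section \<open>The height of a tree\<close>

text \<open>On good trees this is the maximal number on a nullary vertex, or \<open>1\<close> if there is a leaf.\<close>

fun height :: "(real \<times> 'q) tree \<Rightarrow> real" where
  "height Leaf = 1"
| "height (Vert d ts) = Max (insert (fst d) (set (map height ts)))"

lemma height_Vert_le [simp]: "height (Vert d ts) \<le> x \<longleftrightarrow> fst d \<le> x \<and> (\<forall>s\<in>set ts. height s \<le> x)"
  by simp

declare height.simps(2) [simp del]

text \<open>Upper bounds of a height split into conditions on the vertices by
  \<open>height_Vert_le\<close>, which avoids computing with \<open>Max\<close>.\<close>

lemma height_eqI: "(\<And>x. height S \<le> x \<longleftrightarrow> height S' \<le> x) \<Longrightarrow> height S = height S'"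
  by (meson order.antisym order.refl)

lemma good_le_height: "good Q b S \<Longrightarrow> b \<le> 1 \<Longrightarrow> b \<le> height S"
proof (cases S)
  case (Vert d ts)
  moreover have "fst d \<le> height (Vert d ts)" using height_Vert_le by blast
  ultimately show "good Q b S \<Longrightarrow> ?thesis" by simp
qed simp

lemma good_height_le: "good Q b S \<Longrightarrow> height S \<le> 1"
  by (induction S arbitrary: b) auto

lemma leaves_eq_0: "height S < 1 \<Longrightarrow> leaves S = 0"
proof (induction S)
  case (Vert d ts)
  have "height s < 1" if "s \<in> set ts" for s
    using Vert.prems height_Vert_le[of d ts "height (Vert d ts)"] that by force
  then show ?case using Vert.IH by (simp add: sum_list_eq_0_iff)
qed simp

lemma height_subtree: "subtree S a = Some R \<Longrightarrow> height R \<le> height S"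
proof (induction S a rule: subtree.induct)
  case (3 d ts i a)
  then have "height R \<le> height (ts ! i)" "i < length ts" by (auto split: if_splits)
  moreover have "height (ts ! i) \<le> height (Vert d ts)" if "i < length ts"
    using height_Vert_le[of d ts "height (Vert d ts)"] that by auto
  ultimately show ?case by simp
qed auto

lemma height_replace: "subtree S a = Some R \<Longrightarrow> height R' = height R \<Longrightarrow> height (replace S a R') = height S"
proof (induction S a R' rule: replace.induct)
  case (3 d ts i a s)
  then have i: "i < length ts" "height (replace (ts ! i) a s) = height (ts ! i)" by (auto split: if_splits)
  have "map height (ts[i := replace (ts ! i) a s]) = map height ts"
    using i by (intro nth_equalityI) (auto simp: nth_list_update)
  then show ?case by (simp only: replace.simps height.simps)
qed auto

lemma height_eq_1: "good Q b S \<Longrightarrow> \<forall>d\<in>set_tree S. fst d = 1 \<Longrightarrow> height S = 1"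
proof (cases S)
  case (Vert d ts)
  moreover have "fst d \<le> height (Vert d ts)" using height_Vert_le by blast
  ultimately show "?thesis" if "good Q b S" "\<forall>d\<in>set_tree S. fst d = 1"
    using good_height_le[OF that(1)] that(2) by (intro order.antisym) (simp_all del: height_Vert_le)
qed simp

lemma height_le_set_tree: "height S \<le> a \<Longrightarrow> d \<in> set_tree S \<Longrightarrow> fst d \<le> a"
  by (induction S) auto

text \<open>Numbers do not decrease away from the root, so \<open>t\<close> is already dominated by
  the height of what lies above.\<close>

lemma height_unit: "good Q b (Vert (t, u) [R]) \<Longrightarrow> height (Vert (t, u) [R]) = height R"
  using good_le_height[of Q t R] by (intro height_eqI) auto

lemma height_contract:
  assumes "i < length ts" and "ts ! i = Vert (t, q') ts'"
  shows "height (Vert (t, q) ts) = height (Vert (t, q'') (take i ts @ ts' @ drop (i + 1) ts))"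
proof (rule height_eqI)
  have "set ts = insert (ts ! i) (set (take i ts) \<union> set (drop (i + 1) ts))"
    by (subst id_take_nth_drop[OF assms(1)]) auto
  then show "height (Vert (t, q) ts) \<le> x \<longleftrightarrow> height (Vert (t, q'') (take i ts @ ts' @ drop (i + 1) ts)) \<le> x" for x
    using assms(2) by (auto simp del: Suc_eq_plus1)
qed

lemma set_map_nth_permutes:
  assumes "\<sigma> permutes {..<length ts}"
  shows "set (map (\<lambda>j. ts ! \<sigma> j) [0..<length ts]) = set ts"
proof -
  have "set (map (\<lambda>j. ts ! \<sigma> j) [0..<length ts]) = (!) ts ` \<sigma> ` {..<length ts}"
    by (auto simp: image_image)
  also have "\<dots> = set ts"
    using permutes_image[OF assms] by (auto simp: in_set_conv_nth)
  finally show ?thesis .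
qed

text \<open>The \<open>LEAST\<close> ranges over all numbers, but a position below the total lies in
  one of the first \<open>k\<close> blocks. This matters where \<open>ns\<close> reads off list
  entries, which are unspecified beyond the end of the list.\<close>

lemma block_perm_cong:
  assumes "\<sigma> permutes {..<k}" and ns: "\<And>j. j < k \<Longrightarrow> ns j = ns' j"
  shows "block_perm k ns \<sigma> \<tau> = block_perm k ns' \<sigma> \<tau>"
proof
  fix p
  have lt: "(\<Sum>l<k. ns l) = (\<Sum>l<k. ns' l)" using ns by simp
  show "block_perm k ns \<sigma> \<tau> p = block_perm k ns' \<sigma> \<tau> p"
  proof (cases "p < (\<Sum>l<k. ns l)")
    case True
    define j where "j = (LEAST j. p < (\<Sum>l\<le>j. ns l))"
    have "k \<noteq> 0" using True by (cases k) auto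
    then have "{..k - 1} = {..<k}" by auto
    then have "p < (\<Sum>l\<le>k - 1. ns l)" using True by simp
    then have j: "p < (\<Sum>l\<le>j. ns l)" "j \<le> k - 1"
      unfolding j_def by (auto intro: LeastI Least_le)
    have eq: "(\<Sum>l\<le>i. ns l) = (\<Sum>l\<le>i. ns' l)" if "i < k" for i
      using that ns by (intro sum.cong) auto
    have jk: "j < k" using j(2) \<open>k \<noteq> 0\<close> by simp
    have j': "(LEAST j. p < (\<Sum>l\<le>j. ns' l)) = j"
    proof (rule Least_equality)
      show "p < (\<Sum>l\<le>j. ns' l)" using j(1) eq[OF jk] by simp
      show "j \<le> i" if "p < (\<Sum>l\<le>i. ns' l)" for i
      proof (rule ccontr)
        assume "\<not> j \<le> i"
        then have "i < j" "p < (\<Sum>l\<le>i. ns l)" using that eq[of i] jk by auto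
        then show False using not_less_Least unfolding j_def by blast
      qed
    qed
    have "\<sigma> j < k" using jk permutes_in_image[OF assms(1), of j] by simp
    then have "(\<Sum>l<\<sigma> j. ns (inv \<sigma> l)) = (\<Sum>l<\<sigma> j. ns' (inv \<sigma> l))"
      using permutes_in_image[OF permutes_inv[OF assms(1)]] by (intro sum.cong ns) auto
    moreover have "(\<Sum>l<j. ns l) = (\<Sum>l<j. ns' l)" using jk ns by (intro sum.cong) auto
    ultimately show ?thesis
      using True lt by (simp add: block_perm_def j' j_def[symmetric])
  qed (simp add: block_perm_def lt)
qed

lemma height_perm:
  "set ts' = set ts \<Longrightarrow> height (Vert (t, q') ts') = height (Vert (t, q) ts)"
  by (intro height_eqI) auto

text \<open>Cutting off at 0 keeps the numbers in the unit interval; order and equality of numbers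
  are preserved.\<close>

definition lower :: "real \<Rightarrow> (real \<times> 'q) tree \<Rightarrow> (real \<times> 'q) tree" where
  "lower c = map_tree (\<lambda>(t, q). (max 0 (t - c), q))"

lemma lower_simps [simp]:
  "lower c Leaf = Leaf" "lower c (Vert d ts) = Vert (max 0 (fst d - c), snd d) (map (lower c) ts)"
  by (simp_all add: lower_def case_prod_beta)

lemma good_lower: "good Q b S \<Longrightarrow> 0 \<le> c \<Longrightarrow> b' \<le> max 0 (b - c) \<Longrightarrow> good Q b' (lower c S)"
  by (induction S arbitrary: b b') auto

lemma lower_0: "good Q b S \<Longrightarrow> 0 \<le> b \<Longrightarrow> lower 0 S = S"
proof (induction S arbitrary: b)
  case (Vert d ts)
  then show ?case by (auto intro!: map_idI)
qed simp

lemma leaves_lower [simp]: "leaves (lower c S) = leaves S"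
  by (simp add: lower_def)

lemma lower_eq_0: "height S \<le> c \<Longrightarrow> d \<in> set_tree (lower c S) \<Longrightarrow> fst d = 0"
  by (auto simp: lower_def tree.set_map dest: height_le_set_tree)

section \<open>Elementary moves\<close>

text \<open>
  A move from \<open>S\<close> to \<open>S'\<close> relates the values of a family at two forests that differ in one
  branch: the value at the forest with \<open>S\<close> is \<open>\<phi> L k\<close> of the value at the forest with \<open>S'\<close>,
  where \<open>L\<close> counts the leaves of the latter and \<open>k\<close> those to the left of the branch.
\<close>

inductive move :: "'q operad_data \<Rightarrow> ('p, 'q, 'm) bimodule_data \<Rightarrow> (real \<times> 'q) tree \<Rightarrow> (real \<times> 'q) tree
    \<Rightarrow> (nat \<Rightarrow> nat \<Rightarrow> 'm \<Rightarrow> 'm) \<Rightarrow> bool" for Q M where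
  unit: "subtree S a = Some (Vert (t, op_unit Q) [R]) \<Longrightarrow> move Q M S (replace S a R) (\<lambda>L k x. x)"
| contract: "\<lbrakk>subtree S a = Some (Vert (t, q) ts); i < length ts; ts ! i = Vert (t, q') ts'\<rbrakk> \<Longrightarrow>
    move Q M S (replace S a
      (Vert (t, op_circ Q (length ts) (length ts') i q q') (take i ts @ ts' @ drop (i + 1) ts)))
      (\<lambda>L k x. x)"
| perm: "\<lbrakk>subtree S a = Some (Vert (t, q) ts); \<sigma> permutes {..<length ts};
      ts' = map (\<lambda>j. ts ! \<sigma> j) [0..<length ts]\<rbrakk> \<Longrightarrow>
    move Q M (replace S a (Vert (t, op_act Q (length ts) \<sigma> q) ts')) S
      (\<lambda>L k. bm_act M L
         (shift_perm (k + offset S a) (block_perm (length ts) (\<lambda>j. leaves (ts' ! j)) \<sigma> (\<lambda>_. id))))"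
| top: "\<lbrakk>subtree S a = Some R; R \<noteq> Leaf; \<forall>d\<in>set_tree R. fst d = 1\<rbrakk> \<Longrightarrow>
    move Q M S (replace S a Leaf)
      (\<lambda>L k x. bm_right M L (leaves R) (k + offset S a) x (composite Q R))"

lemma move_height:
  assumes "move Q M S S' \<phi>" and "good Q 0 S" and "good Q 0 S'"
  shows "height S = height S'"
  using assms
proof (cases rule: move.cases)
  case (unit a t R)
  then show ?thesis using height_unit good_subtree[OF assms(2) unit(3)] by (metis height_replace)
next
  case (contract a t q ts i q' ts')
  then show ?thesis using height_contract by (metis height_replace)
next
  case (perm a t q ts \<sigma> ts')
  then show ?thesis using height_perm set_map_nth_permutes by (metis height_replace)
next
  case (top a R)
  then have "height R = height Leaf" using height_eq_1 good_subtree[OF assms(2) top(3)] by auto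
  then show ?thesis using top height_replace by metis
qed

text \<open>The first three kinds of move refer to the numbers only through the equality of two of
  them, which lowering preserves. A move \<open>top\<close> requires a subtree of height 1; then
  \<open>S\<close> has height 1 as well, and the bound on \<open>c\<close> forces
  \<open>c = 0\<close>.\<close>

lemma move_lower:
  assumes m: "move Q M S S' \<phi>" and "good Q 0 S" and "good Q 0 S'" and "0 \<le> c" and "c \<le> 1 - height S"
  shows "move Q M (lower c S) (lower c S') \<phi>"
  using m
proof (cases rule: move.cases)
  case (unit a t R)
  have "move Q M (lower c S) (replace (lower c S) a (lower c R)) (\<lambda>L k x. x)"
    using unit by (intro move.unit[of _ _ "max 0 (t - c)"]) (simp add: lower_def subtree_map_tree)
  then show ?thesis using unit by (simp add: lower_def replace_map_tree)
next
  case (contract a t q ts i q' ts')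
  let ?f = "map (lower c)"
  have "move Q M (lower c S) (replace (lower c S) a
      (Vert (max 0 (t - c), op_circ Q (length (?f ts)) (length (?f ts')) i q q')
         (take i (?f ts) @ ?f ts' @ drop (i + 1) (?f ts)))) (\<lambda>L k x. x)"
    using contract
    by (intro move.contract) (simp_all add: lower_def subtree_map_tree)
  moreover have "Vert (max 0 (t - c), op_circ Q (length (?f ts)) (length (?f ts')) i q q')
         (take i (?f ts) @ ?f ts' @ drop (i + 1) (?f ts))
      = lower c (Vert (t, op_circ Q (length ts) (length ts') i q q') (take i ts @ ts' @ drop (i + 1) ts))"
    by (simp add: take_map drop_map)
  ultimately show ?thesis using contract by (simp add: lower_def replace_map_tree del: tree.map)
next
  case (perm a t q ts \<sigma> ts')
  let ?f = "map (lower c)"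
  have eq: "?f ts' = map (\<lambda>j. ?f ts ! \<sigma> j) [0..<length ts]"
    using perm(4,5) by (auto simp: permutes_in_image[OF perm(4), simplified])
  have "move Q M (replace (lower c S') a (Vert (max 0 (t - c), op_act Q (length (?f ts)) \<sigma> q) (?f ts')))
     (lower c S') (\<lambda>L k. bm_act M L (shift_perm (k + offset (lower c S') a)
        (block_perm (length (?f ts)) (\<lambda>j. leaves (?f ts' ! j)) \<sigma> (\<lambda>_. id))))"
    using perm eq
    by (intro move.perm[of _ _ _ q]) (simp_all add: lower_def subtree_map_tree)
  moreover have "Vert (max 0 (t - c), op_act Q (length (?f ts)) \<sigma> q) (?f ts')
      = lower c (Vert (t, op_act Q (length ts) \<sigma> q) ts')"
    by simp
  moreover have "offset (lower c S') a = offset S' a"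
    using perm(3) by (simp add: lower_def offset_map_tree)
  moreover have "block_perm (length (?f ts)) (\<lambda>j. leaves (?f ts' ! j)) \<sigma> (\<lambda>_. id)
      = block_perm (length ts) (\<lambda>j. leaves (ts' ! j)) \<sigma> (\<lambda>_. id)"
    using perm(4,5) by (simp, intro block_perm_cong) auto
  ultimately show ?thesis using perm by (simp add: lower_def replace_map_tree del: tree.map)
next
  case (top a R)
  then have "height R = 1" using height_eq_1 good_subtree[OF assms(2) top(3)] by auto
  then have "c = 0" using height_subtree[OF top(3)] assms(4,5) by auto
  then show ?thesis using m lower_0 assms(2,3) by (metis order.refl)
qed

section \<open>Families as functions on forests\<close>

abbreviation total :: "'d tree list \<Rightarrow> nat" where
  "total ts \<equiv> sum_list (map leaves ts)"

definition ins :: "'d \<Rightarrow> nat \<Rightarrow> 'd list \<Rightarrow> 'd list" where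
  "ins x j ts = take j ts @ x # drop j ts"

definition del :: "nat \<Rightarrow> 'd list \<Rightarrow> 'd list" where
  "del j ts = take j ts @ drop (Suc j) ts"

lemma length_ins [simp]: "length (ins x j ts) = Suc (length ts)"
  by (simp add: ins_def)

lemma length_del [simp]: "j < length ts \<Longrightarrow> length (del j ts) = length ts - 1"
  by (simp add: del_def)

lemma nth_ins:
  "j \<le> length ts \<Longrightarrow> i \<le> length ts \<Longrightarrow>
     ins x j ts ! i = (if i < j then ts ! i else if i = j then x else ts ! (i - 1))"
  by (auto simp: ins_def nth_append min_def nth_Cons')

lemma nth_del:
  "j < length ts \<Longrightarrow> i < length ts - 1 \<Longrightarrow> del j ts ! i = (if i < j then ts ! i else ts ! Suc i)"
  by (auto simp: del_def nth_append min_def)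

lemma ins_del: "j < length ts \<Longrightarrow> ts ! j = x \<Longrightarrow> ins x j (del j ts) = ts"
  by (auto simp: ins_def del_def min_def id_take_nth_drop[symmetric])

lemma set_ins [simp]: "set (ins x j ts) = insert x (set ts)"
proof -
  have "set ts = set (take j ts) \<union> set (drop j ts)"
    by (metis append_take_drop_id set_append)
  then show ?thesis by (auto simp: ins_def)
qed

lemma set_del: "set (del j ts) \<subseteq> set ts"
  by (auto simp: del_def dest: in_set_takeD in_set_dropD)

lemma ins_update:
  "j \<le> length ts \<Longrightarrow> b < length ts \<Longrightarrow>
     ins x j (ts[b := s]) = (ins x j ts)[(if b < j then b else Suc b) := s]"
  by (rule nth_equalityI) (auto simp: nth_ins nth_list_update)

lemma del_update_same: "del b (ts[b := s]) = del b ts"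
  by (simp add: del_def)

lemma del_update:
  "j < length ts \<Longrightarrow> b < length ts \<Longrightarrow> b \<noteq> j \<Longrightarrow>
     del j (ts[b := s]) = (del j ts)[(if b < j then b else b - 1) := s]"
  by (rule nth_equalityI) (auto simp: nth_del nth_list_update)

lemma del_map: "del j (map f ts) = map f (del j ts)"
  by (simp add: del_def take_map drop_map)

lemma total_ins: "leaves x = 0 \<Longrightarrow> total (ins x j ts) = total ts"
proof -
  have "total ts = total (take j ts @ drop j ts)" by simp
  then show "leaves x = 0 \<Longrightarrow> ?thesis" unfolding map_append sum_list_append by (simp add: ins_def)
qed

lemma total_del: "j < length ts \<Longrightarrow> leaves (ts ! j) = 0 \<Longrightarrow> total (del j ts) = total ts"
  by (metis ins_del total_ins)

text \<open>A branch without leaves shifts the positions of later branches but not the numbering of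
  the leaves; hence inserting one does not change the operation that belongs to a move
  elsewhere.\<close>

lemma total_take_ins:
  "leaves x = 0 \<Longrightarrow> j \<le> length ts \<Longrightarrow>
     total (take (if b < j then b else Suc b) (ins x j ts)) = total (take b ts)"
proof (cases "b < j")
  case False
  assume "leaves x = 0" and j: "j \<le> length ts"
  have "take (Suc b) (ins x j ts) = ins x j (take b ts)"
    using False j by (simp add: ins_def take_Cons' min_def Suc_diff_le drop_take)
  then show ?thesis using False total_ins \<open>leaves x = 0\<close> by simp
qed (simp add: ins_def)

lemma total_take_del:
  assumes "j < length ts" and "leaves (ts ! j) = 0" and "b \<noteq> j"
  shows "total (take (if b < j then b else b - 1) (del j ts)) = total (take b ts)"
proof -
  let ?b = "if b < j then b else b - 1"
  have "total (take (if ?b < j then ?b else Suc ?b) (ins (ts ! j) j (del j ts))) = total (take ?b (del j ts))"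
    using assms by (intro total_take_ins) auto
  moreover have "(if ?b < j then ?b else Suc ?b) = b" using assms(3) by auto
  ultimately show ?thesis using assms(1) by (simp add: ins_del)
qed

text \<open>Any root label would do, since \<open>decorations\<close> omits the root; see
  \<open>decorations_root\<close>.\<close>

definition val :: "('q, 'm) family \<Rightarrow> (real \<times> 'q) tree list \<Rightarrow> 'm" where
  "val f ts = value_at f (Vert undefined ts)"

lemma decorations_root: "decorations (Vert d ts) = decorations (Vert d' ts)"
  by (auto simp: decorations_def inner_vertices_Vert fun_eq_iff restrict_def)

lemma value_at_Vert: "value_at f (Vert d ts) = val f ts"
  using decorations_root[of d ts undefined] by (simp add: value_at_def val_def)

locale reduced_module =
  Q: operad Q + M: right_module Q "bm_space M" "bm_act M" "bm_right M"
  for Q :: "'q operad_data" and M :: "('p, 'q, 'm) bimodule_data" +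
  assumes reduced: "reduced_operad Q"
begin

lemma op_circ_closed:
  "\<lbrakk>i < n; x \<in> topspace (op_space Q n); y \<in> topspace (op_space Q m)\<rbrakk>
    \<Longrightarrow> op_circ Q n m i x y \<in> topspace (op_space Q (n + m - 1))"
  using continuous_map_image_subset_topspace[OF Q.continuous[of i n m]] by force

lemma op_act_closed:
  "\<lbrakk>\<sigma> permutes {..<n}; x \<in> topspace (op_space Q n)\<rbrakk> \<Longrightarrow> op_act Q n \<sigma> x \<in> topspace (op_space Q n)"
  using Q.symmetric continuous_map_image_subset_topspace unfolding symmetric_sequence_def by blast

lemma op_space_0: "topspace (op_space Q 0) = {star0 Q}"
proof -
  obtain z where z: "topspace (op_space Q 0) = {z}"
    using reduced unfolding reduced_operad_def by blast
  then show ?thesis by (simp add: star0_def)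
qed

abbreviation stump :: "(real \<times> 'q) tree" where
  "stump \<equiv> Vert (0, star0 Q) []"

lemma good_stump: "good Q 0 stump"
  by (simp add: op_space_0)

definition forests :: "nat \<Rightarrow> (real \<times> 'q) tree list set" where
  "forests n = {ts. length ts = n \<and> (\<forall>s\<in>set ts. good Q 0 s)}"

lemma forests_length: "ts \<in> forests n \<Longrightarrow> length ts = n"
  by (simp add: forests_def)

lemma forests_nth: "ts \<in> forests n \<Longrightarrow> i < n \<Longrightarrow> good Q 0 (ts ! i)"
  by (auto simp: forests_def)

lemma forests_update: "ts \<in> forests n \<Longrightarrow> good Q 0 s \<Longrightarrow> ts[b := s] \<in> forests n"
  by (auto simp: forests_def dest!: subsetD[OF set_update_subset_insert])

lemma forests_ins: "ts \<in> forests (n - 1) \<Longrightarrow> j < n \<Longrightarrow> good Q 0 s \<Longrightarrow> ins s j ts \<in> forests n"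
  by (auto simp: forests_def)

lemma forests_del: "ts \<in> forests n \<Longrightarrow> j < n \<Longrightarrow> del j ts \<in> forests (n - 1)"
  using set_del[of j ts] by (auto simp: forests_def)

lemma decorated_trees_forests: "Vert d ts \<in> decorated_trees Q n \<longleftrightarrow> ts \<in> forests n"
  by (simp add: decorated_trees_iff forests_def)

text \<open>The four defining conditions of \<open>Mf_space\<close> in uniform form, one root branch
  at a time. The rest of the forest enters only through two leaf counts, so adding or deleting a
  branch without leaves is harmless.\<close>

definition compatible :: "nat \<Rightarrow> ((real \<times> 'q) tree list \<Rightarrow> 'm) \<Rightarrow> bool" where
  "compatible n F \<longleftrightarrow> (\<forall>ts b S S' \<phi>. ts \<in> forests n \<and> b < n \<and> good Q 0 S \<and> good Q 0 S' \<and> move Q M S S' \<phi>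
     \<longrightarrow> F (ts[b := S]) = \<phi> (total (ts[b := S'])) (total (take b ts)) (F (ts[b := S'])))"

lemma compatibleD:
  "\<lbrakk>compatible n F; ts \<in> forests n; b < n; good Q 0 S; good Q 0 S'; move Q M S S' \<phi>\<rbrakk>
    \<Longrightarrow> F (ts[b := S]) = \<phi> (total (ts[b := S'])) (total (take b ts)) (F (ts[b := S']))"
  unfolding compatible_def by blast

text \<open>The address \<open>a\<close> in branch \<open>b\<close> is the address
  \<open>b # a\<close> in the whole tree; subtree, replacement and offset are translated
  accordingly.\<close>

lemma compatible_conditions:
  assumes "Mf_unit Q n f" "Mf_perm Q M n f" "Mf_contract Q n f" "Mf_top Q M n f"
  shows "compatible n (val f)"
  unfolding compatible_def
proof (intro allI impI, elim conjE)
  fix ts b S S' \<phi>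
  assume ts: "ts \<in> forests n" and b: "b < n" and S: "good Q 0 S" and S': "good Q 0 S'"
    and m: "move Q M S S' \<phi>"
  have lb: "b < length ts" using ts b by (simp add: forests_def)
  define X where "X R = (Vert undefined (ts[b := R]) :: (real \<times> 'q) tree)" for R
  have X: "X R \<in> decorated_trees Q n" if "good Q 0 R" for R
    using forests_update[OF ts that] by (simp add: X_def decorated_trees_forests)
  have sub: "subtree (X R) (b # a) = subtree R a" for R a
    using lb by (simp add: X_def)
  have rep: "replace (X R) (b # a) R' = X (replace R a R')" for R a R'
    using lb by (simp add: X_def)
  have off: "offset (X R) (b # a) = total (take b ts) + offset R a" for R a
    using lb by (simp add: X_def)
  have lv: "leaves (X R) = total (ts[b := R])" for R by (simp add: X_def)
  have v: "val f (ts[b := R]) = value_at f (X R)" for R by (simp add: val_def X_def)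
  show "val f (ts[b := S]) = \<phi> (total (ts[b := S'])) (total (take b ts)) (val f (ts[b := S']))"
    using m
  proof (cases rule: move.cases)
    case (unit a t R)
    then have "value_at f (X S) = value_at f (replace (X S) (b # a) R)"
      using assms(1)[unfolded Mf_unit_def, rule_format, OF X[OF S], of "b # a" t R] by (simp add: sub)
    then show ?thesis using unit by (simp add: v rep)
  next
    case (contract a t q us i q' us')
    then have "value_at f (X S) = value_at f (replace (X S) (b # a)
        (Vert (t, op_circ Q (length us) (length us') i q q') (take i us @ us' @ drop (i + 1) us)))"
      using assms(3)[unfolded Mf_contract_def, rule_format, OF X[OF S], of "b # a" t q us i q' us']
      by (simp add: sub)
    then show ?thesis using contract by (simp add: v rep)
  next
    case (perm a t q us \<sigma> us')
    then have "value_at f (replace (X S') (b # a) (Vert (t, op_act Q (length us) \<sigma> q) us'))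
        = bm_act M (leaves (X S'))
            (shift_perm (offset (X S') (b # a)) (block_perm (length us) (\<lambda>j. leaves (us' ! j)) \<sigma> (\<lambda>_. id)))
            (value_at f (X S'))"
      using assms(2)[unfolded Mf_perm_def, rule_format, OF X[OF S'], of "b # a" t q us \<sigma> us']
      by (simp add: sub)
    then show ?thesis using perm by (simp only: v rep off lv)
  next
    case (top a R)
    then have "b # a \<in> inner_vertices (X S)"
      using sub[of S a] by (cases R) (auto simp: inner_vertices_def)
    then have "value_at f (X S) = bm_right M (leaves (replace (X S) (b # a) Leaf)) (leaves R)
        (offset (X S) (b # a)) (value_at f (replace (X S) (b # a) Leaf)) (composite Q R)"
      using assms(4)[unfolded Mf_top_def, rule_format, OF X[OF S], of "b # a" R] top by (simp add: sub)
    then show ?thesis using top by (simp only: v rep off lv)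
  qed
qed

lemma conditions_compatible:
  assumes r: "compatible n (val f)"
  shows "Mf_unit Q n f" "Mf_perm Q M n f" "Mf_contract Q n f" "Mf_top Q M n f"
proof -
  \<comment> \<open>Every address other than the root lies in one root branch, so each condition
    need only be checked for an address \<open>b # a'\<close>. It then remains to see that the
    modified branch is good again.\<close>
  have *: "thesis"
    if X: "X \<in> decorated_trees Q n" and a: "a \<noteq> []" "subtree X a = Some R"
      and step: "\<And>d ts b a'. \<lbrakk>X = Vert d ts; a = b # a'; ts \<in> forests n; b < n; b < length ts;
          good Q 0 (ts ! b); subtree (ts ! b) a' = Some R\<rbrakk> \<Longrightarrow> thesis"
    for X a R and thesis :: bool
  proof -
    obtain d ts where ts: "X = Vert d ts" "length ts = n" "\<forall>s\<in>set ts. good Q 0 s"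
      using X by (rule decorated_treesE)
    obtain b a' where b: "a = b # a'" using a(1) by (cases a) auto
    have "b < n" "subtree (ts ! b) a' = Some R" using a(2) ts b by (auto split: if_splits)
    then show thesis using step[OF ts(1) b] ts by (auto simp: forests_def)
  qed
  note D = compatibleD[OF r]
  show "Mf_unit Q n f"
    unfolding Mf_unit_def
  proof (intro ballI allI impI, elim conjE)
    fix X a t R assume X: "X \<in> decorated_trees Q n" and a: "a \<noteq> []" "subtree X a = Some (Vert (t, op_unit Q) [R])"
    show "value_at f X = value_at f (replace X a R)"
    proof (rule *[OF X a])
      fix d ts b a'
      assume h: "X = Vert d ts" "a = b # a'" "ts \<in> forests n" "b < n" "b < length ts"
          "good Q 0 (ts ! b)" "subtree (ts ! b) a' = Some (Vert (t, op_unit Q) [R])"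
      have "good Q 0 (replace (ts ! b) a' R)"
        using h(6,7) by (rule good_replace) (auto intro: good_mono)
      from D[OF h(3,4,6) this move.unit[OF h(7)]] show ?thesis
        using h by (simp add: value_at_Vert)
    qed
  qed
  show "Mf_contract Q n f"
    unfolding Mf_contract_def
  proof (intro ballI allI impI, elim conjE)
    fix X a t q us i q' us'
    assume X: "X \<in> decorated_trees Q n" and a: "a \<noteq> []" "subtree X a = Some (Vert (t, q) us)"
      and i: "i < length us" "us ! i = Vert (t, q') us'"
    let ?R = "Vert (t, op_circ Q (length us) (length us') i q q') (take i us @ us' @ drop (i + 1) us)"
    show "value_at f X = value_at f (replace X a ?R)"
    proof (rule *[OF X a])
      fix d ts b a'
      assume h: "X = Vert d ts" "a = b # a'" "ts \<in> forests n" "b < n" "b < length ts"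
          "good Q 0 (ts ! b)" "subtree (ts ! b) a' = Some (Vert (t, q) us)"
      have "good Q 0 (replace (ts ! b) a' ?R)"
        using h(6,7)
      proof (rule good_replace)
        fix c assume g: "good Q c (Vert (t, q) us)"
        have q': "good Q t (Vert (t, q') us')" using g i by (metis fst_conv good.simps(2) nth_mem)
        have "op_circ Q (length us) (length us') i q q' \<in> topspace (op_space Q (length us + length us' - 1))"
          using i(1) g q' by (intro op_circ_closed) auto
        moreover have "length (take i us @ us' @ drop (i + 1) us) = length us + length us' - 1"
          using i(1) by simp
        ultimately show "good Q c ?R"
          using g q' by (auto dest: in_set_takeD in_set_dropD)
      qed
      from D[OF h(3,4,6) this move.contract[OF h(7) i]] show ?thesis
        using h by (simp add: value_at_Vert)
    qed
  qed
  show "Mf_perm Q M n f"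
    unfolding Mf_perm_def
  proof (intro ballI allI impI, elim conjE)
    fix X a t q us \<sigma> us'
    assume X: "X \<in> decorated_trees Q n" and a: "a \<noteq> []" "subtree X a = Some (Vert (t, q) us)"
      and \<sigma>: "\<sigma> permutes {..<length us}" and us': "us' = map (\<lambda>j. us ! \<sigma> j) [0..<length us]"
    let ?R = "Vert (t, op_act Q (length us) \<sigma> q) us'"
    let ?\<pi> = "block_perm (length us) (\<lambda>j. leaves (us' ! j)) \<sigma> (\<lambda>_. id)"
    show "value_at f (replace X a ?R) = bm_act M (leaves X) (shift_perm (offset X a) ?\<pi>) (value_at f X)"
    proof (rule *[OF X a])
      fix d ts b a'
      assume h: "X = Vert d ts" "a = b # a'" "ts \<in> forests n" "b < n" "b < length ts"
          "good Q 0 (ts ! b)" "subtree (ts ! b) a' = Some (Vert (t, q) us)"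
      have "good Q 0 (replace (ts ! b) a' ?R)"
        using h(6,7)
      proof (rule good_replace)
        fix c assume g: "good Q c (Vert (t, q) us)"
        moreover have "length us' = length us" using us' by simp
        ultimately show "good Q c ?R"
          using op_act_closed[OF \<sigma>] set_map_nth_permutes[OF \<sigma>] us' by simp
      qed
      from D[OF h(3,4) this h(6) move.perm[OF h(7) \<sigma> us']] show ?thesis
        using h by (simp add: value_at_Vert)
    qed
  qed
  show "Mf_top Q M n f"
    unfolding Mf_top_def
  proof (intro ballI allI impI, elim conjE)
    fix X a R
    assume X: "X \<in> decorated_trees Q n" and inner: "a \<in> inner_vertices X" and a: "subtree X a = Some R"
      and one: "\<forall>d\<in>set_tree R. fst d = 1"
    have "a \<noteq> []" "R \<noteq> Leaf" using inner a by (auto simp: inner_vertices_def)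
    show "value_at f X = bm_right M (leaves (replace X a Leaf)) (leaves R) (offset X a)
        (value_at f (replace X a Leaf)) (composite Q R)"
    proof (rule *[OF X \<open>a \<noteq> []\<close> a])
      fix d ts b a'
      assume h: "X = Vert d ts" "a = b # a'" "ts \<in> forests n" "b < n" "b < length ts"
          "good Q 0 (ts ! b)" "subtree (ts ! b) a' = Some R"
      have "good Q 0 (replace (ts ! b) a' Leaf)"
        using h(6,7) by (rule good_replace) simp
      from D[OF h(3,4,6) this move.top[OF h(7) \<open>R \<noteq> Leaf\<close> one]] show ?thesis
        using h by (simp add: value_at_Vert)
    qed
  qed
qed

lemma topspace_Mf_space:
  "f \<in> topspace (Mf_space Q M n) \<longleftrightarrow>
     f \<in> (\<Pi>\<^sub>E T\<in>trees n. maps (HD_space Q T) (bm_space M (leaves T))) \<and> compatible n (val f)"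
proof -
  have "topspace (Mf_space Q M n) = (\<Pi>\<^sub>E T\<in>trees n. maps (HD_space Q T) (bm_space M (leaves T))) \<inter>
       {f. Mf_unit Q n f \<and> Mf_perm Q M n f \<and> Mf_contract Q n f \<and> Mf_top Q M n f}"
    by (simp add: Mf_space_def)
  then show ?thesis using compatible_conditions conditions_compatible by blast
qed

section \<open>Points of \<open>HD_space Q T\<close> as forests of shape \<open>T\<close>\<close>

definition forest_of :: "unit tree \<Rightarrow> (nat list \<Rightarrow> real) \<times> (nat list \<Rightarrow> 'q) \<Rightarrow> (real \<times> 'q) tree list" where
  "forest_of T x = kids (decorate T (\<lambda>a. (fst x a, snd x a)))"

lemma decorate_forest_of:
  assumes "T \<in> trees n"
  shows "decorate T (\<lambda>a. (fst x a, snd x a)) = Vert (fst x [], snd x []) (forest_of T x)"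
  using assms by (auto simp: trees_def forest_of_def)

lemma shape_forest_of:
  assumes "T \<in> trees n"
  shows "Vert () (map shape (forest_of T x)) = T"
  using shape_decorate[of T] decorate_forest_of[OF assms, of x] by (metis tree.map(2))

lemma label_forest_of:
  assumes "T \<in> trees n" and "v \<in> inner_vertices T"
  shows "label (Vert d (forest_of T x)) v = (fst x v, snd x v)"
proof -
  have "v \<in> verts T" "v \<noteq> []" using assms(2) by (auto simp: inner_vertices_verts)
  moreover have "label (Vert d (forest_of T x)) v = label (Vert (fst x [], snd x []) (forest_of T x)) v"
    using \<open>v \<noteq> []\<close> by (cases v) (auto simp: label_def)
  ultimately show ?thesis
    using label_decorate decorate_forest_of[OF assms(1), of x] by (metis (no_types, lifting))
qed

lemma decorations_forest_of:
  assumes "T \<in> trees n" and "x \<in> topspace (HD_space Q T)"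
  shows "decorations (Vert d (forest_of T x)) = x"
proof -
  have "inner_vertices (Vert d (forest_of T x)) = inner_vertices T"
    using shape_forest_of[OF assms(1), of x] by (metis inner_vertices_map_tree tree.map(2))
  then have "decorations (Vert d (forest_of T x))
      = (\<lambda>v\<in>inner_vertices T. fst x v, \<lambda>v\<in>inner_vertices T. snd x v)"
    using label_forest_of[OF assms(1)] by (auto simp: decorations_def fun_eq_iff restrict_def)
  also have "\<dots> = x"
    using assms(2) unfolding topspace_HD_space topspace_D_space mem_Times_iff topspace_H_space
    by (auto simp: prod_eq_iff PiE_def intro: extensional_restrict)
  finally show ?thesis .
qed

lemma forest_of_forests:
  assumes "T \<in> trees n" and "x \<in> topspace (HD_space Q T)"
  shows "forest_of T x \<in> forests n"
proof -
  have "Vert undefined (forest_of T x) \<in> decorated_trees Q n"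
    unfolding decorated_trees_def
    using assms decorations_forest_of shape_forest_of by auto
  then show ?thesis by (simp add: decorated_trees_forests)
qed

lemma total_forest_of: "T \<in> trees n \<Longrightarrow> total (forest_of T x) = leaves T"
proof -
  assume "T \<in> trees n"
  then have "leaves T = leaves (Vert () (map shape (forest_of T x)))" by (simp add: shape_forest_of)
  then show ?thesis by (simp add: o_def)
qed

lemma val_forest_of:
  assumes "T \<in> trees n" and "x \<in> topspace (HD_space Q T)"
  shows "val f (forest_of T x) = f T x"
  using assms decorations_forest_of shape_forest_of by (simp add: val_def value_at_def)

lemma forests_decorations:
  assumes "ts \<in> forests n"
  shows "Vert () (map shape ts) \<in> trees n"
    and "decorations (Vert undefined ts) \<in> topspace (HD_space Q (Vert () (map shape ts)))"
  using assms decorated_trees_forests[of undefined ts n]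
  by (auto simp: decorated_trees_def)

lemma forest_of_decorations:
  assumes "ts \<in> forests n"
  shows "forest_of (Vert () (map shape ts)) (decorations (Vert d ts)) = ts"
proof -
  let ?x = "decorations (Vert d ts)"
  have "decorate (shape (ts ! i)) (\<lambda>a. (fst ?x (i # a), snd ?x (i # a))) = ts ! i" if "i < length ts" for i
    using that by (intro decorate_shape) (auto simp: decorations_def inner_vertices_Vert)
  then show ?thesis by (auto simp: forest_of_def intro!: nth_equalityI)
qed

definition fam :: "nat \<Rightarrow> ((real \<times> 'q) tree list \<Rightarrow> 'm) \<Rightarrow> ('q, 'm) family" where
  "fam n F = (\<lambda>T\<in>trees n. \<lambda>x\<in>topspace (HD_space Q T). F (forest_of T x))"

lemma family_of_fam: "family_of Q n (\<lambda>X. F (kids X)) = fam n F"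
  by (auto simp: family_of_def fam_def forest_of_def fun_eq_iff restrict_def)

lemma val_fam: "ts \<in> forests n \<Longrightarrow> val (fam n F) ts = F ts"
  using forests_decorations forest_of_decorations
  by (simp add: val_def value_at_def fam_def)

lemma fam_in_Mf_space:
  assumes "compatible n F"
    and "\<And>T. T \<in> trees n \<Longrightarrow> continuous_map (HD_space Q T) (bm_space M (leaves T)) (\<lambda>x. F (forest_of T x))"
  shows "fam n F \<in> topspace (Mf_space Q M n)"
proof -
  have "fam n F T \<in> maps (HD_space Q T) (bm_space M (leaves T))" if "T \<in> trees n" for T
    using assms(2)[OF that] that by (auto simp: fam_def maps_def elim: continuous_map_eq)
  moreover have "compatible n (val (fam n F))"
    using assms(1) unfolding compatible_def by (metis forests_update val_fam)
  ultimately show ?thesis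
    unfolding topspace_Mf_space by (auto simp: PiE_iff fam_def)
qed

text \<open>Families are extensional in the tree and in the decorations, and every point of
  \<open>HD_space Q T\<close> comes from a forest.\<close>

lemma Mf_space_eqI:
  assumes "f \<in> topspace (Mf_space Q M n)" and "g \<in> topspace (Mf_space Q M n)"
    and "\<And>ts. ts \<in> forests n \<Longrightarrow> val f ts = val g ts"
  shows "f = g"
proof (rule PiE_ext)
  show f: "f \<in> (\<Pi>\<^sub>E T\<in>trees n. maps (HD_space Q T) (bm_space M (leaves T)))"
    and g: "g \<in> (\<Pi>\<^sub>E T\<in>trees n. maps (HD_space Q T) (bm_space M (leaves T)))"
    using assms(1,2) by (simp_all add: topspace_Mf_space)
  fix T assume T: "T \<in> trees n"
  show "f T = g T"
  proof (rule extensionalityI)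
    show "f T \<in> extensional (topspace (HD_space Q T))" "g T \<in> extensional (topspace (HD_space Q T))"
      using f g T by (auto simp: maps_def)
    show "f T x = g T x" if "x \<in> topspace (HD_space Q T)" for x
      using assms(3)[OF forest_of_forests[OF T that]] by (simp add: val_forest_of[OF T that])
  qed
qed

lemma val_closed:
  assumes "f \<in> topspace (Mf_space Q M n)" and "ts \<in> forests n"
  shows "val f ts \<in> topspace (bm_space M (total ts))"
proof -
  let ?T = "Vert () (map shape ts)"
  have "f ?T \<in> maps (HD_space Q ?T) (bm_space M (leaves ?T))"
    using assms(1) forests_decorations(1)[OF assms(2)] by (simp only: topspace_Mf_space PiE_iff)
  then have "f ?T (decorations (Vert undefined ts)) \<in> topspace (bm_space M (leaves ?T))"
    using forests_decorations(2)[OF assms(2)] by (auto simp: maps_def continuous_map_def)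
  then show ?thesis by (simp add: val_def value_at_def o_def)
qed

lemma Mf_space_compatible: "f \<in> topspace (Mf_space Q M n) \<Longrightarrow> compatible n (val f)"
  by (simp add: topspace_Mf_space)

section \<open>Continuity of maps between spaces of decorations\<close>

lemma continuous_map_HD_coord:
  assumes "continuous_map C (HD_space Q T) \<kappa>" and "v \<in> inner_vertices T"
  shows "continuous_map C euclideanreal (\<lambda>c. fst (\<kappa> c) v)"
proof -
  have "continuous_map C (prod_topology (H_space T) (D_space Q T)) \<kappa>"
    using assms(1) unfolding HD_space_def kprod_def by (rule continuous_map_into_kifyD)
  then have "continuous_map C (H_space T) (\<lambda>c. fst (\<kappa> c))"
    using continuous_map_fst_of[of C "H_space T" "D_space Q T" \<kappa>] by (simp add: o_def)
  then have "continuous_map C (product_topology (\<lambda>_. top_of_set {0..1::real}) (inner_vertices T)) (\<lambda>c. fst (\<kappa> c))"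
    unfolding H_space_def by (rule continuous_map_into_fulltopology)
  from continuous_map_compose[OF this continuous_map_product_projection[OF assms(2)]]
  have "continuous_map C (top_of_set {0..1}) (\<lambda>c. fst (\<kappa> c) v)"
    by (simp add: o_def)
  then show ?thesis by (rule continuous_map_into_fulltopology)
qed

text \<open>Covers all modifications of trees that occur below: the numbers change continuously,
  while each operad label is either copied from a fixed vertex of \<open>T\<close> or constant, as
  on an added stump.\<close>

lemma continuous_map_decorations:
  fixes C :: "'k topology"
    and e :: "'k \<Rightarrow> ((nat list \<Rightarrow> real) \<times> (nat list \<Rightarrow> 'q)) huge"
  assumes C: "compact_Hausdorff C" and e: "inj e"
    and \<kappa>: "continuous_map C (HD_space Q T) \<kappa>"
    and T': "T' \<in> trees n"
    and X: "\<And>c. c \<in> topspace C \<Longrightarrow> X c \<in> forests n"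
      "\<And>c. c \<in> topspace C \<Longrightarrow> Vert () (map shape (X c)) = T'"
    and t: "\<And>v. v \<in> inner_vertices T' \<Longrightarrow>
        continuous_map C euclideanreal (\<lambda>c. fst (label (Vert undefined (X c)) v))"
    and q: "\<And>v. v \<in> inner_vertices T' \<Longrightarrow>
        (\<exists>w\<in>inner_vertices T. arity T w = arity T' v \<and>
          (\<forall>c\<in>topspace C. snd (label (Vert undefined (X c)) v) = snd (\<kappa> c) w)) \<or>
        (\<exists>y\<in>topspace (op_space Q (arity T' v)). \<forall>c\<in>topspace C. snd (label (Vert undefined (X c)) v) = y)"
  shows "continuous_map C (HD_space Q T') (\<lambda>c. decorations (Vert undefined (X c)))"
proof -
  let ?d = "\<lambda>c. decorations (Vert undefined (X c))"
  have inner: "inner_vertices (Vert undefined (X c)) = inner_vertices T'" if "c \<in> topspace C" for c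
    using X(2)[OF that] by (metis inner_vertices_map_tree tree.map(2))
  have d: "?d c \<in> topspace (HD_space Q T')" if "c \<in> topspace C" for c
    using forests_decorations(2)[OF X(1)[OF that]] X(2)[OF that] by simp
  have "continuous_map C (H_space T') (\<lambda>c. fst (?d c))"
    unfolding H_space_def
  proof (rule continuous_map_into_subtopology)
    show "(\<lambda>c. fst (?d c)) \<in> topspace C \<rightarrow>
        {t. \<forall>v\<in>inner_vertices T'. \<forall>w\<in>inner_vertices T'. strict_prefix v w \<longrightarrow> t v \<le> t w}"
      using d by (auto simp: topspace_HD_space mem_Times_iff topspace_H_space)
    show "continuous_map C (product_topology (\<lambda>_. top_of_set {0..1}) (inner_vertices T')) (\<lambda>c. fst (?d c))"
    proof (rule continuous_map_coordinatewise_then_product)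
      fix v assume v: "v \<in> inner_vertices T'"
      have "continuous_map C euclideanreal (\<lambda>c. fst (?d c) v)"
        using t[OF v] by (rule continuous_map_eq) (simp add: decorations_def inner v)
      moreover have "(\<lambda>c. fst (?d c) v) \<in> topspace C \<rightarrow> {0..1}"
        using d v by (fastforce simp: topspace_HD_space mem_Times_iff topspace_H_space PiE_iff)
      ultimately show "continuous_map C (top_of_set {0..1}) (\<lambda>c. fst (?d c) v)"
        by (rule continuous_map_into_subtopology)
    qed (simp add: decorations_def inner)
  qed
  moreover have "continuous_map C (D_space Q T') (\<lambda>c. snd (?d c))"
  proof -
    define P where "P v w \<longleftrightarrow> w \<in> inner_vertices T \<and> arity T w = arity T' v \<and>
        (\<forall>c\<in>topspace C. snd (label (Vert undefined (X c)) v) = snd (\<kappa> c) w)" for v w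
    define R where "R v y \<longleftrightarrow> y \<in> topspace (op_space Q (arity T' v)) \<and>
        (\<forall>c\<in>topspace C. snd (label (Vert undefined (X c)) v) = y)" for v y
    define w y where "w v = (SOME w. P v w)" and "y v = (SOME y. R v y)" for v
    have w: "P v (w v)" if "Ex (P v)" for v
      unfolding w_def using that by (rule someI_ex)
    have y: "R v (y v)" if "Ex (R v)" for v
      unfolding y_def using that by (rule someI_ex)
    \<comment> \<open>The labels are obtained by a map \<open>\<rho>\<close> between the two
      products, which live on one type; its continuity for the k-topologies is then the
      functoriality of \<open>kify\<close>.\<close>
    define \<rho> where "\<rho> z = (\<lambda>v\<in>inner_vertices T'. if Ex (P v) then z (w v) else y v)"
      for z :: "nat list \<Rightarrow> 'q"
    have R: "R v (y v)" if "v \<in> inner_vertices T'" "\<not> Ex (P v)" for v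
    proof (rule y)
      show "Ex (R v)" using q[OF that(1)] that(2) unfolding P_def R_def by blast
    qed
    have "continuous_map (product_topology (\<lambda>v. op_space Q (arity T v)) (inner_vertices T))
        (product_topology (\<lambda>v. op_space Q (arity T' v)) (inner_vertices T')) \<rho>"
    proof (rule continuous_map_coordinatewise_then_product)
      fix v assume v: "v \<in> inner_vertices T'"
      show "continuous_map (product_topology (\<lambda>v. op_space Q (arity T v)) (inner_vertices T))
          (op_space Q (arity T' v)) (\<lambda>z. \<rho> z v)"
      proof (cases "Ex (P v)")
        case True
        then have wv: "w v \<in> inner_vertices T" "arity T (w v) = arity T' v" using w unfolding P_def by blast+
        have "continuous_map (product_topology (\<lambda>v. op_space Q (arity T v)) (inner_vertices T))
            (op_space Q (arity T (w v))) (\<lambda>z. z (w v))"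
          by (rule continuous_map_product_projection[OF wv(1)])
        then show ?thesis using v wv(2) by (simp add: \<rho>_def if_P[OF True])
      next
        case False
        then have "y v \<in> topspace (op_space Q (arity T' v))" using R[OF v] unfolding R_def by blast
        then show ?thesis using v by (simp add: \<rho>_def if_not_P[OF False])
      qed
    qed (simp add: \<rho>_def)
    then have "continuous_map (D_space Q T) (D_space Q T') \<rho>"
      unfolding D_space_def kproduct_def by (rule continuous_map_kify)
    moreover have "continuous_map C (D_space Q T) (\<lambda>c. snd (\<kappa> c))"
    proof -
      have "continuous_map C (prod_topology (H_space T) (D_space Q T)) \<kappa>"
        using \<kappa> unfolding HD_space_def kprod_def by (rule continuous_map_into_kifyD)
      then show ?thesis
        using continuous_map_snd_of[of C "H_space T" "D_space Q T" \<kappa>] by (simp add: o_def)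
    qed
    ultimately have "continuous_map C (D_space Q T') (\<rho> \<circ> (\<lambda>c. snd (\<kappa> c)))"
      by (rule continuous_map_compose[rotated])
    then show ?thesis
    proof (rule continuous_map_eq)
      fix c assume c: "c \<in> topspace C"
      show "(\<rho> \<circ> (\<lambda>c. snd (\<kappa> c))) c = snd (?d c)"
      proof
        fix v
        show "(\<rho> \<circ> (\<lambda>c. snd (\<kappa> c))) c v = snd (?d c) v"
        proof (cases "v \<in> inner_vertices T'")
          case v: True
          show ?thesis
          proof (cases "Ex (P v)")
            case True
            then have "snd (label (Vert undefined (X c)) v) = snd (\<kappa> c) (w v)"
              using w c unfolding P_def by blast
            then show ?thesis using v c by (simp add: \<rho>_def decorations_def inner if_P[OF True])
          next
            case False
            then have "snd (label (Vert undefined (X c)) v) = y v" using R[OF v] c unfolding R_def by blast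
            then show ?thesis using v c by (simp add: \<rho>_def decorations_def inner if_not_P[OF False])
          qed
        qed (simp add: \<rho>_def decorations_def inner c)
      qed
    qed
  qed
  ultimately have "continuous_map C (prod_topology (H_space T') (D_space Q T')) (\<lambda>c. (fst (?d c), snd (?d c)))"
    by (rule continuous_map_pairedI)
  then show ?thesis
    unfolding HD_space_def kprod_def prod.collapse by (rule continuous_map_into_kify[OF C e])
qed

lemma continuous_map_Mf_component:
  assumes "T \<in> trees n"
  shows "continuous_map (Mf_space Q M n) (Map (HD_space Q T) (bm_space M (leaves T))) (\<lambda>f. f T)"
proof -
  have "continuous_map (Mf_space Q M n) (kproduct (trees n) (\<lambda>T. Map (HD_space Q T) (bm_space M (leaves T)))) (\<lambda>f. f)"
    unfolding Mf_space_def by (rule continuous_map_ksub_id)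
  from continuous_map_compose[OF this continuous_map_kproduct_proj[OF assms]]
  show ?thesis by (simp add: o_def)
qed

section \<open>The functor on order preserving injections\<close>

definition cap :: "nat \<Rightarrow> nat \<Rightarrow> ('q, 'm) family \<Rightarrow> ('q, 'm) family" where
  "cap n j f = fam (n - 1) (\<lambda>ts. val f (ins stump j ts))"

text \<open>For arity 0 no root edge is moved onto the new vertex, which carries the number 0 and
  the label \<open>star0 Q\<close>: it is a stump.\<close>

lemma Mf_right_star0: "Mf_right Q n 0 j f (star0 Q) = cap n j f"
  unfolding Mf_right_def cap_def family_of_fam[symmetric]
  by (simp add: value_at_Vert ins_def)

text \<open>A move in branch \<open>b\<close> becomes the same move at the shifted position; both
  leaf counts are unchanged because the stump has no leaves.\<close>

lemma compatible_ins:
  assumes F: "compatible n F" and j: "j < n"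
  shows "compatible (n - 1) (\<lambda>ts. F (ins stump j ts))"
  unfolding compatible_def
proof (intro allI impI, elim conjE)
  fix ts b S S' \<phi>
  assume ts: "ts \<in> forests (n - 1)" and b: "b < n - 1" and S: "good Q 0 S" "good Q 0 S'"
    and m: "move Q M S S' \<phi>"
  let ?b = "if b < j then b else Suc b"
  have l: "length ts = n - 1" using ts by (rule forests_length)
  have upd: "ins stump j (ts[b := R]) = (ins stump j ts)[?b := R]" for R
    using b j l by (intro ins_update) auto
  have "F ((ins stump j ts)[?b := S]) = \<phi> (total ((ins stump j ts)[?b := S']))
      (total (take ?b (ins stump j ts))) (F ((ins stump j ts)[?b := S']))"
    using b j by (intro compatibleD[OF F _ _ S m] forests_ins[OF ts j good_stump]) auto
  moreover have "total (take ?b (ins stump j ts)) = total (take b ts)"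
    using j l by (intro total_take_ins) auto
  moreover have "total ((ins stump j ts)[?b := S']) = total (ts[b := S'])"
    unfolding upd[symmetric] by (intro total_ins) auto
  ultimately show "F (ins stump j (ts[b := S])) = \<phi> (total (ts[b := S'])) (total (take b ts))
      (F (ins stump j (ts[b := S'])))"
    unfolding upd by (simp only:)
qed

definition cap_tree :: "nat \<Rightarrow> unit tree \<Rightarrow> unit tree" where
  "cap_tree j T = Vert () (ins (Vert () []) j (kids T))"

lemma cap_tree_trees: "T \<in> trees (n - 1) \<Longrightarrow> j < n \<Longrightarrow> cap_tree j T \<in> trees n"
  by (auto simp: cap_tree_def trees_def)

lemma leaves_cap_tree: "T \<in> trees n \<Longrightarrow> leaves (cap_tree j T) = leaves T"
  using total_ins[of "Vert () []" j "kids T"] by (auto simp: cap_tree_def trees_def)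

lemma shape_cap:
  assumes "T \<in> trees n"
  shows "Vert () (map shape (ins stump j (forest_of T x))) = cap_tree j T"
proof -
  have "map shape (forest_of T x) = kids T"
    using shape_forest_of[OF assms, of x] by (metis kids.simps(2))
  then show ?thesis by (simp add: cap_tree_def ins_def take_map drop_map flip: take_map drop_map)
qed

lemma continuous_map_cap_tree:
  assumes T: "T \<in> trees (n - 1)" and j: "j < n"
  shows "continuous_map (HD_space Q T) (HD_space Q (cap_tree j T))
    (\<lambda>x. decorations (Vert undefined (ins stump j (forest_of T x))))" (is "continuous_map _ _ ?\<phi>")
proof -
  note T' = cap_tree_trees[OF T j]
  have in_forests: "ins stump j (forest_of T x) \<in> forests n" if "x \<in> topspace (HD_space Q T)" for x
    using forest_of_forests[OF T that] j good_stump by (rule forests_ins)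
  have lT: "length (kids T) = n - 1" using T by (auto simp: trees_def)
  have lf: "length (forest_of T x) = n - 1" for x
    using shape_forest_of[OF T, of x] lT by (metis kids.simps(2) length_map)
  have kidsT: "T = Vert () (kids T)" using T by (auto simp: trees_def)
  show ?thesis
    unfolding HD_space_def[of Q T] kprod_def
  proof (rule continuous_map_from_kify)
    show "?\<phi> \<in> topspace (prod_topology (H_space T) (D_space Q T)) \<rightarrow> topspace (HD_space Q (cap_tree j T))"
    proof
      fix x assume "x \<in> topspace (prod_topology (H_space T) (D_space Q T))"
      then have "x \<in> topspace (HD_space Q T)" by (simp add: HD_space_def)
      from forests_decorations(2)[OF in_forests[OF this]]
      show "?\<phi> x \<in> topspace (HD_space Q (cap_tree j T))" by (simp only: shape_cap[OF T])
    qed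
    fix K :: "((nat list \<Rightarrow> real) \<times> (nat list \<Rightarrow> 'q)) huge topology" and k
    assume K: "compact_Hausdorff K" and "continuous_map K (prod_topology (H_space T) (D_space Q T)) k"
    then have k: "continuous_map K (HD_space Q T) k"
      unfolding HD_space_def kprod_def by (intro continuous_map_into_kify[OF _ inj_on_id])
    then have kin: "k c \<in> topspace (HD_space Q T)" if "c \<in> topspace K" for c
      using that by (auto simp: continuous_map_def)
    \<comment> \<open>A vertex of the capped tree is either the new one, with constant label, or a
      vertex of \<open>T\<close> whose address is shifted in its first entry.\<close>
    have lab: "(v = [j] \<and> arity (cap_tree j T) v = 0 \<and> (\<forall>x. label (Vert undefined (ins stump j (forest_of T x))) v = (0, star0 Q)))
        \<or> (\<exists>w\<in>inner_vertices T. arity T w = arity (cap_tree j T) v \<and>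
             (\<forall>x. label (Vert undefined (ins stump j (forest_of T x))) v = (fst x w, snd x w)))"
      if v: "v \<in> inner_vertices (cap_tree j T)" for v
    proof -
      obtain i a where ia: "v = i # a" "i < n" "a \<in> verts (ins (Vert () []) j (kids T) ! i)"
        using v lT j by (auto simp: cap_tree_def inner_vertices_Vert)
      have nth: "ins (Vert () []) j (kids T) ! i = (if i < j then kids T ! i else if i = j then Vert () [] else kids T ! (i - 1))"
        using lT ia(2) j by (intro nth_ins) auto
      have nth': "ins stump j (forest_of T x) ! i
          = (if i < j then forest_of T x ! i else if i = j then stump else forest_of T x ! (i - 1))" for x
        using lf ia(2) j by (intro nth_ins) auto
      show ?thesis
      proof (cases "i = j")
        case True
        then have "a = []" using ia(3) nth by (auto simp: verts_Vert)
        then show ?thesis using True ia(1) nth nth' lT lf j by (intro disjI1) (simp add: cap_tree_def)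
      next
        case False
        let ?i = "if i < j then i else i - 1"
        have i': "?i < n - 1" using False ia(2) j by auto
        have a: "a \<in> verts (kids T ! ?i)" using ia(3) nth False by (auto split: if_splits)
        then have w: "?i # a \<in> inner_vertices T"
          using i' lT by (subst kidsT) (simp add: inner_vertices_verts)
        have "label (Vert undefined (ins stump j (forest_of T x))) v = label (Vert undefined (forest_of T x)) (?i # a)" for x
          using ia(1,2) False nth' lf i' j by simp
        moreover have "arity T (?i # a) = arity (cap_tree j T) v"
          using ia(1,2) False nth lT i' j by (subst kidsT) (simp add: cap_tree_def)
        ultimately show ?thesis using w label_forest_of[OF T w] by (intro disjI2 bexI[OF _ w]) auto
      qed
    qed
    have "continuous_map K (HD_space Q (cap_tree j T))
        (\<lambda>c. decorations (Vert undefined (ins stump j (forest_of T (k c)))))"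
    proof (rule continuous_map_decorations[OF K inj_on_id k T'])
      show "ins stump j (forest_of T (k c)) \<in> forests n" if "c \<in> topspace K" for c
        using kin[OF that] by (rule in_forests)
      show "Vert () (map shape (ins stump j (forest_of T (k c)))) = cap_tree j T" for c
        by (rule shape_cap[OF T])
      fix v assume v: "v \<in> inner_vertices (cap_tree j T)"
      show "continuous_map K euclideanreal (\<lambda>c. fst (label (Vert undefined (ins stump j (forest_of T (k c)))) v))"
        using lab[OF v] by (elim disjE conjE bexE) (simp_all add: continuous_map_HD_coord[OF k] del: split_paired_All)
      show "(\<exists>w\<in>inner_vertices T. arity T w = arity (cap_tree j T) v \<and>
          (\<forall>c\<in>topspace K. snd (label (Vert undefined (ins stump j (forest_of T (k c)))) v) = snd (k c) w)) \<or>
        (\<exists>y\<in>topspace (op_space Q (arity (cap_tree j T) v)).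
          \<forall>c\<in>topspace K. snd (label (Vert undefined (ins stump j (forest_of T (k c)))) v) = y)"
        using lab[OF v] op_space_0 by (elim disjE conjE bexE) (auto simp del: split_paired_All)
    qed
    then show "continuous_map K (HD_space Q (cap_tree j T)) (?\<phi> \<circ> k)" by (simp add: o_def)
  qed
qed

lemma cap_component:
  assumes T: "T \<in> trees (n - 1)" and j: "j < n"
  shows "cap n j f T = restrict (f (cap_tree j T) \<circ> (\<lambda>x. decorations (Vert undefined (ins stump j (forest_of T x)))))
    (topspace (HD_space Q T))"
  using T by (auto simp: cap_def fam_def val_def value_at_def fun_eq_iff shape_cap[OF T, simplified])

lemma cap_in_Mf_space:
  assumes f: "f \<in> topspace (Mf_space Q M n)" and j: "j < n"
  shows "cap n j f \<in> topspace (Mf_space Q M (n - 1))"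
proof -
  have "continuous_map (HD_space Q T) (bm_space M (leaves T)) (\<lambda>x. val f (ins stump j (forest_of T x)))"
    if T: "T \<in> trees (n - 1)" for T
  proof -
    have "f (cap_tree j T) \<in> maps (HD_space Q (cap_tree j T)) (bm_space M (leaves (cap_tree j T)))"
      using f cap_tree_trees[OF T j] by (simp only: topspace_Mf_space PiE_iff)
    then have "f (cap_tree j T) \<in> maps (HD_space Q (cap_tree j T)) (bm_space M (leaves T))"
      by (simp only: leaves_cap_tree[OF T])
    then have "continuous_map (HD_space Q T) (bm_space M (leaves T))
        (f (cap_tree j T) \<circ> (\<lambda>x. decorations (Vert undefined (ins stump j (forest_of T x)))))"
      using continuous_map_cap_tree[OF T j] by (auto simp: maps_def intro: continuous_map_compose)
    then show ?thesis by (simp add: o_def val_def value_at_def shape_cap[OF T, simplified])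
  qed
  then show ?thesis
    unfolding cap_def using f j by (intro fam_in_Mf_space compatible_ins) (auto simp: topspace_Mf_space)
qed

lemma val_cap: "ts \<in> forests (n - 1) \<Longrightarrow> val (cap n j f) ts = val f (ins stump j ts)"
  by (simp add: cap_def val_fam)

text \<open>On each tree this is precomposition with the map of decorations that adds the stump. The
  target space is the same, as the number of leaves is unchanged.\<close>

lemma continuous_map_cap:
  assumes j: "j < n"
  shows "continuous_map (Mf_space Q M n) (Mf_space Q M (n - 1)) (cap n j)"
proof -
  let ?Y = "\<lambda>n. product_topology (\<lambda>T. Map (HD_space Q T) (bm_space M (leaves T))) (trees n)"
  let ?S = "\<lambda>n. {f. Mf_unit Q n f \<and> Mf_perm Q M n f \<and> Mf_contract Q n f \<and> Mf_top Q M n f}"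
  have "continuous_map (?Y n) (?Y (n - 1)) (cap n j)"
  proof (rule continuous_map_coordinatewise_then_product)
    fix T assume T: "T \<in> trees (n - 1)"
    have "continuous_map (?Y n) (Map (HD_space Q (cap_tree j T)) (bm_space M (leaves T))) (\<lambda>f. f (cap_tree j T))"
      using continuous_map_product_projection[OF cap_tree_trees[OF T j],
          where X="\<lambda>T. Map (HD_space Q T) (bm_space M (leaves T))"] leaves_cap_tree[OF T, of j]
      by simp
    from continuous_map_compose[OF this continuous_map_Map_precompose[OF continuous_map_cap_tree[OF T j]]]
    show "continuous_map (?Y n) (Map (HD_space Q T) (bm_space M (leaves T))) (\<lambda>f. cap n j f T)"
      by (simp add: cap_component[OF T j] o_def)
  qed (simp add: cap_def fam_def)
  then have "continuous_map (kify (?Y n)) (kify (?Y (n - 1))) (cap n j)"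
    by (rule continuous_map_kify)
  then have "continuous_map (subtopology (kify (?Y n)) (?S n)) (subtopology (kify (?Y (n - 1))) (?S (n - 1))) (cap n j)"
  proof (intro continuous_map_into_subtopology continuous_map_from_subtopology)
    show "cap n j \<in> topspace (subtopology (kify (?Y n)) (?S n)) \<rightarrow> ?S (n - 1)"
    proof
      fix f assume "f \<in> topspace (subtopology (kify (?Y n)) (?S n))"
      then have "f \<in> topspace (Mf_space Q M n)" by (simp add: Mf_space_def)
      from cap_in_Mf_space[OF this j]
      show "cap n j f \<in> ?S (n - 1)" by (simp add: Mf_space_def)
    qed
  qed
  then show ?thesis
    unfolding Mf_space_def ksub_def kproduct_def by (rule continuous_map_kify)
qed

section \<open>Iterated insertion of stumps and the action of an injection\<close>

definition caps :: "nat \<Rightarrow> nat list \<Rightarrow> ('q, 'm) family \<Rightarrow> nat \<times> ('q, 'm) family" where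
  "caps n js f = foldr (\<lambda>j (k, y). (k - 1, cap k j y)) js (n, f)"

lemma pull_back_caps:
  "pull_back Q (Mf Q M) n l h f = snd (caps n (filter (\<lambda>j. j \<notin> h ` {..<l}) [0..<n]) f)"
  by (simp add: pull_back_def caps_def Mf_def Mf_right_star0)

lemma fst_caps: "fst (caps n js f) = n - length js"
  by (induction js) (auto simp: caps_def split: prod.splits)

lemma caps_Cons: "caps n (j # js) f = (n - length js - 1, cap (n - length js) j (snd (caps n js f)))"
  using fst_caps[of n js f] by (auto simp: caps_def split: prod.splits)

text \<open>The largest positions are treated before \<open>j\<close>. They lie strictly between
  \<open>j\<close> and \<open>n\<close>, so after their removal \<open>j\<close> is still a valid
  position.\<close>

lemma strict_sorted_less:
  assumes "sorted_wrt (<) (j # js)" and "set (j # js) \<subseteq> {..<n::nat}"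
  shows "j < n - length js"
proof -
  have "distinct js" using assms(1) by (simp add: strict_sorted_iff)
  then have "length js = card (set js)" by (simp add: distinct_card)
  also have "\<dots> \<le> card {Suc j..<n}" using assms by (intro card_mono) (auto simp: Suc_le_eq subset_iff)
  finally show ?thesis using assms(2) by auto
qed

lemma caps_continuous:
  assumes "sorted_wrt (<) js" and "set js \<subseteq> {..<n}"
  shows "continuous_map (Mf_space Q M n) (Mf_space Q M (n - length js)) (\<lambda>f. snd (caps n js f))"
  using assms
proof (induction js)
  case (Cons j js)
  have "j < n - length js" using Cons.prems by (rule strict_sorted_less)
  moreover have "continuous_map (Mf_space Q M n) (Mf_space Q M (n - length js)) (\<lambda>f. snd (caps n js f))"
    using Cons by auto
  ultimately have "continuous_map (Mf_space Q M n) (Mf_space Q M (n - length js - 1))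
      (cap (n - length js) j \<circ> (\<lambda>f. snd (caps n js f)))"
    by (intro continuous_map_compose[OF _ continuous_map_cap])
  then show ?case by (simp add: caps_Cons o_def)
qed (simp add: caps_def)

text \<open>All positions in \<open>js\<close> are larger than the new \<open>j\<close>, hence
  nothing to the left of \<open>j\<close> has been removed, and the stump is put back into the list
  of kept branches at position \<open>j\<close> itself.\<close>

lemma caps_val:
  assumes "sorted_wrt (<) js" and "set js \<subseteq> {..<n}" and "L \<in> forests n" and "\<forall>j\<in>set js. L ! j = stump"
  shows "val (snd (caps n js f)) (map ((!) L) (filter (\<lambda>i. i \<notin> set js) [0..<n])) = val f L"
  using assms
proof (induction js)
  case Nil
  then show ?case using map_nth[of L] forests_length by (simp add: caps_def)
next
  case (Cons j js)
  let ?keep = "\<lambda>js. filter (\<lambda>i. i \<notin> set js) [0..<n]"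
  let ?k = "n - length js"
  have j: "j < n" using Cons.prems by simp
  have upt: "[0..<n] = [0..<j] @ j # [Suc j..<n]"
    using j by (metis less_imp_le_nat upt_add_eq_append upt_conv_Cons zero_le le_add_diff_inverse add_0)
  have js: "\<forall>i\<in>set js. j < i" using Cons.prems(1) by simp
  have lowered: "filter (\<lambda>i. i \<notin> set js) [0..<j] = [0..<j]" "filter (\<lambda>i. i \<notin> set (j # js)) [0..<j] = [0..<j]"
    using js by (auto simp: filter_id_conv)
  have jn: "j \<notin> set js" using js by auto
  have hi: "filter (\<lambda>i. i \<notin> set (j # js)) [Suc j..<n] = filter (\<lambda>i. i \<notin> set js) [Suc j..<n]"
    by (rule filter_cong) auto
  have keep: "?keep js = [0..<j] @ j # filter (\<lambda>i. i \<notin> set js) [Suc j..<n]"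
    "?keep (j # js) = [0..<j] @ filter (\<lambda>i. i \<notin> set js) [Suc j..<n]"
    unfolding upt filter_append lowered using jn hi by simp_all
  have ins: "ins stump j (map ((!) L) (?keep (j # js))) = map ((!) L) (?keep js)"
    unfolding keep using Cons.prems(4) by (simp add: ins_def)
  have "length (?keep (j # js)) = n - length (j # js)"
  proof -
    have "length (?keep (j # js)) = card ({..<n} - set (j # js))"
      by (subst distinct_card[symmetric]) (auto intro!: arg_cong[where f=card])
    also have "\<dots> = n - card (set (j # js))"
      using Cons.prems(2) by (simp add: card_Diff_subset)
    also have "card (set (j # js)) = length (j # js)"
      using Cons.prems(1) by (intro distinct_card) (simp only: strict_sorted_iff)
    finally show ?thesis .
  qed
  moreover have "set (map ((!) L) (?keep (j # js))) \<subseteq> set L"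
    using forests_length[OF Cons.prems(3)] by auto
  ultimately have "map ((!) L) (?keep (j # js)) \<in> forests (?k - 1)"
    using Cons.prems(3) by (auto simp: forests_def simp del: filter.simps)
  then have "val (cap ?k j (snd (caps n js f))) (map ((!) L) (?keep (j # js)))
      = val (snd (caps n js f)) (map ((!) L) (?keep js))"
    by (simp only: val_cap ins)
  also have "\<dots> = val f L" using Cons by auto
  finally show ?case by (simp only: caps_Cons snd_conv)
qed

text \<open>Both lists are sorted and distinct, hence determined by their common set of
  entries.\<close>

lemma inj_mor_filter:
  assumes "h \<in> inj_mor l n"
  shows "filter (\<lambda>i. i \<in> h ` {..<l}) [0..<n] = map h [0..<l]"
proof (rule sorted_distinct_set_unique)
  have m: "strict_mono_on {..<l} h" and sub: "h ` {..<l} \<subseteq> {..<n}"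
    using assms by (auto simp: inj_mor_def)
  show "sorted (map h [0..<l])"
    unfolding sorted_map using m
    by (auto simp: sorted_wrt_iff_nth_less strict_mono_on_def intro: less_imp_le)
  show "distinct (map h [0..<l])"
    using strict_mono_on_imp_inj_on[OF m] by (simp add: distinct_map lessThan_atLeast0)
  show "set (filter (\<lambda>i. i \<in> h ` {..<l}) [0..<n]) = set (map h [0..<l])"
    using sub by (auto simp: image_subset_iff)
  show "sorted (filter (\<lambda>i. i \<in> h ` {..<l}) [0..<n])" by (intro sorted_wrt_filter) simp
qed simp

lemma length_missed:
  assumes "h \<in> inj_mor l n"
  shows "n - length (filter (\<lambda>j. j \<notin> h ` {..<l}) [0..<n]) = l"
  using sum_length_filter_compl[of "\<lambda>i. i \<in> h ` {..<l}" "[0..<n]"] inj_mor_filter[OF assms]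
  by simp

lemma pull_back_continuous:
  assumes "h \<in> inj_mor l n"
  shows "continuous_map (Mf_space Q M n) (Mf_space Q M l) (pull_back Q (Mf Q M) n l h)"
proof -
  let ?js = "filter (\<lambda>j. j \<notin> h ` {..<l}) [0..<n]"
  have "sorted_wrt (<) ?js" by (intro sorted_wrt_filter) simp
  then have "continuous_map (Mf_space Q M n) (Mf_space Q M (n - length ?js)) (\<lambda>f. snd (caps n ?js f))"
    by (rule caps_continuous) auto
  then show ?thesis
    by (simp add: length_missed[OF assms] pull_back_caps[abs_def])
qed

lemma pull_back_val:
  assumes "h \<in> inj_mor l n" and "L \<in> forests n" and "\<And>j. j < n \<Longrightarrow> j \<notin> h ` {..<l} \<Longrightarrow> L ! j = stump"
  shows "val (pull_back Q (Mf Q M) n l h f) (map (\<lambda>i. L ! h i) [0..<l]) = val f L"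
proof -
  let ?js = "filter (\<lambda>j. j \<notin> h ` {..<l}) [0..<n]"
  have "sorted_wrt (<) ?js" by (intro sorted_wrt_filter) simp
  then have "val (snd (caps n ?js f)) (map ((!) L) (filter (\<lambda>i. i \<notin> set ?js) [0..<n])) = val f L"
    using assms by (intro caps_val) auto
  moreover have "filter (\<lambda>i. i \<notin> set ?js) [0..<n] = map h [0..<l]"
    unfolding inj_mor_filter[OF assms(1), symmetric] by (rule filter_cong) auto
  ultimately show ?thesis by (simp add: pull_back_caps o_def)
qed

text \<open>Lets \<open>pull_back_val\<close> compute the value of a pulled back family at every
  forest.\<close>

lemma ex_filled_forest:
  assumes "h \<in> inj_mor l n" and "ts \<in> forests l"
  obtains L where "L \<in> forests n" and "\<And>i. i < l \<Longrightarrow> L ! h i = ts ! i"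
    and "\<And>j. j < n \<Longrightarrow> j \<notin> h ` {..<l} \<Longrightarrow> L ! j = stump"
proof
  let ?L = "map (\<lambda>j. if j \<in> h ` {..<l} then ts ! the_inv_into {..<l} h j else stump) [0..<n]"
  have inj: "inj_on h {..<l}" using assms(1) by (auto simp: inj_mor_def intro: strict_mono_on_imp_inj_on)
  show "?L \<in> forests n"
    using forests_nth[OF assms(2)] good_stump the_inv_into_f_f[OF inj]
    by (auto simp: forests_def simp del: good.simps)
  show "?L ! h i = ts ! i" if "i < l" for i
  proof -
    have "h i < n" using that assms(1) by (auto simp: inj_mor_def)
    then show ?thesis using that the_inv_into_f_f[OF inj, of i] by simp
  qed
  show "?L ! j = stump" if "j < n" "j \<notin> h ` {..<l}" for j
    using that by simp
qed

lemma inj_mor_compose: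
  "\<lbrakk>h \<in> inj_mor l n; g \<in> inj_mor k l\<rbrakk> \<Longrightarrow> compose {..<k} h g \<in> inj_mor k n"
  by (auto simp: inj_mor_def compose_def strict_mono_on_def PiE_iff)

text \<open>Functoriality is checked on values: both sides evaluate \<open>f\<close> at the forest
  \<open>L\<close> that has stumps at all positions missed by the composite.\<close>

lemma pull_back_compose:
  assumes h: "h \<in> inj_mor l n" and g: "g \<in> inj_mor k l" and f: "f \<in> topspace (Mf_space Q M n)"
  shows "pull_back Q (Mf Q M) l k g (pull_back Q (Mf Q M) n l h f)
    = pull_back Q (Mf Q M) n k (compose {..<k} h g) f"
proof (rule Mf_space_eqI)
  note hg = inj_mor_compose[OF h g]
  have pb: "pull_back Q (Mf Q M) n l h f \<in> topspace (Mf_space Q M l)"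
    if "h \<in> inj_mor l n" "f \<in> topspace (Mf_space Q M n)" for n l h f
    using continuous_map_image_subset_topspace[OF pull_back_continuous[OF that(1)]] that(2) by blast
  show "pull_back Q (Mf Q M) l k g (pull_back Q (Mf Q M) n l h f) \<in> topspace (Mf_space Q M k)"
    by (intro pb h g f)
  show "pull_back Q (Mf Q M) n k (compose {..<k} h g) f \<in> topspace (Mf_space Q M k)"
    by (intro pb hg f)
  fix ts assume ts: "ts \<in> forests k"
  obtain L where L: "L \<in> forests n" "\<And>i. i < k \<Longrightarrow> L ! compose {..<k} h g i = ts ! i"
    and stump: "\<And>j. j < n \<Longrightarrow> j \<notin> compose {..<k} h g ` {..<k} \<Longrightarrow> L ! j = stump"
    using ex_filled_forest[OF hg ts] by metis
  let ?L = "map (\<lambda>i. L ! h i) [0..<l]"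
  have hn: "h i < n" if "i < l" for i using h that by (auto simp: inj_mor_def)
  have gl: "g i < l" if "i < k" for i using g that by (auto simp: inj_mor_def)
  have inj: "inj_on h {..<l}" using h by (auto simp: inj_mor_def intro: strict_mono_on_imp_inj_on)
  have "?L \<in> forests l"
    using forests_nth[OF L(1)] hn by (auto simp: forests_def)
  have Lg: "map (\<lambda>i. ?L ! g i) [0..<k] = ts"
    using L(2) gl forests_length[OF ts] by (intro nth_equalityI) (auto simp: compose_def)
  have Lhg: "map (\<lambda>i. L ! compose {..<k} h g i) [0..<k] = ts"
    using L(2) forests_length[OF ts] by (intro nth_equalityI) auto
  have "val (pull_back Q (Mf Q M) l k g (pull_back Q (Mf Q M) n l h f)) (map (\<lambda>i. ?L ! g i) [0..<k])
      = val (pull_back Q (Mf Q M) n l h f) ?L"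
  proof (rule pull_back_val[OF g \<open>?L \<in> forests l\<close>])
    fix j assume j: "j < l" "j \<notin> g ` {..<k}"
    have "h j \<notin> compose {..<k} h g ` {..<k}"
      using j gl inj by (auto simp: compose_def inj_on_def)
    then show "?L ! j = stump" using stump hn j by simp
  qed
  also have "\<dots> = val f L"
  proof (rule pull_back_val[OF h L(1)])
    fix j assume "j < n" "j \<notin> h ` {..<l}"
    then show "L ! j = stump" using gl by (intro stump) (auto simp: compose_def)
  qed
  also have "\<dots> = val (pull_back Q (Mf Q M) n k (compose {..<k} h g) f)
      (map (\<lambda>i. L ! compose {..<k} h g i) [0..<k])"
    using stump by (intro pull_back_val[OF hg L(1), symmetric]) auto
  finally show "val (pull_back Q (Mf Q M) l k g (pull_back Q (Mf Q M) n l h f)) ts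
      = val (pull_back Q (Mf Q M) n k (compose {..<k} h g) f) ts"
    unfolding Lg Lhg .
qed

text \<open>All edges inside the branch join vertices with number 0 and can be contracted. A single
  vertex without inputs remains, and its label is \<open>star0 Q\<close> because \<open>Q\<close> is
  reduced.\<close>

lemma compatible_zero_branch:
  assumes F: "compatible n F" and "ts \<in> forests n" and "b < n"
    and "good Q 0 S" and "leaves S = 0" and "\<forall>d\<in>set_tree S. fst d = 0"
  shows "F (ts[b := S]) = F (ts[b := stump])"
  using assms(2-)
proof (induction S rule: measure_induct_rule[of size])
  case (less S)
  obtain q us where S: "S = Vert (0, q) us"
    using less.prems by (cases S) auto
  show ?case
  proof (cases us)
    case Nil
    then have "q = star0 Q" using less.prems(3) S op_space_0 by simp
    then show ?thesis using S Nil by simp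
  next
    case (Cons s rest)
    \<comment> \<open>Without leaves the leftmost child is a vertex, so its edge is available for
      contraction.\<close>
    then obtain q' us' where s: "s = Vert (0, q') us'"
      using less.prems S by (cases s) auto
    let ?S = "Vert (0, op_circ Q (length us) (length us') 0 q q') (us' @ rest)"
    have "op_circ Q (length us) (length us') 0 q q' \<in> topspace (op_space Q (length us + length us' - 1))"
      using less.prems(3) S Cons s by (intro op_circ_closed) auto
    then have g: "good Q 0 ?S" using less.prems(3) S Cons s by (auto simp: add.commute)
    have "move Q M S (replace S [] (Vert (0, op_circ Q (length us) (length us') 0 q q')
        (take 0 us @ us' @ drop (0 + 1) us))) (\<lambda>L k x. x)"
      using S Cons s by (intro move.contract) auto
    then have "move Q M S ?S (\<lambda>L k x. x)" using Cons by simp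
    then have "F (ts[b := S]) = F (ts[b := ?S])"
      by (rule compatibleD[OF F less.prems(1,2,3) g])
    also have "\<dots> = F (ts[b := stump])"
      using less.prems S Cons s g
      by (intro less.IH) auto
    finally show ?thesis .
  qed
qed

end

section \<open>Continuity of maxima, minima and heights\<close>

lemma continuous_map_Max_insert:
  assumes "finite I" and "continuous_map X euclideanreal f0"
    and "\<And>i. i \<in> I \<Longrightarrow> continuous_map X euclideanreal (f i)"
  shows "continuous_map X euclideanreal (\<lambda>x. Max (insert (f0 x) ((\<lambda>i. f i x) ` I)))"
  using assms
proof (induction I rule: finite_induct)
  case (insert i I)
  have "Max (insert (f0 x) ((\<lambda>i. f i x) ` insert i I)) = max (f i x) (Max (insert (f0 x) ((\<lambda>i. f i x) ` I)))" for x
    using insert.hyps by (simp add: insert_commute[of "f0 x" "f i x"])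
  then show ?case using insert by (simp add: continuous_map_real_max)
qed simp

lemma continuous_map_Min_insert:
  assumes "finite I" and "continuous_map X euclideanreal f0"
    and "\<And>i. i \<in> I \<Longrightarrow> continuous_map X euclideanreal (f i)"
  shows "continuous_map X euclideanreal (\<lambda>x. Min (insert (f0 x) ((\<lambda>i. f i x) ` I)))"
  using assms
proof (induction I rule: finite_induct)
  case (insert i I)
  have "Min (insert (f0 x) ((\<lambda>i. f i x) ` insert i I)) = min (f i x) (Min (insert (f0 x) ((\<lambda>i. f i x) ` I)))" for x
    using insert.hyps by (simp add: insert_commute[of "f0 x" "f i x"])
  then show ?case using insert by (simp add: continuous_map_real_min)
qed simp

lemma closedin_le:
  assumes "continuous_map X euclideanreal f" and "continuous_map X euclideanreal g"
  shows "closedin X {x \<in> topspace X. f x \<le> g x}"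
proof -
  have "closedin X {x \<in> topspace X. g x - f x \<in> {0..}}"
    using assms by (intro closedin_continuous_map_preimage[of _ euclideanreal] continuous_map_diff) auto
  then show ?thesis by simp
qed

lemma continuous_map_height:
  fixes g :: "'c \<Rightarrow> nat list \<Rightarrow> real \<times> 'q"
  assumes "\<And>a. a \<in> verts T \<Longrightarrow> continuous_map C euclideanreal (\<lambda>c. fst (g c a))"
  shows "continuous_map C euclideanreal (\<lambda>c. height (decorate T (g c)))"
  using assms
proof (induction T arbitrary: g)
  case (Vert d ts)
  have "continuous_map C euclideanreal (\<lambda>c. height (decorate (ts ! i) (\<lambda>a. g c (i # a))))" if "i < length ts" for i
    using that Vert.prems by (intro Vert.IH) auto
  then have "continuous_map C euclideanreal (\<lambda>c. Max (insert (fst (g c []))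
      ((\<lambda>i. height (decorate (ts ! i) (\<lambda>a. g c (i # a)))) ` {..<length ts})))"
    using Vert.prems by (intro continuous_map_Max_insert) auto
  then show ?case by (simp add: height.simps(2) image_image lessThan_atLeast0)
qed simp

section \<open>Points of the matching object\<close>

text \<open>The injection \<open>s\<^sub>j\<close> that misses \<open>j\<close>.\<close>

definition skip :: "nat \<Rightarrow> nat \<Rightarrow> nat \<Rightarrow> nat" where
  "skip n j = (\<lambda>i\<in>{..<n - 1}. if i < j then i else Suc i)"

lemma skip_inj_mor: "j < n \<Longrightarrow> skip n j \<in> inj_mor (n - 1) n"
  by (auto simp: skip_def inj_mor_def strict_mono_on_def)

text \<open>The cosimplicial identity: both sides miss exactly \<open>i\<close> and
  \<open>j\<close>, and \<open>j\<close> becomes \<open>j - 1\<close> once the smaller position is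
  gone.\<close>

lemma skip_skip:
  "i < j \<Longrightarrow> j < n \<Longrightarrow>
    compose {..<n - 1 - 1} (skip n i) (skip (n - 1) (j - 1)) = compose {..<n - 1 - 1} (skip n j) (skip (n - 1) i)"
  by (auto simp: compose_def skip_def fun_eq_iff)

text \<open>By counting, some \<open>j\<close> is missed; \<open>g\<close> is \<open>h\<close> with
  the values beyond \<open>j\<close> shifted down. Hence a point of the matching object is
  determined by its components at the injections \<open>skip n j\<close>.\<close>

lemma inj_mor_factor:
  assumes h: "h \<in> inj_mor l n" and "l < n"
  obtains j g where "j < n" and "g \<in> inj_mor l (n - 1)" and "h = compose {..<l} (skip n j) g"
proof -
  have h': "\<And>i. i < l \<Longrightarrow> h i < n" "strict_mono_on {..<l} h" "h \<in> extensional {..<l}"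
    using h by (auto simp: inj_mor_def PiE_def)
  have "card (h ` {..<l}) < card {..<n}"
    using assms(2) card_image_le[of "{..<l}" h] by simp
  then obtain j where j: "j < n" "j \<notin> h ` {..<l}"
    using h'(1) by (metis card_mono finite_imageI finite_lessThan lessThan_iff linorder_not_le subsetI)
  have ne: "h i \<noteq> j" if "i < l" for i using j that by auto
  define g where "g = (\<lambda>i\<in>{..<l}. if h i < j then h i else h i - 1)"
  have "g \<in> inj_mor l (n - 1)"
  proof -
    have "g i < n - 1" if "i < l" for i
      using h'(1)[OF that] ne[OF that] j that by (auto simp: g_def)
    moreover have "g i < g i'" if "i < i'" "i' < l" for i i'
      using strict_mono_onD[OF h'(2), of i i'] ne[of i] ne[of i'] that by (auto simp: g_def)
    ultimately show ?thesis by (auto simp: inj_mor_def strict_mono_on_def g_def)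
  qed
  moreover have "h = compose {..<l} (skip n j) g"
  proof
    fix i
    show "h i = compose {..<l} (skip n j) g i"
    proof (cases "i < l")
      case True
      then show ?thesis using h'(1)[OF True] ne[OF True] j by (auto simp: compose_def skip_def g_def)
    next
      case False
      then show ?thesis using h'(3) by (simp add: compose_def extensional_def)
    qed
  qed
  ultimately show thesis using j(1) that by blast
qed

context reduced_module
begin

lemma bm_act_id: "x \<in> topspace (bm_space M n) \<Longrightarrow> bm_act M n id x = x"
  using M.symmetric unfolding symmetric_sequence_def by blast

text \<open>Such a branch has no leaves to permute and no subtree with all numbers 1. Needed for a
  move inside the branch that the lift deletes: the two deleted forests coincide, so the operation
  must do nothing.\<close>

lemma move_trivial:
  assumes "move Q M S S' \<phi>" and "good Q 0 S" and "good Q 0 S'" and "height S < 1"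
    and x: "x \<in> topspace (bm_space M L)"
  shows "\<phi> L k x = x"
  using assms(1)
proof (cases rule: move.cases)
  case (perm a t q ts \<sigma> ts')
  have "height S' < 1" using move_height[OF assms(1-3)] assms(4) by simp
  then have "leaves S' = 0" by (rule leaves_eq_0)
  then have "leaves (Vert (t, q) ts) = 0" using leaves_subtree[OF perm(3)] by simp
  then have "leaves (ts ! \<sigma> j) = 0" if "j < length ts" for j
    using permutes_in_image[OF perm(4), of j] that by (simp add: sum_list_eq_0_iff)
  then have "(\<Sum>l<length ts. leaves (ts' ! l)) = 0" using perm(5) by simp
  then have "block_perm (length ts) (\<lambda>j. leaves (ts' ! j)) \<sigma> (\<lambda>_. id) = id"
    by (auto simp: block_perm_def fun_eq_iff)
  moreover have "shift_perm s id = id" for s by (auto simp: shift_perm_def fun_eq_iff)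
  ultimately show ?thesis using perm(2) bm_act_id[OF x] by simp
next
  case (top a R)
  have "height R = 1" using height_eq_1 good_subtree[OF assms(2) top(3)] top(5) by blast
  then show ?thesis using height_subtree[OF top(3)] assms(4) by simp
qed auto

lemma pull_back_skip:
  assumes f: "f \<in> topspace (Mf_space Q M n)" and j: "j < n"
  shows "pull_back Q (Mf Q M) n (n - 1) (skip n j) f = cap n j f"
proof (rule Mf_space_eqI)
  note s = skip_inj_mor[OF j]
  show "pull_back Q (Mf Q M) n (n - 1) (skip n j) f \<in> topspace (Mf_space Q M (n - 1))"
    using continuous_map_image_subset_topspace[OF pull_back_continuous[OF s]] f by blast
  show "cap n j f \<in> topspace (Mf_space Q M (n - 1))"
    using f j by (rule cap_in_Mf_space)
  fix ts assume ts: "ts \<in> forests (n - 1)"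
  note l = forests_length[OF ts]
  have "map (\<lambda>i. ins stump j ts ! skip n j i) [0..<n - 1] = ts"
    using l j by (intro nth_equalityI) (auto simp: skip_def nth_ins)
  moreover have "val (pull_back Q (Mf Q M) n (n - 1) (skip n j) f)
      (map (\<lambda>i. ins stump j ts ! skip n j i) [0..<n - 1]) = val f (ins stump j ts)"
  proof (rule pull_back_val[OF s forests_ins[OF ts j good_stump]])
    fix i assume i: "i < n" "i \<notin> skip n j ` {..<n - 1}"
    have "i = j"
    proof (rule ccontr)
      assume "i \<noteq> j"
      then have "i = skip n j (if i < j then i else i - 1)" "(if i < j then i else i - 1) \<in> {..<n - 1}"
        using i(1) j by (auto simp: skip_def)
      then show False using i(2) by blast
    qed
    then show "ins stump j ts ! i = stump" using l j by (simp add: nth_ins)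
  qed
  ultimately show "val (pull_back Q (Mf Q M) n (n - 1) (skip n j) f) ts = val (cap n j f) ts"
    by (simp add: val_cap[OF ts])
qed

lemma val_cap_del:
  assumes "ts \<in> forests n" and "j < n" and "ts ! j = stump"
  shows "val (cap n j f) (del j ts) = val f ts"
  using val_cap[OF forests_del[OF assms(1,2)], of j f] assms forests_length[OF assms(1)]
  by (simp add: ins_del)

abbreviation face :: "nat \<Rightarrow> (nat \<times> (nat \<Rightarrow> nat) \<Rightarrow> ('q, 'm) family) \<Rightarrow> nat \<Rightarrow> ('q, 'm) family" where
  "face n x j \<equiv> x (n - 1, skip n j)"

lemma topspace_matching_object:
  "x \<in> topspace (matching_object Q (Mf Q M) n) \<longleftrightarrow>
     x \<in> (\<Pi>\<^sub>E (l, h)\<in>matching_index n. topspace (Mf_space Q M l)) \<and>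
     (\<forall>(l, h)\<in>matching_index n. \<forall>k. \<forall>g\<in>inj_mor k l.
        pull_back Q (Mf Q M) l k g (x (l, h)) = x (k, compose {..<k} h g))"
  by (simp add: matching_object_def Mf_def case_prod_beta')

lemma skip_index: "j < n \<Longrightarrow> (n - 1, skip n j) \<in> matching_index n"
  using skip_inj_mor by (auto simp: matching_index_def)

lemma face_in_Mf_space:
  "x \<in> topspace (matching_object Q (Mf Q M) n) \<Longrightarrow> j < n \<Longrightarrow> face n x j \<in> topspace (Mf_space Q M (n - 1))"
  using skip_index[of j n] by (fastforce simp: topspace_matching_object PiE_iff)

lemma continuous_map_face:
  assumes "j < n"
  shows "continuous_map (matching_object Q (Mf Q M) n) (Mf_space Q M (n - 1)) (\<lambda>x. face n x j)"
proof -
  have "continuous_map (matching_object Q (Mf Q M) n)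
      (kproduct (matching_index n) (\<lambda>(l, h). bm_space (Mf Q M) l)) (\<lambda>x. x)"
    unfolding matching_object_def by (rule continuous_map_ksub_id)
  from continuous_map_compose[OF this continuous_map_kproduct_proj[OF skip_index[OF assms]]]
  show ?thesis by (simp add: o_def Mf_def)
qed

lemma matching_pull_back:
  assumes "x \<in> topspace (matching_object Q (Mf Q M) n)" and "(l, h) \<in> matching_index n" and "g \<in> inj_mor k l"
  shows "pull_back Q (Mf Q M) l k g (x (l, h)) = x (k, compose {..<k} h g)"
  using assms unfolding topspace_matching_object by blast

text \<open>Capping each face once more leads to the component of \<open>x\<close> at the injection
  missing both \<open>i\<close> and \<open>j\<close>.\<close>

lemma face_face:
  assumes x: "x \<in> topspace (matching_object Q (Mf Q M) n)" and ij: "i < j" "j < n"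
    and L: "L \<in> forests n" "L ! i = stump" "L ! j = stump"
  shows "val (face n x i) (del i L) = val (face n x j) (del j L)"
proof -
  have l: "length L = n" using L(1) by (rule forests_length)
  have i: "i < n" "i < n - 1" and j: "j - 1 < n - 1" using ij by auto
  have 1: "cap (n - 1) (j - 1) (face n x i) = x (n - 1 - 1, compose {..<n - 1 - 1} (skip n i) (skip (n - 1) (j - 1)))"
    using matching_pull_back[OF x skip_index[OF i(1)] skip_inj_mor[OF j]]
      pull_back_skip[OF face_in_Mf_space[OF x i(1)] j] by simp
  have 2: "cap (n - 1) i (face n x j) = x (n - 1 - 1, compose {..<n - 1 - 1} (skip n j) (skip (n - 1) i))"
    using matching_pull_back[OF x skip_index[OF ij(2)] skip_inj_mor[OF i(2)]]
      pull_back_skip[OF face_in_Mf_space[OF x ij(2)] i(2)] by simp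
  have "val (face n x i) (del i L) = val (cap (n - 1) (j - 1) (face n x i)) (del (j - 1) (del i L))"
    using L l ij j by (intro val_cap_del[symmetric] forests_del) (auto simp: nth_del)
  also have "\<dots> = val (cap (n - 1) i (face n x j)) (del (j - 1) (del i L))"
    unfolding 1 2 skip_skip[OF ij] ..
  also have "del (j - 1) (del i L) = del i (del j L)"
    using l ij by (intro nth_equalityI) (auto simp: nth_del)
  also have "val (cap (n - 1) i (face n x j)) (del i (del j L)) = val (face n x j) (del j L)"
    using L l ij i by (intro val_cap_del forests_del) (auto simp: nth_del)
  finally show ?thesis .
qed

lemma face_zero_branch:
  assumes x: "x \<in> topspace (matching_object Q (Mf Q M) n)" and ij: "i < n" "j < n" "i \<noteq> j"
    and L: "L \<in> forests n" and zero: "leaves (L ! j) = 0" "\<forall>d\<in>set_tree (L ! j). fst d = 0"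
  shows "val (face n x i) (del i L) = val (face n x i) (del i (L[j := stump]))"
proof -
  let ?j = "if j < i then j else j - 1"
  have l: "length L = n" using L by (rule forests_length)
  have upd: "del i (L[j := S]) = (del i L)[?j := S]" for S
    using ij l by (intro del_update) auto
  have "val (face n x i) ((del i L)[?j := L ! j]) = val (face n x i) ((del i L)[?j := stump])"
    using ij zero by (intro compatible_zero_branch[OF Mf_space_compatible[OF face_in_Mf_space[OF x ij(1)]]]
        forests_del[OF L] forests_nth[OF L]) auto
  then show ?thesis unfolding upd[symmetric] by simp
qed

text \<open>The lift deletes a branch with all numbers 0, and there may be several; this shows that
  the choice does not matter. Such branches are replaced by stumps, for which
  \<open>face_face\<close> applies.\<close>

lemma face_independent:
  assumes x: "x \<in> topspace (matching_object Q (Mf Q M) n)" and ij: "i < n" "j < n"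
    and L: "L \<in> forests n"
    and zero: "\<And>k. k \<in> {i, j} \<Longrightarrow> leaves (L ! k) = 0 \<and> (\<forall>d\<in>set_tree (L ! k). fst d = 0)"
  shows "val (face n x i) (del i L) = val (face n x j) (del j L)"
proof -
  have "val (face n x i) (del i L) = val (face n x j) (del j L)"
    if ij: "i < j" "j < n" and zero: "\<And>k. k \<in> {i, j} \<Longrightarrow> leaves (L ! k) = 0 \<and> (\<forall>d\<in>set_tree (L ! k). fst d = 0)"
    for i j
  proof -
    let ?L = "L[i := stump, j := stump]"
    have l: "length L = n" using L by (rule forests_length)
    have "val (face n x i) (del i L) = val (face n x i) (del i (L[j := stump]))"
      using ij zero by (intro face_zero_branch[OF x _ _ _ L]) auto
    also have "\<dots> = val (face n x i) (del i ?L)"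
      using ij by (simp add: list_update_swap[of i j] del_update_same)
    also have "\<dots> = val (face n x j) (del j ?L)"
      using ij l by (intro face_face[OF x ij] forests_update[OF forests_update[OF L good_stump] good_stump]) auto
    also have "\<dots> = val (face n x j) (del j (L[i := stump]))"
      by (simp add: del_update_same)
    also have "\<dots> = val (face n x j) (del j L)"
      using ij zero by (intro face_zero_branch[OF x _ _ _ L, symmetric]) auto
    finally show ?thesis .
  qed
  note * = this
  show ?thesis
  proof (cases i j rule: linorder_cases)
    case less
    then show ?thesis using ij zero by (intro *) auto
  next
    case greater
    then show ?thesis using ij zero by (intro *[symmetric]) auto
  qed simp
qed

text \<open>Every index of the matching object factors through some \<open>skip n j\<close>, so the
  faces determine all components.\<close>

lemma matching_map_eqI:
  assumes f: "f \<in> topspace (Mf_space Q M n)" and x: "x \<in> topspace (matching_object Q (Mf Q M) n)"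
    and eq: "\<And>j. j < n \<Longrightarrow> cap n j f = face n x j"
  shows "matching_map Q (Mf Q M) n f = x"
proof
  fix p :: "nat \<times> (nat \<Rightarrow> nat)"
  show "matching_map Q (Mf Q M) n f p = x p"
  proof (cases "p \<in> matching_index n")
    case True
    then obtain l h where p: "p = (l, h)" "l < n" "h \<in> inj_mor l n"
      by (auto simp: matching_index_def)
    obtain j g where j: "j < n" and g: "g \<in> inj_mor l (n - 1)" and h: "h = compose {..<l} (skip n j) g"
      using inj_mor_factor[OF p(3,2)] .
    have "matching_map Q (Mf Q M) n f p = pull_back Q (Mf Q M) n l h f"
      using True by (simp add: matching_map_def p(1))
    also have "\<dots> = pull_back Q (Mf Q M) (n - 1) l g (cap n j f)"
      using pull_back_compose[OF skip_inj_mor[OF j] g f] by (simp only: h pull_back_skip[OF f j])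
    also have "\<dots> = x p"
      using matching_pull_back[OF x skip_index[OF j] g] by (simp add: eq[OF j] p(1) h)
    finally show ?thesis .
  next
    case False
    then show ?thesis using x by (cases p) (auto simp: matching_map_def topspace_matching_object PiE_iff extensional_def)
  qed
qed

lemma face_matching_map:
  assumes "f \<in> topspace (Mf_space Q M n)" and "j < n"
  shows "face n (matching_map Q (Mf Q M) n f) j = cap n j f"
  using skip_index[OF assms(2)] pull_back_skip[OF assms] by (simp add: matching_map_def)

lemma continuous_map_matching_map:
  "continuous_map (Mf_space Q M n) (matching_object Q (Mf Q M) n) (matching_map Q (Mf Q M) n)"
proof -
  let ?Y = "product_topology (\<lambda>(l, h). Mf_space Q M l) (matching_index n)"
  let ?S = "{x. \<forall>(l, h) \<in> matching_index n. \<forall>k. \<forall>g \<in> inj_mor k l.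
              pull_back Q (Mf Q M) l k g (x (l, h)) = x (k, compose {..<k} h g)}"
  let ?X = "subtopology (kproduct (trees n) (\<lambda>T. Map (HD_space Q T) (bm_space M (leaves T))))
       {f. Mf_unit Q n f \<and> Mf_perm Q M n f \<and> Mf_contract Q n f \<and> Mf_top Q M n f}"
  have Mf: "Mf_space Q M n = kify ?X" by (simp add: Mf_space_def ksub_def)
  have N: "matching_object Q (Mf Q M) n = kify (subtopology (kify ?Y) ?S)"
    by (simp add: matching_object_def ksub_def kproduct_def Mf_def)
  have inS: "matching_map Q (Mf Q M) n f \<in> ?S" if f: "f \<in> topspace (Mf_space Q M n)" for f
  proof (clarify)
    fix l h k g assume lh: "(l, h) \<in> matching_index n" and g: "g \<in> inj_mor k l"
    then have h: "h \<in> inj_mor l n" and "l < n" by (auto simp: matching_index_def)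
    have "k \<le> l"
    proof -
      have "card {..<k} \<le> card {..<l}"
        using g by (intro card_inj_on_le[of g]) (auto simp: inj_mor_def intro: strict_mono_on_imp_inj_on)
      then show ?thesis by simp
    qed
    then have "(k, compose {..<k} h g) \<in> matching_index n"
      using inj_mor_compose[OF h g] \<open>l < n\<close> by (simp add: matching_index_def)
    then show "pull_back Q (Mf Q M) l k g (matching_map Q (Mf Q M) n f (l, h))
        = matching_map Q (Mf Q M) n f (k, compose {..<k} h g)"
      using lh pull_back_compose[OF h g f] by (simp add: matching_map_def)
  qed
  have cont: "continuous_map (Mf_space Q M n) ?Y (matching_map Q (Mf Q M) n)"
  proof (rule continuous_map_coordinatewise_then_product)
    fix p assume p: "p \<in> matching_index n"
    then obtain l h where lh: "p = (l, h)" "h \<in> inj_mor l n" by (auto simp: matching_index_def)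
    show "continuous_map (Mf_space Q M n) (case p of (l, h) \<Rightarrow> Mf_space Q M l)
        (\<lambda>f. matching_map Q (Mf Q M) n f p)"
      using pull_back_continuous[OF lh(2)] p by (simp add: matching_map_def lh(1))
  qed (simp add: matching_map_def)
  show ?thesis
    unfolding N Mf
  proof (rule continuous_map_from_kify)
    show "matching_map Q (Mf Q M) n \<in> topspace ?X \<rightarrow> topspace (kify (subtopology (kify ?Y) ?S))"
    proof
      fix f assume "f \<in> topspace ?X"
      then have f: "f \<in> topspace (Mf_space Q M n)" unfolding Mf by simp
      have "matching_map Q (Mf Q M) n f \<in> topspace ?Y"
        using continuous_map_image_subset_topspace[OF cont] f by blast
      then show "matching_map Q (Mf Q M) n f \<in> topspace (kify (subtopology (kify ?Y) ?S))"
        using inS[OF f] by simp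
    qed
    fix K :: "('q, 'm) family huge topology" and k
    assume K: "compact_Hausdorff K" and "continuous_map K ?X k"
    then have k: "continuous_map K (Mf_space Q M n) k"
      unfolding Mf by (intro continuous_map_into_kify[OF _ inj_on_id])
    \<comment> \<open>The product is tested on a larger type than the families; families embed into
      it as constant functions of the index.\<close>
    obtain e :: "('q, 'm) family huge \<Rightarrow> (nat \<times> (nat \<Rightarrow> nat) \<Rightarrow> ('q, 'm) family) huge" where e: "inj e"
    proof -
      have "inj (\<lambda>(f :: ('q, 'm) family) (p :: nat \<times> (nat \<Rightarrow> nat)). f)"
        by (auto intro: injI dest: fun_cong)
      then show thesis using that ex_inj_huge_map by blast
    qed
    have "continuous_map K ?Y (matching_map Q (Mf Q M) n \<circ> k)"
      using k cont by (rule continuous_map_compose)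
    then have "continuous_map K (kify ?Y) (matching_map Q (Mf Q M) n \<circ> k)"
      by (rule continuous_map_into_kify[OF K e])
    moreover have "matching_map Q (Mf Q M) n \<circ> k \<in> topspace K \<rightarrow> ?S"
    proof
      fix c assume "c \<in> topspace K"
      then have "k c \<in> topspace (Mf_space Q M n)"
        using continuous_map_image_subset_topspace[OF k] by blast
      from inS[OF this] show "(matching_map Q (Mf Q M) n \<circ> k) c \<in> ?S" by (simp only: comp_apply)
    qed
    ultimately have "continuous_map K (subtopology (kify ?Y) ?S) (matching_map Q (Mf Q M) n \<circ> k)"
      by (rule continuous_map_into_subtopology)
    then show "continuous_map K (kify (subtopology (kify ?Y) ?S)) (matching_map Q (Mf Q M) n \<circ> k)"
      by (rule continuous_map_into_kify[OF K e])
  qed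
qed

end

section \<open>The lift\<close>

text \<open>The inserted 1 is the value for the empty forest. Otherwise it has no effect, as heights
  of good trees are at most 1.\<close>

definition min_height :: "(real \<times> 'q) tree list \<Rightarrow> real" where
  "min_height ts = Min (insert 1 (set (map height ts)))"

lemma min_height_le_1: "min_height ts \<le> 1"
  by (simp add: min_height_def)

lemma min_height_le: "S \<in> set ts \<Longrightarrow> min_height ts \<le> height S"
  by (simp add: min_height_def)

lemma min_height_attained: "min_height ts < 1 \<Longrightarrow> \<exists>i<length ts. height (ts ! i) = min_height ts"
proof -
  assume "min_height ts < 1"
  moreover have "min_height ts \<in> insert 1 (set (map height ts))"
    unfolding min_height_def by (rule Min_in) auto
  ultimately show ?thesis by (auto simp: in_set_conv_nth)
qed

text \<open>The amount \<open>amount \<tau> ts S\<close> by which the numbers of a branch \<open>S\<close> are lowered vanishes if \<open>S\<close> has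
  height \<open>1\<close>, if the forest has a branch of height \<open>0\<close>, and for \<open>\<tau> = 0\<close>; on a branch of minimal
  height \<open>m\<close> it is \<open>m\<close> as soon as \<open>\<tau>(1 - m) \<ge> m\<close>.\<close>

definition amount :: "real \<Rightarrow> (real \<times> 'q) tree list \<Rightarrow> (real \<times> 'q) tree \<Rightarrow> real" where
  "amount \<tau> ts S = min (min (min_height ts) (\<tau> * (1 - min_height ts))) (1 - height S)"

definition lowered :: "real \<Rightarrow> (real \<times> 'q) tree list \<Rightarrow> (real \<times> 'q) tree list" where
  "lowered \<tau> ts = map (\<lambda>S. lower (amount \<tau> ts S) S) ts"

lemma length_lowered [simp]: "length (lowered \<tau> ts) = length ts"
  by (simp add: lowered_def)

lemma nth_lowered [simp]: "i < length ts \<Longrightarrow> lowered \<tau> ts ! i = lower (amount \<tau> ts (ts ! i)) (ts ! i)"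
  by (simp add: lowered_def)

lemma map_leaves_lowered: "map leaves (lowered \<tau> ts) = map leaves ts"
  by (simp add: lowered_def)

lemma map_shape_lowered: "map shape (lowered \<tau> ts) = map shape ts"
  by (simp add: lowered_def lower_def tree.map_comp o_def case_prod_beta)

text \<open>Amounts depend only on heights. Since a move preserves the height of its branch, it
  changes neither the amounts nor the other lowered branches.\<close>

lemma lowered_update:
  assumes "b < length ts" and "height S = height S'"
  shows "min_height (ts[b := S]) = min_height (ts[b := S'])"
    and "amount \<tau> (ts[b := S]) = amount \<tau> (ts[b := S'])"
    and "lowered \<tau> (ts[b := S]) = (lowered \<tau> (ts[b := S']))[b := lower (amount \<tau> (ts[b := S']) S') S]"
    and "i < length ts \<Longrightarrow> height (ts[b := S] ! i) = height (ts[b := S'] ! i)"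
proof -
  have "map height (ts[b := S]) = map height (ts[b := S'])"
    using assms by (simp add: map_update)
  then show m: "min_height (ts[b := S]) = min_height (ts[b := S'])" by (simp only: min_height_def)
  then show a: "amount \<tau> (ts[b := S]) = amount \<tau> (ts[b := S'])" by (simp add: amount_def fun_eq_iff)
  have "amount \<tau> (ts[b := S']) S = amount \<tau> (ts[b := S']) S'" using assms(2) by (simp add: amount_def)
  then show "lowered \<tau> (ts[b := S]) = (lowered \<tau> (ts[b := S']))[b := lower (amount \<tau> (ts[b := S']) S') S]"
    using assms(1) a by (intro nth_equalityI) (auto simp: nth_list_update)
  show "height (ts[b := S] ! i) = height (ts[b := S'] ! i)" if "i < length ts"
    using that assms by (simp add: nth_list_update)
qed

context reduced_module
begin

lemma min_height_nonneg: "ts \<in> forests n \<Longrightarrow> 0 \<le> min_height ts"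
  using good_le_height[of Q 0] by (auto simp: min_height_def forests_def)

lemma amount_bounds:
  assumes "ts \<in> forests n" and "S \<in> set ts" and "0 \<le> \<tau>"
  shows "0 \<le> amount \<tau> ts S" and "amount \<tau> ts S \<le> 1 - height S"
proof -
  have "height S \<le> 1" using assms(1,2) good_height_le[of Q 0 S] by (auto simp: forests_def)
  then show "0 \<le> amount \<tau> ts S" using min_height_nonneg[OF assms(1)] min_height_le_1[of ts] assms(3) by (simp add: amount_def)
qed (simp add: amount_def)

lemma lowered_forests: "ts \<in> forests n \<Longrightarrow> 0 \<le> \<tau> \<Longrightarrow> lowered \<tau> ts \<in> forests n"
  using amount_bounds(1)[of ts n] good_lower[where b=0 and b'=0 and Q=Q] by (auto simp: forests_def lowered_def)

lemma lowered_id: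
  assumes ts: "ts \<in> forests n" and z: "\<And>S. S \<in> set ts \<Longrightarrow> amount \<tau> ts S = 0"
  shows "lowered \<tau> ts = ts"
  unfolding lowered_def using ts by (intro map_idI) (auto simp: z forests_def intro: lower_0)

text \<open>The assumptions on \<open>\<tau>\<close> give m \<le> \<tau>(1 - m) \<le> 1 - m for the
  minimal height m, so in \<open>amount\<close> the minimum is m, and the branch has height at most
  1/2 and therefore no leaves.\<close>

lemma lowered_zero:
  assumes ts: "ts \<in> forests n" and i: "i < n" "height (ts ! i) = min_height ts"
    and \<tau>: "\<tau> \<le> 1" "min_height ts \<le> \<tau> * (1 - min_height ts)"
  shows "leaves (lowered \<tau> ts ! i) = 0 \<and> (\<forall>d\<in>set_tree (lowered \<tau> ts ! i). fst d = 0)"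
proof -
  have l: "length ts = n" using ts by (rule forests_length)
  have "\<tau> * (1 - min_height ts) \<le> 1 * (1 - min_height ts)" using \<tau>(1) min_height_le_1[of ts] by (intro mult_right_mono) auto
  then have m: "min_height ts \<le> 1 - min_height ts" using \<tau>(2) by simp
  then have "leaves (ts ! i) = 0" using i(2) by (intro leaves_eq_0) simp
  moreover have "amount \<tau> ts (ts ! i) = min_height ts" using \<tau>(2) m i(2) by (simp add: amount_def)
  ultimately show ?thesis using i l lower_eq_0[of "ts ! i" "min_height ts"] by auto
qed

end

section \<open>The lifting problem over a compact base\<close>

locale lifting_problem = reduced_module Q M
  for Q :: "'q operad_data" and M :: "('p, 'q, 'm) bimodule_data" +
  fixes n :: nat and Z :: "(nat \<Rightarrow> real) topology"
    and u :: "(nat \<Rightarrow> real) \<Rightarrow> ('q, 'm) family"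
    and v :: "(nat \<Rightarrow> real) \<times> real \<Rightarrow> (nat \<times> (nat \<Rightarrow> nat) \<Rightarrow> ('q, 'm) family)"
  assumes Z: "compact_Hausdorff Z"
    and u: "continuous_map Z (Mf_space Q M n) u"
    and v: "continuous_map (prod_topology Z (top_of_set {0..1})) (matching_object Q (Mf Q M) n) v"
    and uv: "\<And>a. a \<in> topspace Z \<Longrightarrow> matching_map Q (Mf Q M) n (u a) = v (a, 0)"
begin

abbreviation cyl :: "((nat \<Rightarrow> real) \<times> real) topology" where
  "cyl \<equiv> prod_topology Z (top_of_set {0..1})"

lemma u_in: "a \<in> topspace Z \<Longrightarrow> u a \<in> topspace (Mf_space Q M n)"
  using continuous_map_image_subset_topspace[OF u] by blast

lemma v_in: "z \<in> topspace cyl \<Longrightarrow> v z \<in> topspace (matching_object Q (Mf Q M) n)"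
  using continuous_map_image_subset_topspace[OF v] by blast

definition idx :: "(real \<times> 'q) tree list \<Rightarrow> nat" where
  "idx ts = (LEAST i. i < n \<and> height (ts ! i) = min_height ts)"

text \<open>Composition with the retraction: where it ends at time 0, \<open>u\<close> is evaluated;
  elsewhere it ends at a forest with a branch of height 0, whose value at the remaining time is
  prescribed by a face of \<open>v\<close>.\<close>

definition lift :: "(nat \<Rightarrow> real) \<times> real \<Rightarrow> (real \<times> 'q) tree list \<Rightarrow> 'm" where
  "lift z ts = (case z of (s, \<tau>) \<Rightarrow>
     if \<tau> * (1 - min_height ts) \<le> min_height ts then val (u s) (lowered \<tau> ts)
     else val (face n (v (s, \<tau> * (1 - min_height ts) - min_height ts)) (idx ts)) (del (idx ts) (lowered \<tau> ts)))"

lemma remaining_time: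
  assumes "(s, \<tau>) \<in> topspace cyl" and "ts \<in> forests n" and "min_height ts \<le> \<tau> * (1 - min_height ts)"
  shows "(s, \<tau> * (1 - min_height ts) - min_height ts) \<in> topspace cyl" and "min_height ts < 1"
proof -
  have "0 \<le> min_height ts" "min_height ts \<le> 1" "0 \<le> \<tau>" "\<tau> \<le> 1"
    using assms min_height_nonneg min_height_le_1 by auto
  moreover have "\<tau> * (1 - min_height ts) \<le> 1 * (1 - min_height ts)" using calculation by (intro mult_right_mono) auto
  ultimately show "(s, \<tau> * (1 - min_height ts) - min_height ts) \<in> topspace cyl" "min_height ts < 1"
    using assms(1,3) by auto
qed

lemma idx:
  assumes "ts \<in> forests n" and "min_height ts < 1"
  shows "idx ts < n" and "height (ts ! idx ts) = min_height ts"
  using LeastI_ex[of "\<lambda>i. i < n \<and> height (ts ! i) = min_height ts"] min_height_attained[OF assms(2)] forests_length[OF assms(1)]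
  unfolding idx_def by blast+

lemma lift_first:
  "\<tau> * (1 - min_height ts) \<le> min_height ts \<Longrightarrow> lift (s, \<tau>) ts = val (u s) (lowered \<tau> ts)"
  by (simp add: lift_def)

text \<open>Extends the second formula to the boundary between the two cases and to any branch of
  minimal height. This is the consistency needed for gluing and for compatibility with
  moves.\<close>

lemma lift_second:
  assumes z: "(s, \<tau>) \<in> topspace cyl" and ts: "ts \<in> forests n"
    and t: "min_height ts \<le> \<tau> * (1 - min_height ts)" and i: "i < n" "height (ts ! i) = min_height ts"
  shows "lift (s, \<tau>) ts = val (face n (v (s, \<tau> * (1 - min_height ts) - min_height ts)) i) (del i (lowered \<tau> ts))"
proof -
  let ?x = "v (s, \<tau> * (1 - min_height ts) - min_height ts)" and ?L = "lowered \<tau> ts"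
  have \<tau>: "0 \<le> \<tau>" "\<tau> \<le> 1" and s: "s \<in> topspace Z" using z by auto
  have L: "?L \<in> forests n" using ts \<tau>(1) by (rule lowered_forests)
  have zero: "leaves (?L ! i) = 0 \<and> (\<forall>d\<in>set_tree (?L ! i). fst d = 0)"
    if "i < n" "height (ts ! i) = min_height ts" for i
    using ts that \<tau>(2) t by (rule lowered_zero)
  show ?thesis
  proof (cases "\<tau> * (1 - min_height ts) \<le> min_height ts")
    case True
    \<comment> \<open>On the boundary the remaining time is 0. There the zero branch is contracted
      to a stump, and \<open>u\<close> is compared with \<open>v\<close> by the commutativity of the
      square.\<close>
    have "lift (s, \<tau>) ts = val (u s) (?L[i := ?L ! i])" using True by (simp add: lift_first)
    also have "\<dots> = val (u s) (?L[i := stump])"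
      using zero[OF i] i L
      by (intro compatible_zero_branch[OF Mf_space_compatible[OF u_in[OF s]]] forests_nth[OF L]) auto
    also have "\<dots> = val (cap n i (u s)) (del i (?L[i := stump]))"
      using i(1) forests_length[OF L] by (intro val_cap_del[symmetric] forests_update[OF L good_stump]) auto
    also have "\<dots> = val (face n (v (s, 0)) i) (del i ?L)"
      using face_matching_map[OF u_in[OF s] i(1)] uv[OF s] by (simp add: del_update_same)
    finally show ?thesis using True t by simp
  next
    case False
    have m: "min_height ts < 1" and x: "?x \<in> topspace (matching_object Q (Mf Q M) n)"
      using remaining_time[OF z ts t] v_in by blast+
    have "lift (s, \<tau>) ts = val (face n ?x (idx ts)) (del (idx ts) ?L)"
      using False by (simp add: lift_def)
    also have "\<dots> = val (face n ?x i) (del i ?L)"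
      using zero idx[OF ts m] i by (intro face_independent[OF x _ _ L]) auto
    finally show ?thesis .
  qed
qed

lemma lift_in:
  assumes z: "z \<in> topspace cyl" and ts: "ts \<in> forests n"
  shows "lift z ts \<in> topspace (bm_space M (total ts))"
proof -
  obtain s \<tau> where st: "z = (s, \<tau>)" by fastforce
  have \<tau>: "0 \<le> \<tau>" "\<tau> \<le> 1" and s: "s \<in> topspace Z" using z by (auto simp: st)
  have L: "lowered \<tau> ts \<in> forests n" using ts \<tau>(1) by (rule lowered_forests)
  show ?thesis
  proof (cases "\<tau> * (1 - min_height ts) \<le> min_height ts")
    case True
    then show ?thesis using val_closed[OF u_in[OF s] L] by (simp add: st lift_first map_leaves_lowered)
  next
    case False
    then have t: "min_height ts \<le> \<tau> * (1 - min_height ts)" by simp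
    note r = remaining_time[OF z[unfolded st] ts t]
    note i = idx[OF ts r(2)]
    have "leaves (lowered \<tau> ts ! idx ts) = 0" using lowered_zero[OF ts i \<tau>(2) t] by simp
    then have "total (del (idx ts) (lowered \<tau> ts)) = total ts"
      using i(1) forests_length[OF L] by (simp add: total_del map_leaves_lowered)
    then show ?thesis
      using val_closed[OF face_in_Mf_space[OF v_in[OF r(1)] i(1)] forests_del[OF L i(1)]]
        lift_second[OF z[unfolded st] ts t i] by (simp add: st)
  qed
qed

text \<open>A move lowers to a move with the same operation, so the compatibility of
  \<open>u s\<close> or of a face carries over, unless the moved branch is the deleted one.\<close>

lemma compatible_lift:
  assumes z: "z \<in> topspace cyl"
  shows "compatible n (lift z)"
  unfolding compatible_def
proof (intro allI impI, elim conjE)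
  fix ts b S S' \<phi>
  assume ts: "ts \<in> forests n" and b: "b < n" and S: "good Q 0 S" and S': "good Q 0 S'"
    and m: "move Q M S S' \<phi>"
  obtain s \<tau> where st: "z = (s, \<tau>)" by fastforce
  have \<tau>: "0 \<le> \<tau>" "\<tau> \<le> 1" and s: "s \<in> topspace Z" using z by (auto simp: st)
  let ?A = "ts[b := S]" and ?A' = "ts[b := S']"
  have l: "length ts = n" using ts by (rule forests_length)
  have A: "?A \<in> forests n" "?A' \<in> forests n" using ts S S' by (auto intro: forests_update)
  have height: "height S = height S'" using m S S' by (rule move_height)
  \<comment> \<open>Both branches have the same height, so one amount serves for both.\<close>
  let ?c = "amount \<tau> ?A' S'"
  let ?R = "lower ?c S" and ?R' = "lower ?c S'" and ?L = "lowered \<tau> ?A'"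
  have bl: "b < length ts" using b l by simp
  note upd = lowered_update[OF bl height]
  have L: "?L \<in> forests n" and LA: "lowered \<tau> ?A \<in> forests n" using A \<tau>(1) by (auto intro: lowered_forests)
  have L': "?L = ?L[b := ?R']" using bl by (intro nth_equalityI) (auto simp: nth_list_update)
  have c: "0 \<le> ?c" "?c \<le> 1 - height S"
    using amount_bounds[OF A(2) _ \<tau>(1), of S'] bl height by (auto simp: set_update_memI)
  have m': "move Q M ?R ?R' \<phi>" using m S S' c by (rule move_lower)
  have R: "good Q 0 ?R" "good Q 0 ?R'" using S S' c(1) by (auto intro: good_lower)
  have tot: "total ?L = total ?A'" by (simp only: map_leaves_lowered)
  have take: "total (take b ?L) = total (take b ts)"
    by (simp only: take_map[symmetric] map_leaves_lowered) (simp add: take_map)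
  show "lift z ?A = \<phi> (total ?A') (total (take b ts)) (lift z ?A')"
  proof (cases "\<tau> * (1 - min_height ?A') \<le> min_height ?A'")
    case True
    have "val (u s) (?L[b := ?R]) = \<phi> (total (?L[b := ?R'])) (total (take b ?L)) (val (u s) (?L[b := ?R']))"
      by (rule compatibleD[OF Mf_space_compatible[OF u_in[OF s]] L b R m'])
    then show ?thesis
      using True by (simp only: st lift_first upd(1,3) L'[symmetric] tot take)
  next
    case False
    then have t: "min_height ?A' \<le> \<tau> * (1 - min_height ?A')" "min_height ?A \<le> \<tau> * (1 - min_height ?A)" unfolding upd(1) by auto
    note r = remaining_time[OF z[unfolded st] A(2) t(1)]
    define i where "i = idx ?A'"
    have i: "i < n" "height (?A' ! i) = min_height ?A'" using idx[OF A(2) r(2)] by (auto simp: i_def)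
    \<comment> \<open>The same branch is minimal in both forests, so one \<open>i\<close> can be
      used on both sides instead of two values of \<open>idx\<close>.\<close>
    have iA: "height (?A ! i) = min_height ?A" using i upd(1,4) l by metis
    let ?f = "face n (v (s, \<tau> * (1 - min_height ?A') - min_height ?A')) i"
    have f: "?f \<in> topspace (Mf_space Q M (n - 1))" using face_in_Mf_space[OF v_in[OF r(1)] i(1)] .
    have lift: "lift z ?A = val ?f (del i (?L[b := ?R]))" "lift z ?A' = val ?f (del i ?L)"
      using lift_second[OF z[unfolded st] A(1) t(2) i(1) iA] lift_second[OF z[unfolded st] A(2) t(1) i]
      by (simp_all only: st upd(1,3))
    show ?thesis
    proof (cases "b = i")
      case True
      have "height S < 1" using i(2) r(2) bl height True by simp
      then show ?thesis
        using move_trivial[OF m S S' _ lift_in[OF z A(2)]]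
        unfolding lift by (simp add: True del_update_same)
    next
      case False
      let ?b = "if b < i then b else b - 1"
      have lv: "leaves (?L ! i) = 0" using lowered_zero[OF A(2) i \<tau>(2) t(1)] by simp
      have il: "i < length ?L" using i(1) l by simp
      have up: "del i (?L[b := X]) = (del i ?L)[?b := X]" for X
        using bl il False by (intro del_update) auto
      have upR: "(del i ?L)[?b := ?R'] = del i ?L" unfolding up[symmetric] L'[symmetric] ..
      have "val ?f ((del i ?L)[?b := ?R]) = \<phi> (total ((del i ?L)[?b := ?R'])) (total (take ?b (del i ?L)))
          (val ?f ((del i ?L)[?b := ?R']))"
        using b i(1) False
        by (intro compatibleD[OF Mf_space_compatible[OF f] forests_del[OF L i(1)] _ R m']) auto
      moreover have "total (take ?b (del i ?L)) = total (take b ts)"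
        unfolding take[symmetric] using il lv False by (rule total_take_del)
      moreover have "total (del i ?L) = total ?A'"
        unfolding tot[symmetric] using il lv by (rule total_del)
      ultimately show ?thesis unfolding lift up upR by (simp only:)
    qed
  qed
qed

text \<open>The closed piece \<open>n\<close> is the region evaluated by \<open>u\<close>; on the
  closed piece \<open>i < n\<close> the remaining time is nonnegative and branch \<open>i\<close>
  has minimal height. On each piece a single formula without \<open>idx\<close> holds, and the
  finitely many pieces are pasted.\<close>

lemma continuous_map_lift:
  fixes K :: "((nat list \<Rightarrow> real) \<times> (nat list \<Rightarrow> 'q)) huge topology"
  assumes T: "T \<in> trees n" and K: "compact_Hausdorff K" and \<kappa>: "continuous_map K (HD_space Q T) \<kappa>"
  shows "continuous_map (prod_topology cyl K) (bm_space M (leaves T)) (\<lambda>(z, x). lift z (forest_of T (\<kappa> x)))"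
proof -
  let ?W = "prod_topology cyl K"
  define s where "s c = fst (fst c)" for c :: "((nat \<Rightarrow> real) \<times> real) \<times> ((nat list \<Rightarrow> real) \<times> (nat list \<Rightarrow> 'q)) huge"
  define \<tau> where "\<tau> c = snd (fst c)" for c :: "((nat \<Rightarrow> real) \<times> real) \<times> ((nat list \<Rightarrow> real) \<times> (nat list \<Rightarrow> 'q)) huge"
  define x where "x c = \<kappa> (snd c)" for c :: "((nat \<Rightarrow> real) \<times> real) \<times> ((nat list \<Rightarrow> real) \<times> (nat list \<Rightarrow> 'q)) huge"
  define F where "F c = forest_of T (x c)" for c
  define time where "time c = \<tau> c * (1 - min_height (F c))" for c
  have W: "compact_Hausdorff ?W"
    using Z K by (intro compact_Hausdorff_prod) (auto simp: compact_space_subtopology Hausdorff_space_subtopology)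
  \<comment> \<open>The pieces are themselves compact test spaces for the space of decorations,
    which requires embedding their type.\<close>
  obtain e :: "((nat \<Rightarrow> real) \<times> real) \<times> ((nat list \<Rightarrow> real) \<times> (nat list \<Rightarrow> 'q)) huge
      \<Rightarrow> ((nat list \<Rightarrow> real) \<times> (nat list \<Rightarrow> 'q)) huge" where e: "inj e"
  proof -
    obtain e1 :: "(nat \<Rightarrow> real) \<Rightarrow> ((nat list \<Rightarrow> real) \<times> (nat list \<Rightarrow> 'q)) huge"
      and e2 :: "real \<Rightarrow> ((nat list \<Rightarrow> real) \<times> (nat list \<Rightarrow> 'q)) huge"
      where "inj e1" "inj e2" using ex_inj_huge_fun ex_inj_huge_real by metis
    then obtain e3 :: "(nat \<Rightarrow> real) \<times> real \<Rightarrow> ((nat list \<Rightarrow> real) \<times> (nat list \<Rightarrow> 'q)) huge" where "inj e3"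
      using ex_inj_huge_Pair by blast
    then show thesis using ex_inj_huge_Pair[OF _ inj_on_id] that by blast
  qed
  have cs: "continuous_map ?W Z s"
    unfolding s_def using continuous_map_compose[OF continuous_map_fst continuous_map_fst] by (simp add: o_def)
  have c\<tau>: "continuous_map ?W euclideanreal \<tau>"
    unfolding \<tau>_def
    using continuous_map_into_fulltopology[OF continuous_map_compose[OF continuous_map_fst continuous_map_snd]]
    by (simp add: o_def)
  have cx: "continuous_map ?W (HD_space Q T) x"
    unfolding x_def using continuous_map_compose[OF continuous_map_snd \<kappa>] by (simp add: o_def)
  have xin: "x c \<in> topspace (HD_space Q T)" if "c \<in> topspace ?W" for c
    using continuous_map_image_subset_topspace[OF cx] that by blast
  have Fin: "F c \<in> forests n" if "c \<in> topspace ?W" for c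
    unfolding F_def using T xin[OF that] by (rule forest_of_forests)
  have sin: "s c \<in> topspace Z" "0 \<le> \<tau> c" "\<tau> c \<le> 1" "(s c, \<tau> c) \<in> topspace cyl" if "c \<in> topspace ?W" for c
    using that by (auto simp: s_def \<tau>_def)
  have kidsT: "length (kids T) = n" "T = Vert () (kids T)" using T by (auto simp: trees_def)
  have shF: "map shape (F c) = kids T" for c
    unfolding F_def using shape_forest_of[OF T] by (metis kids.simps(2))
  have lF: "length (F c) = n" for c using shF[of c] kidsT(1) by (metis length_map)
  have nthF: "F c ! i = decorate (kids T ! i) (\<lambda>a. (fst (x c) (i # a), snd (x c) (i # a)))" if "i < n" for c i
    using that T by (auto simp: F_def forest_of_def trees_def)
  have cmx: "continuous_map ?W euclideanreal (\<lambda>c. height (F c ! i))" if i: "i < n" for i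
    unfolding nthF[OF i]
  proof (rule continuous_map_height)
    fix a assume "a \<in> verts (kids T ! i)"
    then have "i # a \<in> inner_vertices T"
      using i kidsT(1) by (subst kidsT(2)) (simp add: inner_vertices_verts)
    then show "continuous_map ?W euclideanreal (\<lambda>c. fst (fst (x c) (i # a), snd (x c) (i # a)))"
      using continuous_map_HD_coord[OF cx] by simp
  qed
  have cmn: "continuous_map ?W euclideanreal (\<lambda>c. min_height (F c))"
  proof -
    have "min_height (F c) = Min (insert 1 ((\<lambda>i. height (F c ! i)) ` {..<n}))" for c
    proof -
      have "set (F c) = (!) (F c) ` {..<n}"
        using lF[of c] by (auto simp: in_set_conv_nth)
      then have "set (map height (F c)) = (\<lambda>i. height (F c ! i)) ` {..<n}"
        by (simp add: image_image)
      then show ?thesis by (simp only: min_height_def)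
    qed
    moreover have "continuous_map ?W euclideanreal (\<lambda>c. Min (insert 1 ((\<lambda>i. height (F c ! i)) ` {..<n})))"
      using cmx by (intro continuous_map_Min_insert) auto
    ultimately show ?thesis by simp
  qed
  have ctime: "continuous_map ?W euclideanreal time"
    unfolding time_def using c\<tau> cmn by (intro continuous_map_real_mult continuous_map_diff) auto
  have camt: "continuous_map ?W euclideanreal (\<lambda>c. amount (\<tau> c) (F c) (F c ! i))" if "i < n" for i
    unfolding amount_def time_def[symmetric] using ctime cmn cmx[OF that]
    by (intro continuous_map_real_min continuous_map_diff) auto
  have lab: "label (Vert undefined (lowered (\<tau> c) (F c))) (i # a)
      = (max 0 (fst (x c) (i # a) - amount (\<tau> c) (F c) (F c ! i)), snd (x c) (i # a))"
    if i: "i < n" and a: "a \<in> verts (kids T ! i)" for c i a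
  proof -
    have "label (Vert undefined (lowered (\<tau> c) (F c))) (i # a) = label (lower (amount (\<tau> c) (F c) (F c ! i)) (F c ! i)) a"
      using i lF by simp
    also have "\<dots> = (\<lambda>(t, q). (max 0 (t - amount (\<tau> c) (F c) (F c ! i)), q)) (label (F c ! i) a)"
      unfolding lower_def using a by (intro label_map_tree) (simp add: nthF[OF i])
    finally show ?thesis using a by (simp add: nthF[OF i] label_decorate)
  qed
  have clab: "continuous_map ?W euclideanreal (\<lambda>c. max 0 (fst (x c) (i # a) - amount (\<tau> c) (F c) (F c ! i)))"
    if i: "i < n" and a: "a \<in> verts (kids T ! i)" for i a
  proof -
    have "i # a \<in> inner_vertices T"
      using i a kidsT(1) by (subst kidsT(2)) (simp add: inner_vertices_verts)
    then show ?thesis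
      using continuous_map_HD_coord[OF cx] camt[OF i]
      by (intro continuous_map_real_max continuous_map_diff) auto
  qed
  have aT: "arity T (i # a) = arity (kids T ! i) a" "i # a \<in> inner_vertices T"
    if "i < n" "a \<in> verts (kids T ! i)" for i a
    using that T by (auto simp: inner_vertices_verts trees_def)
  define piece where "piece i = (if i = n then {c \<in> topspace ?W. time c \<le> min_height (F c)}
      else {c \<in> topspace ?W. min_height (F c) \<le> time c} \<inter> {c \<in> topspace ?W. height (F c ! i) \<le> min_height (F c)})" for i
  define on_piece where "on_piece i c = (if i = n then val (u (s c)) (lowered (\<tau> c) (F c))
      else val (face n (v (s c, time c - min_height (F c))) i) (del i (lowered (\<tau> c) (F c))))" for i c
  have closed: "closedin ?W (piece i)" if "i \<in> {..n}" for i
  proof (cases "i = n")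
    case True
    then show ?thesis unfolding piece_def using closedin_le[OF ctime cmn] by simp
  next
    case False
    then have "i < n" using that by simp
    then show ?thesis unfolding piece_def
      using closedin_Int[OF closedin_le[OF cmn ctime] closedin_le[OF cmx cmn]] False by simp
  qed
  have on_piece: "lift (fst c) (F c) = on_piece i c" if "i \<in> {..n}" "c \<in> topspace ?W \<inter> piece i" for i c
  proof -
    have c: "c \<in> topspace ?W" and z: "fst c = (s c, \<tau> c)" using that by (auto simp: s_def \<tau>_def)
    show ?thesis
    proof (cases "i = n")
      case True
      then show ?thesis using that lift_first by (simp add: z piece_def on_piece_def time_def)
    next
      case False
      then have i: "i < n" "height (F c ! i) \<le> min_height (F c)" "min_height (F c) \<le> \<tau> c * (1 - min_height (F c))"
        using that by (auto simp: piece_def time_def)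
      have "height (F c ! i) = min_height (F c)" using i lF[of c] min_height_le[of "F c ! i" "F c"] by simp
      then show ?thesis
        using lift_second[OF sin(4)[OF c] Fin[OF c] i(3,1)] False by (simp add: z on_piece_def time_def)
    qed
  qed
  have cont: "continuous_map (subtopology ?W (piece i)) (bm_space M (leaves T)) (on_piece i)" if i: "i \<in> {..n}" for i
  proof -
    let ?C = "subtopology ?W (piece i)"
    have C: "compact_Hausdorff ?C" using W closed[OF i] by (rule compact_Hausdorff_subtopology)
    have tC: "c \<in> topspace ?W" "c \<in> piece i" if "c \<in> topspace ?C" for c using that by auto
    note sub = continuous_map_from_subtopology[of ?W _ _ "piece i"]
    have L: "lowered (\<tau> c) (F c) \<in> forests n" if "c \<in> topspace ?C" for c
      using Fin[OF tC(1)[OF that]] sin(2)[OF tC(1)[OF that]] by (rule lowered_forests)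
    show ?thesis
    proof (cases "i = n")
      case True
      have shape: "Vert () (map shape (lowered (\<tau> c) (F c))) = T" for c
        by (simp only: map_shape_lowered shF kidsT(2)[symmetric])
      have d: "continuous_map ?C (HD_space Q T) (\<lambda>c. decorations (Vert undefined (lowered (\<tau> c) (F c))))"
      proof (rule continuous_map_decorations[OF C e sub[OF cx] T L shape])
        fix w assume "w \<in> inner_vertices T"
        then obtain j a where w: "w = j # a" "j < n" "a \<in> verts (kids T ! j)"
          using T by (auto simp: inner_vertices_Vert trees_def)
        show "continuous_map ?C euclideanreal (\<lambda>c. fst (label (Vert undefined (lowered (\<tau> c) (F c))) w))"
          unfolding w(1) lab[OF w(2,3)] fst_conv by (rule sub[OF clab[OF w(2,3)]])
        show "(\<exists>w'\<in>inner_vertices T. arity T w' = arity T w \<and>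
            (\<forall>c\<in>topspace ?C. snd (label (Vert undefined (lowered (\<tau> c) (F c))) w) = snd (x c) w')) \<or>
          (\<exists>y\<in>topspace (op_space Q (arity T w)).
            \<forall>c\<in>topspace ?C. snd (label (Vert undefined (lowered (\<tau> c) (F c))) w) = y)"
          using aT[OF w(2,3)] unfolding w(1) lab[OF w(2,3)] snd_conv by blast
      qed
      have "continuous_map ?W (Map (HD_space Q T) (bm_space M (leaves T))) (\<lambda>c. u (s c) T)"
        using continuous_map_compose[OF continuous_map_compose[OF cs u] continuous_map_Mf_component[OF T]]
        by (simp add: o_def)
      from continuous_map_Map_apply[OF C e sub[OF this] d]
      show ?thesis
        using True by (simp add: on_piece_def[abs_def] val_def value_at_def shape[simplified])
    next
      case False
      then have i: "i < n" using i by simp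
      let ?T = "Vert () (del i (kids T))"
      have T': "?T \<in> trees (n - 1)" using i kidsT(1) by (simp add: trees_def)
      have shape: "Vert () (map shape (del i (lowered (\<tau> c) (F c)))) = ?T" for c
        by (simp add: del_map[symmetric] map_shape_lowered shF)
      have d: "continuous_map ?C (HD_space Q ?T) (\<lambda>c. decorations (Vert undefined (del i (lowered (\<tau> c) (F c)))))"
      proof (rule continuous_map_decorations[OF C e sub[OF cx] T' forests_del[OF L i] shape])
        fix w assume "w \<in> inner_vertices ?T"
        then obtain j a where w: "w = j # a" "j < n - 1" "a \<in> verts (del i (kids T) ! j)"
          using i kidsT(1) by (auto simp: inner_vertices_Vert)
        let ?j = "if j < i then j else Suc j"
        have j: "?j < n" using w(2) i by auto
        have a: "a \<in> verts (kids T ! ?j)" using w(2,3) i kidsT(1) by (simp add: nth_del split: if_splits)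
        have lab': "label (Vert undefined (del i (lowered (\<tau> c) (F c)))) w = label (Vert undefined (lowered (\<tau> c) (F c))) (?j # a)" for c
          using w(1,2) i lF[of c] j by (simp add: nth_del)
        have ar: "arity ?T w = arity T (?j # a)"
          using w(1,2) i kidsT(1) aT(1)[OF j a] by (simp add: nth_del)
        show "continuous_map ?C euclideanreal (\<lambda>c. fst (label (Vert undefined (del i (lowered (\<tau> c) (F c)))) w))"
          unfolding lab' lab[OF j a] fst_conv by (rule sub[OF clab[OF j a]])
        show "(\<exists>w'\<in>inner_vertices T. arity T w' = arity ?T w \<and>
            (\<forall>c\<in>topspace ?C. snd (label (Vert undefined (del i (lowered (\<tau> c) (F c)))) w) = snd (x c) w')) \<or>
          (\<exists>y\<in>topspace (op_space Q (arity ?T w)).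
            \<forall>c\<in>topspace ?C. snd (label (Vert undefined (del i (lowered (\<tau> c) (F c)))) w) = y)"
          using aT(2)[OF j a] unfolding lab' lab[OF j a] snd_conv ar by blast
      qed
      have "continuous_map ?C cyl (\<lambda>c. (s c, time c - min_height (F c)))"
      proof (rule continuous_map_pairedI[OF sub[OF cs]], rule continuous_map_into_subtopology)
        show "continuous_map ?C euclideanreal (\<lambda>c. time c - min_height (F c))"
          using sub[OF ctime] sub[OF cmn] by (rule continuous_map_diff)
        show "(\<lambda>c. time c - min_height (F c)) \<in> topspace ?C \<rightarrow> {0..1}"
        proof
          fix c assume c: "c \<in> topspace ?C"
          then have "min_height (F c) \<le> \<tau> c * (1 - min_height (F c))" using False by (simp add: piece_def time_def)
          from remaining_time(1)[OF sin(4) Fin this] tC(1)[OF c]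
          show "time c - min_height (F c) \<in> {0..1}" by (simp add: time_def)
        qed
      qed
      from continuous_map_compose[OF continuous_map_compose[OF continuous_map_compose[OF this v] continuous_map_face[OF i]]
          continuous_map_Mf_component[OF T']]
      have "continuous_map ?C (Map (HD_space Q ?T) (bm_space M (leaves ?T)))
          (\<lambda>c. face n (v (s c, time c - min_height (F c))) i ?T)"
        by (simp add: o_def)
      from continuous_map_Map_apply[OF C e this d]
      have c: "continuous_map ?C (bm_space M (leaves ?T)) (on_piece i)"
        using False by (simp add: on_piece_def[abs_def] val_def value_at_def shape[simplified])
      \<comment> \<open>The formula takes values in arity \<open>leaves ?T\<close>. At any point of
        the piece branch \<open>i\<close> has height below 1, hence no leaves; leaf counts depend
        only on \<open>T\<close>, so one point suffices, and an empty piece is trivial.\<close>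
      have lT: "leaves ?T = leaves T" if "c \<in> topspace ?C" for c
      proof -
        have "height (F c ! i) = min_height (F c)" "min_height (F c) \<le> \<tau> c * (1 - min_height (F c))"
          using tC(2)[OF that] False i lF[of c] min_height_le[of "F c ! i" "F c"] by (auto simp: piece_def time_def)
        then have "height (F c ! i) < 1" using remaining_time(2)[OF sin(4) Fin] tC(1)[OF that] by simp
        then have "leaves (F c ! i) = 0" by (rule leaves_eq_0)
        moreover have "F c ! i = decorate (kids T ! i) (\<lambda>a. (fst (x c) (i # a), snd (x c) (i # a)))" by (rule nthF[OF i])
        ultimately have "leaves (kids T ! i) = 0" by (metis leaves_map_tree shape_decorate)
        then have "total (del i (kids T)) = total (kids T)" using i kidsT(1) by (intro total_del) auto
        then show ?thesis using kidsT(2) by (metis leaves.simps(2))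
      qed
      show ?thesis
      proof (cases "topspace ?C = {}")
        case True
        show ?thesis unfolding continuous_map_def True by simp
      next
        case False
        then show ?thesis using c lT by (metis all_not_in_conv)
      qed
    qed
  qed
  have "continuous_map ?W (bm_space M (leaves T)) (\<lambda>c. lift (fst c) (F c))"
  proof (rule pasting_lemma_closed[of "{..n}", OF _ closed cont])
    show "on_piece i c = on_piece j c" if "i \<in> {..n}" "j \<in> {..n}" "c \<in> topspace ?W \<inter> piece i \<inter> piece j" for i j c
      using that on_piece[of i c] on_piece[of j c] by auto
    show "\<exists>j. j \<in> {..n} \<and> c \<in> piece j \<and> lift (fst c) (F c) = on_piece j c" if c: "c \<in> topspace ?W" for c
    proof (cases "time c \<le> min_height (F c)")
      case True
      then have "c \<in> piece n" using c by (simp add: piece_def)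
      then show ?thesis using on_piece[of n c] c by blast
    next
      case False
      then have m: "min_height (F c) \<le> \<tau> c * (1 - min_height (F c))" by (simp add: time_def)
      then have "min_height (F c) < 1" using remaining_time(2)[OF sin(4) Fin] c by blast
      then obtain i where "i < n" "height (F c ! i) = min_height (F c)" using min_height_attained[of "F c"] lF[of c] by auto
      then have "i \<in> {..n}" "c \<in> piece i" using c False by (auto simp: piece_def)
      then show ?thesis using on_piece[of i c] c by blast
    qed
  qed auto
  then show ?thesis by (simp add: F_def x_def case_prod_beta')
qed

lemma fam_lift_in:
  assumes z: "z \<in> topspace cyl"
  shows "fam n (lift z) \<in> topspace (Mf_space Q M n)"
proof (rule fam_in_Mf_space[OF compatible_lift[OF z]])
  fix T assume T: "T \<in> trees n"
  show "continuous_map (HD_space Q T) (bm_space M (leaves T)) (\<lambda>x. lift z (forest_of T x))"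
    unfolding HD_space_def[of Q T] kprod_def
  proof (rule continuous_map_from_kify)
    show "(\<lambda>x. lift z (forest_of T x)) \<in> topspace (prod_topology (H_space T) (D_space Q T))
        \<rightarrow> topspace (bm_space M (leaves T))"
    proof
      fix x assume "x \<in> topspace (prod_topology (H_space T) (D_space Q T))"
      then have "forest_of T x \<in> forests n" by (intro forest_of_forests[OF T]) (simp add: HD_space_def)
      from lift_in[OF z this] show "lift z (forest_of T x) \<in> topspace (bm_space M (leaves T))"
        by (simp add: total_forest_of[OF T])
    qed
    fix K :: "((nat list \<Rightarrow> real) \<times> (nat list \<Rightarrow> 'q)) huge topology" and k
    assume K: "compact_Hausdorff K" and "continuous_map K (prod_topology (H_space T) (D_space Q T)) k"
    then have k: "continuous_map K (HD_space Q T) k"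
      unfolding HD_space_def kprod_def by (intro continuous_map_into_kify[OF _ inj_on_id])
    \<comment> \<open>For fixed \<open>z\<close> this is the slice of the joint continuity at
      \<open>z\<close>.\<close>
    have "continuous_map K (prod_topology cyl K) (\<lambda>x. (z, x))"
      using z by (intro continuous_map_pairedI) auto
    from continuous_map_compose[OF this continuous_map_lift[OF T K k]]
    show "continuous_map K (bm_space M (leaves T)) ((\<lambda>x. lift z (forest_of T x)) \<circ> k)"
      by (simp add: o_def)
  qed
qed

lemma continuous_map_fam_lift: "continuous_map cyl (Mf_space Q M n) (\<lambda>z. fam n (lift z))"
proof -
  have cyl: "compact_Hausdorff cyl"
    using Z by (intro compact_Hausdorff_prod) (auto simp: compact_space_subtopology Hausdorff_space_subtopology)
  let ?Y = "product_topology (\<lambda>T. Map (HD_space Q T) (bm_space M (leaves T))) (trees n)"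
  let ?S = "{f. Mf_unit Q n f \<and> Mf_perm Q M n f \<and> Mf_contract Q n f \<and> Mf_top Q M n f}"
  \<comment> \<open>Two embeddings of the cylinder are needed: \<open>e\<close> for the k-topologies
    on families, \<open>e'\<close> for those on the individual mapping spaces.\<close>
  obtain e :: "(nat \<Rightarrow> real) \<times> real \<Rightarrow> ('q, 'm) family huge" where e: "inj e"
    using ex_inj_huge_fun ex_inj_huge_real ex_inj_huge_Pair by metis
  obtain e' :: "(nat \<Rightarrow> real) \<times> real \<Rightarrow> ((nat list \<Rightarrow> real) \<times> (nat list \<Rightarrow> 'q) \<Rightarrow> 'm) huge" where e': "inj e'"
    using ex_inj_huge_fun ex_inj_huge_real ex_inj_huge_Pair by metis
  have "continuous_map cyl ?Y (\<lambda>z. fam n (lift z))"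
  proof (rule continuous_map_coordinatewise_then_product)
    fix T assume T: "T \<in> trees n"
    show "continuous_map cyl (Map (HD_space Q T) (bm_space M (leaves T))) (\<lambda>z. fam n (lift z) T)"
    proof (rule continuous_map_into_Map[OF cyl e'])
      show "fam n (lift z) T \<in> maps (HD_space Q T) (bm_space M (leaves T))" if "z \<in> topspace cyl" for z
        using fam_lift_in[OF that] T by (simp only: topspace_Mf_space PiE_iff)
      fix K :: "((nat list \<Rightarrow> real) \<times> (nat list \<Rightarrow> 'q)) huge topology" and \<kappa>
      assume K: "compact_Hausdorff K" and \<kappa>: "continuous_map K (HD_space Q T) \<kappa>"
      show "continuous_map (prod_topology cyl K) (bm_space M (leaves T)) (\<lambda>(z, x). fam n (lift z) T (\<kappa> x))"
        using continuous_map_lift[OF T K \<kappa>]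
      proof (rule continuous_map_eq)
        fix c assume "c \<in> topspace (prod_topology cyl K)"
        then have "\<kappa> (snd c) \<in> topspace (HD_space Q T)"
          using continuous_map_image_subset_topspace[OF \<kappa>] by auto
        then show "(case c of (z, x) \<Rightarrow> lift z (forest_of T (\<kappa> x))) = (case c of (z, x) \<Rightarrow> fam n (lift z) T (\<kappa> x))"
          using T by (simp add: fam_def case_prod_beta)
      qed
    qed
  qed (simp add: fam_def)
  then have "continuous_map cyl (kify ?Y) (\<lambda>z. fam n (lift z))"
    by (rule continuous_map_into_kify[OF cyl e])
  moreover have "(\<lambda>z. fam n (lift z)) \<in> topspace cyl \<rightarrow> ?S"
  proof
    fix z assume "z \<in> topspace cyl"
    from fam_lift_in[OF this] show "fam n (lift z) \<in> ?S" by (simp add: Mf_space_def)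
  qed
  ultimately have "continuous_map cyl (subtopology (kify ?Y) ?S) (\<lambda>z. fam n (lift z))"
    by (rule continuous_map_into_subtopology)
  then show ?thesis
    unfolding Mf_space_def ksub_def kproduct_def by (rule continuous_map_into_kify[OF cyl e])
qed

lemma fam_lift_start:
  assumes a: "a \<in> topspace Z"
  shows "fam n (lift (a, 0)) = u a"
proof (rule Mf_space_eqI[OF fam_lift_in u_in[OF a]])
  show "(a, 0) \<in> topspace cyl" using a by simp
  fix ts assume ts: "ts \<in> forests n"
  have "lowered 0 ts = ts"
  proof (rule lowered_id[OF ts])
    fix S assume S: "S \<in> set ts"
    then show "amount 0 ts S = 0"
      using min_height_nonneg[OF ts] amount_bounds(1)[OF ts S, of 0] by (simp add: amount_def)
  qed
  then show "val (fam n (lift (a, 0))) ts = val (u a) ts"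
    using min_height_nonneg[OF ts] by (simp add: val_fam[OF ts] lift_first)
qed

text \<open>By \<open>matching_map_eqI\<close> only forests with a stump matter. A stump has height
  0, so nothing is lowered, the remaining time is all of \<open>\<tau>\<close>, and
  \<open>lift_second\<close> applies with the stump as the branch to be deleted.\<close>

lemma matching_map_fam_lift:
  assumes z: "z \<in> topspace cyl"
  shows "matching_map Q (Mf Q M) n (fam n (lift z)) = v z"
proof (rule matching_map_eqI[OF fam_lift_in[OF z] v_in[OF z]])
  fix j assume j: "j < n"
  obtain s \<tau> where st: "z = (s, \<tau>)" by fastforce
  have \<tau>: "0 \<le> \<tau>" using z by (simp add: st)
  show "cap n j (fam n (lift z)) = face n (v z) j"
  proof (rule Mf_space_eqI[OF cap_in_Mf_space[OF fam_lift_in[OF z] j] face_in_Mf_space[OF v_in[OF z] j]])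
    fix ts assume ts: "ts \<in> forests (n - 1)"
    let ?A = "ins stump j ts"
    have l: "length ts = n - 1" using ts by (rule forests_length)
    have A: "?A \<in> forests n" using ts j good_stump by (rule forests_ins)
    have Aj: "?A ! j = stump" using l j by (simp add: nth_ins)
    have mxs: "height stump = 0" by (simp add: height.simps(2))
    have "min_height ?A = 0"
      using min_height_nonneg[OF A] min_height_le[of stump ?A] mxs by simp
    moreover have "lowered \<tau> ?A = ?A"
    proof (rule lowered_id[OF A])
      fix S assume S: "S \<in> set ?A"
      then show "amount \<tau> ?A S = 0"
        using calculation amount_bounds(1)[OF A S \<tau>] \<tau> by (simp add: amount_def)
    qed
    ultimately have "lift z ?A = val (face n (v z) j) (del j ?A)"
      using lift_second[OF z[unfolded st] A _ j] Aj mxs \<tau> by (simp add: st)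
    moreover have "del j ?A = ts" using l j by (simp add: del_def ins_def)
    ultimately show "val (cap n j (fam n (lift z))) ts = val (face n (v z) j) ts"
      by (simp add: val_cap[OF ts] val_fam[OF A])
  qed
qed

end

context reduced_module
begin

lemma serre_fibration_matching_map:
  "serre_fibration (Mf_space Q M n) (matching_object Q (Mf Q M) n) (matching_map Q (Mf Q M) n)"
  unfolding serre_fibration_def lifting_def
proof (intro conjI allI impI, rule continuous_map_matching_map, elim conjE)
  fix k u and v :: "(nat \<Rightarrow> real) \<times> real \<Rightarrow> nat \<times> (nat \<Rightarrow> nat) \<Rightarrow> ('q, 'm) family"
  assume "continuous_map (disk k) (Mf_space Q M n) u"
    and "continuous_map (prod_topology (disk k) (top_of_set {0..1})) (matching_object Q (Mf Q M) n) v"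
    and "\<forall>a\<in>topspace (disk k). matching_map Q (Mf Q M) n (u a) = v (a, 0)"
  then interpret lifting_problem Q M n "disk k" u v
    by unfold_locales (auto simp: compact_Hausdorff_disk)
  show "\<exists>w. continuous_map (prod_topology (disk k) (top_of_set {0..1})) (Mf_space Q M n) w \<and>
      (\<forall>a\<in>topspace (disk k). w (a, 0) = u a) \<and>
      (\<forall>x\<in>topspace (prod_topology (disk k) (top_of_set {0..1})). matching_map Q (Mf Q M) n (w x) = v x)"
    using continuous_map_fam_lift fam_lift_start matching_map_fam_lift by blast
qed

end

theorem proposition3p4:
  fixes P :: "'p operad_data" and Q :: "'q operad_data" and M :: "('p, 'q, 'm) bimodule_data"
  assumes "operad P" and "operad Q" and "reduced_operad Q" and "bimodule P Q M"
    and "well_pointed Q"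
  shows "reedy_fibrant Q (Mf Q M)"
proof -
  interpret reduced_module Q M
    using assms by (intro reduced_module.intro reduced_module_axioms.intro bimodule.axioms)
  show ?thesis
    using serre_fibration_matching_map by (simp add: reedy_fibrant_def Mf_def)
qed

end
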